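(* Let $q$ and $q'$ be normally admissible presentations of the same fixed-point ideal $I$ (the ideal of a strict logarithmic self-map $f$ at an isolated fixed point $p\in D$), and let $h\in R$ be a holomorphic germ at $p$. Then $$\operatorname{SpTr}_{D,q}(h)=\operatorname{SpTr}_{D,q'}(h)=\lambda_{f,p}([h]).$$ Thus, when $h\,\mathrm dz\wedge \mathrm dw$ represents a fixed intrinsic numerator, the specialisation coefficient is independent of the admissible presentation, the adapted coordinates and the representative of $[h]\in A_{f,p}$. The normal-cone class $\operatorname{Sp}^{\log}_{D,q}(h)$ itself is attached to the chosen admissible one-parameter family; here, only its trace is claimed to be canonical.
   Context: Local setting: $D$ is a simple normal crossings divisor in a complex manifold $X$, and $f:X\to X$ is a strict logarithmic self-map, i.e. it is holomorphic and $f^{-1}\mathcal I_{D_i}\cdot\mathcal O_X=\mathcal I_{D_i}$ for each irreducible component $D_i$ of $D$. Let $p\in D$ be an isolated fixed point lying on exactly $k$ local branches of $D$. Take adapted coordinates $(z_1,\ldots,z_k,w_1,\ldots,w_m)$ centred at $p$, with $D=\{z_1\cdots z_k=0\}$, $f^*z_i=z_ia_i$ with $a_i$ units, $f^*w_\alpha=F_\alpha$; $n=k+m$, $R=\mathbb C\{z,w\}\cong\mathcal O_{X,p}$, $\mathrm dz=\mathrm dz_1\wedge\cdots\wedge \mathrm dz_k$, $\mathrm dw=\mathrm dw_1\wedge\cdots\wedge \mathrm dw_m$. The coordinate fixed-point equations $g_1,\ldots,g_n$ are $z_i(1-a_i)$ and $w_\alpha-F_\alpha$; the fixed-point ideal is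 $I=(g_1,\ldots,g_n)$, $A_{f,p}=R/I$, and $\lambda_{f,p}:A_{f,p}\to\mathbb C$ is the Grothendieck residue functional $\lambda_{f,p}([h])=\operatorname{Res}_0\left[\frac{h\,\mathrm dz\wedge \mathrm dw}{g_1,\ldots,g_n}\right]$, in which $h\,\mathrm dz\wedge\mathrm dw$ is the numerator $n$-form. For $0\ne u=\sum_{\alpha\in\mathbb N^k}u_\alpha(w)z^\alpha\in R$, put $\nu_D(u)=\min\{|\alpha|:u_\alpha\ne0\}$ and $\operatorname{in}_D(u)=\sum_{|\alpha|=\nu_D(u)}u_\alpha(w)z^\alpha$. A regular sequence $q=(q_1,\ldots,q_n)$ generating $I$ is a normally admissible presentation if $R/(\operatorname{in}_D(q_1),\ldots,\operatorname{in}_D(q_n))$ has finite length and $\sum_j\nu_D(q_j)\ge k$. Write $(q_1,\ldots,q_n)^t=A(g_1,\ldots,g_n)^t$ with $A\in\operatorname{GL}_n(R)$, and $\Delta_q=\det A$. Put $d_j=\nu_D(q_j)$, $e(q)=\sum_jd_j-k$, $Q_j(t,z,w)=t^{-d_j}q_j(tz,w)$, so that $Q_j(0,z,w)=\operatorname{in}_D(q_j)$. The specialisation coefficient is $$\operatorname{SpTr}_{D,q}(h)=\frac1{e(q)!}\left.\frac{\mathrm d^{e(q)}}{\mathrm dt^{e(q)}}\operatorname{Res}_0\left[\frac{h(tz,w)\Delta_q(tz,w)\,\mathrm dz\wedge \mathrm dw}{Q_1(t),\ldots,Q_n(t)}\right]\right|_{t=0}$$ (the residue is a holomorphic function of $t$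 near $0$). The one-parameter family attached to $q$ is $\pi_q:\mathcal Z_q=\{Q_1=\cdots=Q_n=0\}\subset\Delta\times V\to\Delta$, with $\Delta$ a small disc with coordinate $t$ and $V$ a small polydisc with coordinates $(z,w)$; it is finite and flat. Its special fibre $\mathcal Z_{q,0}$ is defined by $\operatorname{in}_D(q_1),\ldots,\operatorname{in}_D(q_n)$, with dualising module $\omega_{\mathcal Z_{q,0}}$ generated by the residue symbol $\left[\frac{\mathrm dz\wedge\mathrm dw}{\operatorname{in}_D(q_1),\ldots,\operatorname{in}_D(q_n)}\right]$. If $h(tz,w)\Delta_q(tz,w)=t^{e(q)}\widetilde h(t,z,w)$ with $\widetilde h$ holomorphic, the normal-cone (residue) class is $$\operatorname{Sp}^{\log}_{D,q}(h)=\widetilde h(0,z,w)\left[\frac{\mathrm dz\wedge\mathrm dw}{\operatorname{in}_D(q_1),\ldots,\operatorname{in}_D(q_n)}\right]\in H^0(\mathcal Z_{q,0},\omega_{\mathcal Z_{q,0}}).$$ Its trace is its image under the Grothendieck duality trace of $\mathcal Z_{q,0}$, namely $\operatorname{Res}_0\left[\frac{\widetilde h(0,z,w)\,\mathrm dz\wedge\mathrm dw}{\operatorname{in}_D(q_1),\ldots,\operatorname{in}_D(q_n)}\right]$.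
   Formalization: Fixing the n-form h dz∧dw while g changes with the coordinates fails (f=2z, z'=3z: −1 versus −1/3); coordinate independence is stated instead for a fixed function class h with coordinate equations g, and for a fixed n-form with fixed generators g. *)

theory Defs
  imports "HOL-Analysis.Analysis"
begin

section \<open>The ring of convergent power series\<close>

text \<open>Coordinates are indexed by a finite type \<open>'n\<close>, and multi-indices have type \<open>nat ^ 'n\<close>.\<close>

definition mdeg :: "nat ^ 'n::finite \<Rightarrow> nat" where
  "mdeg \<alpha> = (\<Sum>i\<in>UNIV. \<alpha> $ i)"

typedef (overloaded) 'n cps =
  "{c :: nat ^ 'n::finite \<Rightarrow> complex.
      \<exists>r>0. (\<lambda>\<alpha>. norm (c \<alpha>) * r ^ mdeg \<alpha>) summable_on UNIV}"
  morphisms coeff Abs_cps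
  by (rule exI[of _ "\<lambda>_. 0"]) (auto intro!: exI[of _ "1::real"])

setup_lifting type_definition_cps

lemma mdeg_add: "mdeg (\<alpha> + \<beta>) = mdeg \<alpha> + mdeg \<beta>"
  by (simp add: mdeg_def sum.distrib)

lemma mdeg_0 [simp]: "mdeg 0 = 0"
  by (simp add: mdeg_def)

lemma component_le_mdeg: "\<alpha> $ i \<le> mdeg \<alpha>"
  unfolding mdeg_def by (rule member_le_sum) auto

lemma finite_mdeg_le: "finite {\<alpha> :: nat ^ 'n::finite. mdeg \<alpha> \<le> N}"
proof -
  have "{\<alpha> :: nat ^ 'n. mdeg \<alpha> \<le> N} \<subseteq> vec_lambda ` (UNIV \<rightarrow>\<^sub>E {..N})"
  proof
    fix \<alpha> :: "nat ^ 'n" assume "\<alpha> \<in> {\<alpha>. mdeg \<alpha> \<le> N}"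
    then have "($) \<alpha> \<in> UNIV \<rightarrow>\<^sub>E {..N}"
      using component_le_mdeg[of \<alpha>] by (auto simp: PiE_def intro: order_trans)
    then show "\<alpha> \<in> vec_lambda ` (UNIV \<rightarrow>\<^sub>E {..N})"
      by (metis image_eqI vec_nth_inverse)
  qed
  then show ?thesis
    by (rule finite_subset) (intro finite_imageI finite_PiE; simp)
qed

lemma finite_splits: "finite {(\<beta>, \<gamma>). \<beta> + \<gamma> = (\<alpha> :: nat ^ 'n::finite)}"
  by (rule finite_subset[of _ "{\<beta>. mdeg \<beta> \<le> mdeg \<alpha>} \<times> {\<beta>. mdeg \<beta> \<le> mdeg \<alpha>}"])
     (auto simp: mdeg_add finite_mdeg_le)

lemma summable_shrink:
  fixes c :: "nat ^ 'n::finite \<Rightarrow> complex"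
  assumes "(\<lambda>\<alpha>. norm (c \<alpha>) * r ^ mdeg \<alpha>) summable_on UNIV" "0 < s" "s \<le> r"
  shows "(\<lambda>\<alpha>. norm (c \<alpha>) * s ^ mdeg \<alpha>) summable_on UNIV"
  by (rule summable_on_comparison_test[OF assms(1)])
     (use assms in \<open>auto intro!: mult_left_mono power_mono\<close>)

lemma summable_zero_one:
  fixes a :: complex
  shows "\<exists>r>0. (\<lambda>\<alpha> :: nat ^ 'n::finite. norm (if \<alpha> = \<beta> then a else 0) * r ^ mdeg \<alpha>) summable_on UNIV"
proof (intro exI conjI)
  have "(\<lambda>\<alpha>. norm (if \<alpha> = \<beta> then a else 0) * 1 ^ mdeg \<alpha>) summable_on {\<beta>}" by simp
  then show "(\<lambda>\<alpha>. norm (if \<alpha> = \<beta> then a else 0) * 1 ^ mdeg \<alpha>) summable_on UNIV"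
    by (rule summable_on_cong_neutral[THEN iffD1, rotated -1]) auto
qed simp

lemma summable_add:
  fixes c d :: "nat ^ 'n::finite \<Rightarrow> complex"
  assumes "\<exists>r>0. (\<lambda>\<alpha>. norm (c \<alpha>) * r ^ mdeg \<alpha>) summable_on UNIV"
    and "\<exists>r>0. (\<lambda>\<alpha>. norm (d \<alpha>) * r ^ mdeg \<alpha>) summable_on UNIV"
  shows "\<exists>r>0. (\<lambda>\<alpha>. norm (c \<alpha> + d \<alpha>) * r ^ mdeg \<alpha>) summable_on UNIV"
proof -
  obtain r s where rs: "r > 0" "s > 0"
    "(\<lambda>\<alpha>. norm (c \<alpha>) * r ^ mdeg \<alpha>) summable_on UNIV"
    "(\<lambda>\<alpha>. norm (d \<alpha>) * s ^ mdeg \<alpha>) summable_on UNIV"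
    using assms by blast
  define \<rho> where "\<rho> = min r s"
  have "(\<lambda>\<alpha>. norm (c \<alpha>) * \<rho> ^ mdeg \<alpha> + norm (d \<alpha>) * \<rho> ^ mdeg \<alpha>) summable_on UNIV"
    using rs by (intro summable_on_add summable_shrink[OF rs(3)] summable_shrink[OF rs(4)])
      (auto simp: \<rho>_def)
  then have "(\<lambda>\<alpha>. norm (c \<alpha> + d \<alpha>) * \<rho> ^ mdeg \<alpha>) summable_on UNIV"
    by (rule summable_on_comparison_test)
       (use rs in \<open>auto simp: \<rho>_def distrib_right[symmetric] intro!: mult_right_mono norm_triangle_ineq\<close>)
  then show ?thesis using rs by (intro exI[of _ \<rho>]) (auto simp: \<rho>_def)
qed

lemma summable_mult:
  fixes c d :: "nat ^ 'n::finite \<Rightarrow> complex"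
  assumes "\<exists>r>0. (\<lambda>\<alpha>. norm (c \<alpha>) * r ^ mdeg \<alpha>) summable_on UNIV"
    and "\<exists>r>0. (\<lambda>\<alpha>. norm (d \<alpha>) * r ^ mdeg \<alpha>) summable_on UNIV"
  shows "\<exists>r>0. (\<lambda>\<alpha>. norm (\<Sum>(\<beta>, \<gamma>) | \<beta> + \<gamma> = \<alpha>. c \<beta> * d \<gamma>) * r ^ mdeg \<alpha>) summable_on UNIV"
proof -
  obtain r s where rs: "r > 0" "s > 0"
    "(\<lambda>\<alpha>. norm (c \<alpha>) * r ^ mdeg \<alpha>) summable_on UNIV"
    "(\<lambda>\<alpha>. norm (d \<alpha>) * s ^ mdeg \<alpha>) summable_on UNIV"
    using assms by blast
  define \<rho> where "\<rho> = min r s"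
  have \<rho>: "\<rho> > 0" using rs by (simp add: \<rho>_def)
  define C where "C = (\<lambda>\<alpha>. norm (c \<alpha>) * \<rho> ^ mdeg \<alpha>)"
  define D where "D = (\<lambda>\<alpha>. norm (d \<alpha>) * \<rho> ^ mdeg \<alpha>)"
  have C: "C summable_on UNIV" and D: "D summable_on UNIV"
    unfolding C_def D_def using rs \<rho>
    by (auto intro!: summable_shrink[OF rs(3)] summable_shrink[OF rs(4)] simp: \<rho>_def)
  have nn: "C \<alpha> \<ge> 0" "D \<alpha> \<ge> 0" for \<alpha> using \<rho> by (auto simp: C_def D_def)
  have *: "norm (\<Sum>(\<beta>, \<gamma>) | \<beta> + \<gamma> = \<alpha>. c \<beta> * d \<gamma>) * \<rho> ^ mdeg \<alpha>
      \<le> (\<Sum>(\<beta>, \<gamma>) | \<beta> + \<gamma> = \<alpha>. C \<beta> * D \<gamma>)" for \<alpha>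
  proof -
    have "norm (\<Sum>(\<beta>, \<gamma>) | \<beta> + \<gamma> = \<alpha>. c \<beta> * d \<gamma>) * \<rho> ^ mdeg \<alpha>
      \<le> (\<Sum>(\<beta>, \<gamma>) | \<beta> + \<gamma> = \<alpha>. norm (c \<beta> * d \<gamma>)) * \<rho> ^ mdeg \<alpha>"
      using \<rho> norm_sum[of "\<lambda>(\<beta>, \<gamma>). c \<beta> * d \<gamma>" "{(\<beta>, \<gamma>). \<beta> + \<gamma> = \<alpha>}"]
      by (intro mult_right_mono) (auto simp: case_prod_unfold)
    also have "\<dots> = (\<Sum>(\<beta>, \<gamma>) | \<beta> + \<gamma> = \<alpha>. C \<beta> * D \<gamma>)"
      unfolding sum_distrib_right
      by (rule sum.cong) (auto simp: C_def D_def norm_mult mdeg_add power_add)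
    finally show ?thesis .
  qed
  have "(\<lambda>\<alpha>. norm (\<Sum>(\<beta>, \<gamma>) | \<beta> + \<gamma> = \<alpha>. c \<beta> * d \<gamma>) * \<rho> ^ mdeg \<alpha>) summable_on UNIV"
  proof (rule nonneg_bdd_above_summable_on)
    show "bdd_above (sum (\<lambda>\<alpha>. norm (\<Sum>(\<beta>, \<gamma>) | \<beta> + \<gamma> = \<alpha>. c \<beta> * d \<gamma>) * \<rho> ^ mdeg \<alpha>)
        ` {F. F \<subseteq> UNIV \<and> finite F})"
    proof (rule bdd_aboveI2)
      fix F :: "(nat ^ 'n) set" assume "F \<in> {F. F \<subseteq> UNIV \<and> finite F}"
      then have F: "finite F" by simp
      define N where "N = Max (insert 0 (mdeg ` F))"
      define G where "G = {\<alpha> :: nat ^ 'n. mdeg \<alpha> \<le> N}"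
      have G: "finite G" unfolding G_def by (rule finite_mdeg_le)
      have FG: "mdeg \<alpha> \<le> N" if "\<alpha> \<in> F" for \<alpha> unfolding N_def using F that by auto
      have "(\<Sum>\<alpha>\<in>F. norm (\<Sum>(\<beta>, \<gamma>) | \<beta> + \<gamma> = \<alpha>. c \<beta> * d \<gamma>) * \<rho> ^ mdeg \<alpha>)
          \<le> (\<Sum>\<alpha>\<in>F. \<Sum>(\<beta>, \<gamma>) | \<beta> + \<gamma> = \<alpha>. C \<beta> * D \<gamma>)"
        by (rule sum_mono) (rule *)
      also have "\<dots> = (\<Sum>(\<beta>, \<gamma>) \<in> (\<Union>\<alpha>\<in>F. {(\<beta>, \<gamma>). \<beta> + \<gamma> = \<alpha>}). C \<beta> * D \<gamma>)"
        using F finite_splits by (subst sum.UNION_disjoint) auto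
      also have "\<dots> \<le> (\<Sum>(\<beta>, \<gamma>) \<in> G \<times> G. C \<beta> * D \<gamma>)"
        using G FG nn by (intro sum_mono2) (force simp: G_def mdeg_add)+
      also have "\<dots> = sum C G * sum D G"
        by (simp add: sum_product sum.cartesian_product)
      also have "\<dots> \<le> infsum C UNIV * infsum D UNIV"
        using C D G nn
        by (intro mult_mono finite_sum_le_infsum infsum_nonneg sum_nonneg) auto
      finally show "(\<Sum>\<alpha>\<in>F. norm (\<Sum>(\<beta>, \<gamma>) | \<beta> + \<gamma> = \<alpha>. c \<beta> * d \<gamma>) * \<rho> ^ mdeg \<alpha>)
          \<le> infsum C UNIV * infsum D UNIV" .
    qed
  qed (use \<rho> in auto)
  then show ?thesis using \<rho> by blast
qed

instantiation cps :: (finite) comm_ring_1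
begin

lift_definition zero_cps :: "'a cps" is "\<lambda>_. 0"
  by (auto intro!: exI[of _ "1::real"])

lift_definition one_cps :: "'a cps" is "\<lambda>\<alpha>. if \<alpha> = 0 then 1 else 0"
  by (rule summable_zero_one)

lift_definition plus_cps :: "'a cps \<Rightarrow> 'a cps \<Rightarrow> 'a cps" is "\<lambda>c d \<alpha>. c \<alpha> + d \<alpha>"
  by (rule summable_add)

lift_definition uminus_cps :: "'a cps \<Rightarrow> 'a cps" is "\<lambda>c \<alpha>. - c \<alpha>"
  by simp

definition minus_cps :: "'a cps \<Rightarrow> 'a cps \<Rightarrow> 'a cps" where
  "minus_cps u v = u + - v"

lift_definition times_cps :: "'a cps \<Rightarrow> 'a cps \<Rightarrow> 'a cps" is
  "\<lambda>c d \<alpha>. \<Sum>(\<beta>, \<gamma>) | \<beta> + \<gamma> = \<alpha>. c \<beta> * d \<gamma>"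
  by (rule summable_mult)

instance
proof
  fix a b c :: "'a cps"
  show "a + b + c = a + (b + c)" by transfer (simp add: add.assoc)
  show "a + b = b + a" by transfer (simp add: add.commute)
  show "0 + a = a" by transfer simp
  show "- a + a = 0" by transfer simp
  show "a - b = a + - b" by (simp add: minus_cps_def)
  show "(0 :: 'a cps) \<noteq> 1" by transfer (metis zero_neq_one)
  show "(a + b) * c = a * c + b * c"
    by transfer (simp add: distrib_right sum.distrib case_prod_unfold)
  show "a * b = b * a"
  proof (transfer, rule ext)
    fix a b :: "nat ^ 'a \<Rightarrow> complex" and \<alpha> :: "nat ^ 'a"
    show "(\<Sum>(\<beta>, \<gamma>) | \<beta> + \<gamma> = \<alpha>. a \<beta> * b \<gamma>) = (\<Sum>(\<beta>, \<gamma>) | \<beta> + \<gamma> = \<alpha>. b \<beta> * a \<gamma>)"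
      by (rule sum.reindex_bij_witness[of _ prod.swap prod.swap]) (auto simp: add.commute)
  qed
  show "1 * a = a"
  proof (transfer, rule ext)
    fix a :: "nat ^ 'a \<Rightarrow> complex" and \<alpha> :: "nat ^ 'a"
    have "(\<Sum>(\<beta>, \<gamma>) | \<beta> + \<gamma> = \<alpha>. (if \<beta> = 0 then 1 else 0) * a \<gamma>)
        = (\<Sum>(\<beta>, \<gamma>) \<in> {(0 :: nat ^ 'a, \<alpha>)}. (if \<beta> = 0 then 1 else 0) * a \<gamma>)"
      using finite_splits[of \<alpha>] by (intro sum.mono_neutral_right) (auto split: if_splits)
    then show "(\<Sum>(\<beta>, \<gamma>) | \<beta> + \<gamma> = \<alpha>. (if \<beta> = 0 then 1 else 0) * a \<gamma>) = a \<alpha>" by simp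
  qed
  show "a * b * c = a * (b * c)"
  proof (transfer, rule ext)
    fix a b c :: "nat ^ 'a \<Rightarrow> complex" and \<alpha> :: "nat ^ 'a"
    have "(\<Sum>(\<delta>, \<gamma>) | \<delta> + \<gamma> = \<alpha>. (\<Sum>(\<beta>, \<epsilon>) | \<beta> + \<epsilon> = \<delta>. a \<beta> * b \<epsilon>) * c \<gamma>)
        = (\<Sum>x\<in>{(\<delta>, \<gamma>). \<delta> + \<gamma> = \<alpha>}. \<Sum>y\<in>{(\<beta>, \<epsilon>). \<beta> + \<epsilon> = fst x}.
             a (fst y) * b (snd y) * c (snd x))"
      by (simp add: sum_distrib_right case_prod_unfold)
    also have "\<dots> = (\<Sum>(x, y)\<in>(SIGMA x:{(\<delta>, \<gamma>). \<delta> + \<gamma> = \<alpha>}. {(\<beta>, \<epsilon>). \<beta> + \<epsilon> = fst x}).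
             a (fst y) * b (snd y) * c (snd x))"
      by (rule sum.Sigma) (auto simp: finite_splits)
    also have "\<dots> = (\<Sum>(x, y)\<in>(SIGMA x:{(\<beta>, \<delta>). \<beta> + \<delta> = \<alpha>}. {(\<epsilon>, \<gamma>). \<epsilon> + \<gamma> = snd x}).
             a (fst x) * (b (fst y) * c (snd y)))"
      by (rule sum.reindex_bij_witness[of _
            "\<lambda>(x, y). ((fst x + fst y, snd y), (fst x, fst y))"
            "\<lambda>(x, y). ((fst y, snd y + snd x), (snd y, snd x))"])
         (auto simp: ac_simps)
    also have "\<dots> = (\<Sum>x\<in>{(\<beta>, \<delta>). \<beta> + \<delta> = \<alpha>}. \<Sum>y\<in>{(\<epsilon>, \<gamma>). \<epsilon> + \<gamma> = snd x}.
             a (fst x) * (b (fst y) * c (snd y)))"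
      by (rule sum.Sigma[symmetric]) (auto simp: finite_splits)
    also have "\<dots> = (\<Sum>(\<beta>, \<delta>) | \<beta> + \<delta> = \<alpha>. a \<beta> * (\<Sum>(\<epsilon>, \<gamma>) | \<epsilon> + \<gamma> = \<delta>. b \<epsilon> * c \<gamma>))"
      by (simp add: sum_distrib_left case_prod_unfold)
    finally show "(\<Sum>(\<delta>, \<gamma>) | \<delta> + \<gamma> = \<alpha>. (\<Sum>(\<beta>, \<epsilon>) | \<beta> + \<epsilon> = \<delta>. a \<beta> * b \<epsilon>) * c \<gamma>)
        = (\<Sum>(\<beta>, \<delta>) | \<beta> + \<delta> = \<alpha>. a \<beta> * (\<Sum>(\<epsilon>, \<gamma>) | \<epsilon> + \<gamma> = \<delta>. b \<epsilon> * c \<gamma>))" .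
  qed
qed

end

lift_definition coord :: "'n::finite \<Rightarrow> 'n cps" is
  "\<lambda>i \<alpha>. if \<alpha> = axis i 1 then 1 else 0"
  by (rule summable_zero_one)

definition val_at :: "'n::finite cps \<Rightarrow> complex ^ 'n \<Rightarrow> complex" where
  "val_at u x = (\<Sum>\<^sub>\<infinity>\<alpha>. coeff u \<alpha> * (\<Prod>i\<in>UNIV. x $ i ^ (\<alpha> $ i)))"

definition map_at :: "'n::finite cps ^ 'm \<Rightarrow> complex ^ 'n \<Rightarrow> complex ^ 'm" where
  "map_at \<phi> x = (\<chi> i. val_at (\<phi> $ i) x)"

lift_definition cps_partial :: "'n::finite \<Rightarrow> 'n cps \<Rightarrow> 'n cps" is
  "\<lambda>i c \<alpha>. of_nat (\<alpha> $ i + 1) * c (\<alpha> + axis i 1)"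
proof -
  fix i :: 'n and c :: "nat ^ 'n \<Rightarrow> complex"
  assume "\<exists>r>0. (\<lambda>\<alpha>. norm (c \<alpha>) * r ^ mdeg \<alpha>) summable_on UNIV"
  then obtain r where r: "r > 0" "(\<lambda>\<alpha>. norm (c \<alpha>) * r ^ mdeg \<alpha>) summable_on UNIV" by blast
  have inj: "inj (\<lambda>\<alpha> :: nat ^ 'n. \<alpha> + axis i 1)" by (auto intro: injI)
  have "(\<lambda>\<alpha>. norm (c \<alpha>) * r ^ mdeg \<alpha>) summable_on range (\<lambda>\<alpha>. \<alpha> + axis i 1)"
    using r(2) by (rule summable_on_subset_banach) simp
  then have "(\<lambda>\<alpha>. norm (c (\<alpha> + axis i 1)) * r ^ mdeg (\<alpha> + axis i 1)) summable_on UNIV"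
    by (subst (asm) summable_on_reindex[OF inj]) (simp add: o_def)
  then have s: "(\<lambda>\<alpha>. norm (c (\<alpha> + axis i 1)) * r ^ mdeg (\<alpha> + axis i 1) * inverse r) summable_on UNIV"
    by (rule summable_on_cmult_left)
  have "mdeg (axis i 1 :: nat ^ 'n) = 1"
    by (simp add: mdeg_def axis_def)
  have "(\<lambda>\<alpha>. norm (of_nat (\<alpha> $ i + 1) * c (\<alpha> + axis i 1)) * (r / 2) ^ mdeg \<alpha>) summable_on UNIV"
  proof (rule summable_on_comparison_test[OF s])
    fix \<alpha> :: "nat ^ 'n"
    have "\<alpha> $ i + 1 \<le> 2 ^ mdeg \<alpha>"
      using component_le_mdeg[of \<alpha> i] less_exp[of "mdeg \<alpha>"] by linarith
    then have "real (\<alpha> $ i + 1) \<le> 2 ^ mdeg \<alpha>"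
      by (metis of_nat_le_iff of_nat_numeral of_nat_power)
    then have "real (\<alpha> $ i + 1) * (r / 2) ^ mdeg \<alpha> \<le> 2 ^ mdeg \<alpha> * (r / 2) ^ mdeg \<alpha>"
      using r(1) by (intro mult_right_mono) auto
    also have "\<dots> = r ^ mdeg \<alpha>" by (simp add: power_divide)
    finally have "norm (c (\<alpha> + axis i 1)) * (real (\<alpha> $ i + 1) * (r / 2) ^ mdeg \<alpha>)
        \<le> norm (c (\<alpha> + axis i 1)) * r ^ mdeg \<alpha>"
      by (rule mult_left_mono) simp
    also have "\<dots> = norm (c (\<alpha> + axis i 1)) * r ^ mdeg (\<alpha> + axis i 1) * inverse r"
      using r(1) \<open>mdeg (axis i 1) = 1\<close> by (simp add: mdeg_add)
    finally show "norm (of_nat (\<alpha> $ i + 1) * c (\<alpha> + axis i 1)) * (r / 2) ^ mdeg \<alpha>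
        \<le> norm (c (\<alpha> + axis i 1)) * r ^ mdeg (\<alpha> + axis i 1) * inverse r"
      unfolding norm_mult norm_of_nat by (simp only: ac_simps)
  qed (use r in auto)
  then show "\<exists>r>0. (\<lambda>\<alpha>. norm (of_nat (\<alpha> $ i + 1) * c (\<alpha> + axis i 1)) * r ^ mdeg \<alpha>) summable_on UNIV"
    using r(1) by (intro exI[of _ "r / 2"]) auto
qed

definition jac :: "'n::finite cps ^ 'n \<Rightarrow> 'n cps ^ 'n ^ 'n" where
  "jac \<phi> = (\<chi> i j. cps_partial j (\<phi> $ i))"

section \<open>Ideals, regular sequences and finite length\<close>

abbreviation is_ideal :: "'a::comm_ring_1 set \<Rightarrow> bool" where
  "is_ideal \<equiv> module.subspace (*)"

abbreviation ideal_gen :: "'a::comm_ring_1 set \<Rightarrow> 'a set" where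
  "ideal_gen \<equiv> module.span (*)"

text \<open>Submodules of \<open>R/J\<close> are the ideals of \<open>R\<close> containing \<open>J\<close>, and the length of a module is the
  supremum of the lengths of its chains of submodules.\<close>

definition finite_length_quotient :: "'a::comm_ring_1 set \<Rightarrow> bool" where
  "finite_length_quotient J \<longleftrightarrow>
     (\<exists>N. \<forall>\<C>. subset.chain {M. is_ideal M \<and> J \<subseteq> M} \<C> \<longrightarrow> finite \<C> \<and> card \<C> \<le> N)"

definition regular_sequence :: "('a::comm_ring_1, 'n::{finite,linorder}) vec \<Rightarrow> bool" where
  "regular_sequence q \<longleftrightarrow>
     (\<forall>j u. q $ j * u \<in> ideal_gen {q $ i |i. i < j} \<longrightarrow> u \<in> ideal_gen {q $ i |i. i < j}) \<and>
     1 \<notin> ideal_gen (range (($) q))"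

section \<open>The Grothendieck residue\<close>

text \<open>The residue symbol \<open>[u dx / q]\<close> is an element of the local cohomology module
  \<open>H\<^sup>n(\<Omega>\<^sup>n)\<close> with supports in the maximal ideal, that is, of the direct limit of the
  \<open>\<Omega>\<^sup>n / (x\<^sub>1\<^sup>M, \<dots>, x\<^sub>n\<^sup>M)\<close>. If \<open>C q = (x\<^sub>1\<^sup>M, \<dots>, x\<^sub>n\<^sup>M)\<close>, it equals
  \<open>[det C u dx / x\<^sub>1\<^sup>M, \<dots>, x\<^sub>n\<^sup>M]\<close>, and the residue map reads off the coefficient of
  \<open>dx / (x\<^sub>1 \<dots> x\<^sub>n)\<close>, i.e. the iterated one-variable Cauchy residue. The value does not depend on
  the choice of \<open>M\<close> and \<open>C\<close>; they exist iff the \<open>q\<^sub>j\<close> generate an ideal containing a power of the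
  maximal ideal. Coordinates and equations share the index type, so that the orders of
  the \<open>dx\<^sub>i\<close> and of the \<open>q\<^sub>i\<close> match and \<open>det C\<close> carries the right sign.\<close>

definition residue :: "'n::finite cps \<Rightarrow> 'n cps ^ 'n \<Rightarrow> complex" where
  "residue u q =
     (THE r. \<exists>N C. C *v q = (\<chi> i. coord i ^ Suc N) \<and> r = coeff (det C * u) (\<chi> i. N))"

section \<open>The filtration by order along the divisor\<close>

text \<open>\<open>K \<subseteq> 'n\<close> is the set of indices of the coordinates \<open>z\<close>, so \<open>D\<close> is the zero set of
  \<open>\<Prod>i\<in>K. x\<^sub>i\<close>; the remaining coordinates are the \<open>w\<close>.\<close>

definition zdeg :: "'n::finite set \<Rightarrow> nat ^ 'n \<Rightarrow> nat" where
  "zdeg K \<alpha> = (\<Sum>i\<in>K. \<alpha> $ i)"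

lemma zdeg_le_mdeg: "zdeg K \<alpha> \<le> mdeg \<alpha>"
  unfolding zdeg_def mdeg_def by (rule sum_mono2) auto

text \<open>The order of \<open>0\<close> is a dummy value.\<close>

definition nu :: "'n::finite set \<Rightarrow> 'n cps \<Rightarrow> nat" where
  "nu K u = (LEAST d. \<exists>\<alpha>. coeff u \<alpha> \<noteq> 0 \<and> zdeg K \<alpha> = d)"

text \<open>\<open>zpart K d u\<close> is the homogeneous part of \<open>u\<close> of degree \<open>d\<close> in \<open>z\<close>.\<close>

lift_definition zpart :: "'n::finite set \<Rightarrow> nat \<Rightarrow> 'n cps \<Rightarrow> 'n cps" is
  "\<lambda>K d c \<alpha>. if zdeg K \<alpha> = d then c \<alpha> else 0"
proof -
  fix K :: "'n set" and d and c :: "nat ^ 'n \<Rightarrow> complex"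
  assume "\<exists>r>0. (\<lambda>\<alpha>. norm (c \<alpha>) * r ^ mdeg \<alpha>) summable_on UNIV"
  then obtain r where r: "r > 0" "(\<lambda>\<alpha>. norm (c \<alpha>) * r ^ mdeg \<alpha>) summable_on UNIV" by blast
  then have "(\<lambda>\<alpha>. norm (if zdeg K \<alpha> = d then c \<alpha> else 0) * r ^ mdeg \<alpha>) summable_on UNIV"
    by (intro summable_on_comparison_test[OF r(2)]) auto
  then show "\<exists>r>0. (\<lambda>\<alpha>. norm (if zdeg K \<alpha> = d then c \<alpha> else 0) * r ^ mdeg \<alpha>) summable_on UNIV"
    using r(1) by blast
qed

definition initial_form :: "'n::finite set \<Rightarrow> 'n cps \<Rightarrow> 'n cps" where
  "initial_form K u = zpart K (nu K u) u"

text \<open>\<open>rescale K d t u\<close> is \<open>t\<^sup>-\<^sup>d u(t z, w)\<close> for \<open>d \<le> nu K u\<close>, written coefficientwise so that it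
  also makes sense for \<open>t = 0\<close>; terms of degree \<open>< d\<close> in \<open>z\<close>, which then do not occur, are dropped.\<close>

lift_definition rescale :: "'n::finite set \<Rightarrow> nat \<Rightarrow> complex \<Rightarrow> 'n cps \<Rightarrow> 'n cps" is
  "\<lambda>K d t c \<alpha>. if d \<le> zdeg K \<alpha> then t ^ (zdeg K \<alpha> - d) * c \<alpha> else 0"
proof -
  fix K :: "'n set" and d and t :: complex and c :: "nat ^ 'n \<Rightarrow> complex"
  assume "\<exists>r>0. (\<lambda>\<alpha>. norm (c \<alpha>) * r ^ mdeg \<alpha>) summable_on UNIV"
  then obtain r where r: "r > 0" "(\<lambda>\<alpha>. norm (c \<alpha>) * r ^ mdeg \<alpha>) summable_on UNIV" by blast
  define s where "s = max 1 (norm t)"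
  have s: "s \<ge> 1" "norm t \<le> s" by (auto simp: s_def)
  have "(\<lambda>\<alpha>. norm (if d \<le> zdeg K \<alpha> then t ^ (zdeg K \<alpha> - d) * c \<alpha> else 0) * (r / s) ^ mdeg \<alpha>)
      summable_on UNIV"
  proof (rule summable_on_comparison_test[OF r(2)])
    fix \<alpha> :: "nat ^ 'n"
    have "norm t ^ (zdeg K \<alpha> - d) \<le> s ^ (zdeg K \<alpha> - d)"
      using s by (intro power_mono) auto
    also have "\<dots> \<le> s ^ mdeg \<alpha>"
      using s zdeg_le_mdeg[of K \<alpha>] by (intro power_increasing) auto
    finally have *: "norm t ^ (zdeg K \<alpha> - d) \<le> s ^ mdeg \<alpha>" .
    have "norm t ^ (zdeg K \<alpha> - d) * (r / s) ^ mdeg \<alpha> \<le> s ^ mdeg \<alpha> * (r / s) ^ mdeg \<alpha>"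
      using * r(1) s by (intro mult_right_mono) auto
    also have "\<dots> = r ^ mdeg \<alpha>" using s by (simp add: power_divide)
    finally have "norm (c \<alpha>) * (norm t ^ (zdeg K \<alpha> - d) * (r / s) ^ mdeg \<alpha>) \<le> norm (c \<alpha>) * r ^ mdeg \<alpha>"
      by (rule mult_left_mono) simp
    then show "norm (if d \<le> zdeg K \<alpha> then t ^ (zdeg K \<alpha> - d) * c \<alpha> else 0) * (r / s) ^ mdeg \<alpha>
        \<le> norm (c \<alpha>) * r ^ mdeg \<alpha>"
      using r(1) by (auto simp: norm_mult norm_power ac_simps)
  qed (use r s in auto)
  then show "\<exists>r>0. (\<lambda>\<alpha>. norm (if d \<le> zdeg K \<alpha> then t ^ (zdeg K \<alpha> - d) * c \<alpha> else 0) * r ^ mdeg \<alpha>)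
      summable_on UNIV"
    using r(1) s by (intro exI[of _ "r / s"]) auto
qed

lemma coeff_below_nu: "zdeg K \<alpha> < nu K u \<Longrightarrow> coeff u \<alpha> = 0"
  unfolding nu_def using not_less_Least by blast

lemma rescale_0: "rescale K (nu K u) 0 u = initial_form K u"
  unfolding initial_form_def coeff_inject[symmetric] zpart.rep_eq rescale.rep_eq
  by (auto simp: fun_eq_iff)

abbreviation dilate :: "'n::finite set \<Rightarrow> complex \<Rightarrow> 'n cps \<Rightarrow> 'n cps" where
  "dilate K t u \<equiv> rescale K 0 t u"

section \<open>Strict logarithmic self-maps in adapted coordinates\<close>

text \<open>The component \<open>f $ i\<close> is the pullback \<open>f\<^sup>*x\<^sub>i\<close>. The components of \<open>D\<close> through \<open>p\<close> are
  \<open>x\<^sub>i = 0\<close> for \<open>i \<in> K\<close>, so the ideal condition says \<open>f\<^sup>*x\<^sub>i = x\<^sub>i a\<^sub>i\<close> with a unit \<open>a\<^sub>i\<close>.\<close>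

definition strict_log :: "'n::finite set \<Rightarrow> 'n cps ^ 'n \<Rightarrow> bool" where
  "strict_log K f \<longleftrightarrow> (\<forall>i\<in>K. ideal_gen {f $ i} = ideal_gen {coord i})"

definition isolated_fixed_point :: "'n::finite cps ^ 'n \<Rightarrow> bool" where
  "isolated_fixed_point f \<longleftrightarrow> map_at f 0 = 0 \<and> (\<forall>\<^sub>F x in at 0. map_at f x \<noteq> x)"

text \<open>\<open>x\<^sub>i - f\<^sup>*x\<^sub>i\<close>, which is \<open>z\<^sub>i(1 - a\<^sub>i)\<close> for \<open>i \<in> K\<close> and \<open>w\<^sub>i - F\<^sub>i\<close> otherwise.\<close>

definition fixed_eqs :: "'n::finite cps ^ 'n \<Rightarrow> 'n cps ^ 'n" where
  "fixed_eqs f = (\<chi> i. coord i - f $ i)"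

definition fixed_ideal :: "'n::finite cps ^ 'n \<Rightarrow> 'n cps set" where
  "fixed_ideal f = ideal_gen (range (($) (fixed_eqs f)))"

definition lambda :: "'n::finite cps ^ 'n \<Rightarrow> 'n cps \<Rightarrow> complex" where
  "lambda f h = residue h (fixed_eqs f)"

section \<open>Normally admissible presentations and the specialisation coefficient\<close>

definition normally_admissible ::
  "('n::{finite,linorder}) set \<Rightarrow> 'n cps set \<Rightarrow> ('n cps, 'n) vec \<Rightarrow> bool" where
  "normally_admissible K I q \<longleftrightarrow>
     regular_sequence q \<and> ideal_gen (range (($) q)) = I \<and>
     finite_length_quotient (ideal_gen (range (\<lambda>j. initial_form K (q $ j)))) \<and>
     card K \<le> (\<Sum>j\<in>UNIV. nu K (q $ j))"

definition excess :: "'n::finite set \<Rightarrow> 'n cps ^ 'n \<Rightarrow> nat" where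
  "excess K q = (\<Sum>j\<in>UNIV. nu K (q $ j)) - card K"

definition Q_family :: "'n::finite set \<Rightarrow> 'n cps ^ 'n \<Rightarrow> complex \<Rightarrow> 'n cps ^ 'n" where
  "Q_family K q t = (\<chi> j. rescale K (nu K (q $ j)) t (q $ j))"

text \<open>\<open>A\<close> is the matrix with \<open>q = A g\<close>, so \<open>\<Delta>\<^sub>q = det A\<close>.\<close>

definition SpTr ::
  "'n::finite set \<Rightarrow> 'n cps ^ 'n \<Rightarrow> 'n cps ^ 'n ^ 'n \<Rightarrow> 'n cps \<Rightarrow> complex" where
  "SpTr K q A h =
     (deriv ^^ excess K q) (\<lambda>t. residue (dilate K t h * dilate K t (det A)) (Q_family K q t)) 0
       / fact (excess K q)"

section \<open>The normal-cone class\<close>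

text \<open>Functions holomorphic near \<open>0\<close> in \<open>(t, x)\<close> are convergent power series over the index type
  \<open>'n option\<close>, with \<open>None\<close> the index of \<open>t\<close>.\<close>

definition with_t :: "'a \<Rightarrow> 'a ^ 'n \<Rightarrow> 'a ^ ('n::finite) option" where
  "with_t t x = (\<chi> i. case i of None \<Rightarrow> t | Some j \<Rightarrow> x $ j)"

lift_definition at_t0 :: "('n::finite) option cps \<Rightarrow> 'n cps" is
  "\<lambda>c \<alpha>. c (with_t 0 \<alpha>)"
proof -
  fix c :: "nat ^ 'n option \<Rightarrow> complex"
  assume "\<exists>r>0. (\<lambda>\<alpha>. norm (c \<alpha>) * r ^ mdeg \<alpha>) summable_on UNIV"
  then obtain r where r: "r > 0" "(\<lambda>\<alpha>. norm (c \<alpha>) * r ^ mdeg \<alpha>) summable_on UNIV" by blast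
  have inj: "inj (with_t 0 :: nat ^ 'n \<Rightarrow> nat ^ 'n option)"
  proof (rule injI)
    fix \<alpha> \<beta> :: "nat ^ 'n" assume "with_t 0 \<alpha> = with_t 0 \<beta>"
    then have "with_t 0 \<alpha> $ Some i = with_t 0 \<beta> $ Some i" for i by simp
    then show "\<alpha> = \<beta>" by (simp add: with_t_def vec_eq_iff)
  qed
  have deg: "mdeg (with_t 0 \<alpha>) = mdeg \<alpha>" for \<alpha> :: "nat ^ 'n"
    by (simp add: mdeg_def with_t_def UNIV_option_conv sum.reindex)
  have "(\<lambda>\<alpha>. norm (c \<alpha>) * r ^ mdeg \<alpha>) summable_on range (with_t 0)"
    using r(2) by (rule summable_on_subset_banach) simp
  then have "(\<lambda>\<alpha>. norm (c (with_t 0 \<alpha>)) * r ^ mdeg \<alpha>) summable_on UNIV"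
    by (subst (asm) summable_on_reindex[OF inj]) (simp add: o_def deg)
  then show "\<exists>r>0. (\<lambda>\<alpha>. norm (c (with_t 0 \<alpha>)) * r ^ mdeg \<alpha>) summable_on UNIV"
    using r(1) by blast
qed

text \<open>\<open>H\<close> is the function with \<open>h(t z, w) \<Delta>\<^sub>q(t z, w) = t\<^sup>e H(t, z, w)\<close>.\<close>

definition divided_numerator ::
  "'n::finite set \<Rightarrow> 'n cps ^ 'n \<Rightarrow> 'n cps ^ 'n ^ 'n \<Rightarrow> 'n cps \<Rightarrow> 'n option cps \<Rightarrow> bool" where
  "divided_numerator K q A h H \<longleftrightarrow>
     (\<forall>\<^sub>F (t, x) in nhds (0, 0).
        val_at (dilate K t h * dilate K t (det A)) x = t ^ excess K q * val_at H (with_t t x))"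

text \<open>The dualising module of a zero-dimensional \<open>Z\<close> with coordinate ring \<open>R/J\<close> is the \<open>\<complex>\<close>-dual of
  \<open>R/J\<close>, here a functional on \<open>R\<close> vanishing on \<open>J\<close>; the residue symbol \<open>[v dx / q]\<close> is the
  functional \<open>u \<mapsto> Res [u v dx / q]\<close>, and the duality trace is evaluation at \<open>1\<close>.\<close>

definition residue_symbol :: "'n::finite cps \<Rightarrow> 'n cps ^ 'n \<Rightarrow> 'n cps \<Rightarrow> complex" where
  "residue_symbol v q = (\<lambda>u. residue (u * v) q)"

definition duality_trace :: "('n::finite cps \<Rightarrow> complex) \<Rightarrow> complex" where
  "duality_trace \<xi> = \<xi> 1"

definition Sp_log ::
  "'n::finite set \<Rightarrow> 'n cps ^ 'n \<Rightarrow> 'n option cps \<Rightarrow> 'n cps \<Rightarrow> complex" where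
  "Sp_log K q H = residue_symbol (at_t0 H) (\<chi> j. initial_form K (q $ j))"

section \<open>Changes of adapted coordinates\<close>

text \<open>\<open>y = \<phi>(x)\<close> is another coordinate system centred at \<open>p\<close> in which \<open>D\<close> is again the zero set of
  \<open>\<Prod>i\<in>K. y\<^sub>i\<close>.\<close>

definition adapted_change :: "'n::finite set \<Rightarrow> 'n cps ^ 'n \<Rightarrow> bool" where
  "adapted_change K \<phi> \<longleftrightarrow>
     map_at \<phi> 0 = 0 \<and> val_at (det (jac \<phi>)) 0 \<noteq> 0 \<and>
     (\<forall>\<^sub>F x in nhds 0. (\<Prod>i\<in>K. map_at \<phi> x $ i) = 0 \<longleftrightarrow> (\<Prod>i\<in>K. x $ i) = 0)"

text \<open>\<open>v = u \<circ> \<phi>\<close> as germs at \<open>0\<close>\<close>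

definition is_pullback :: "'n::finite cps ^ 'n \<Rightarrow> 'n cps \<Rightarrow> 'n cps \<Rightarrow> bool" where
  "is_pullback \<phi> u v \<longleftrightarrow> (\<forall>\<^sub>F x in nhds 0. val_at v x = val_at u (map_at \<phi> x))"

text \<open>\<open>f'\<close> is \<open>f\<close> in the coordinates \<open>y = \<phi>(x)\<close>.\<close>

definition is_conjugate :: "'n::finite cps ^ 'n \<Rightarrow> 'n cps ^ 'n \<Rightarrow> 'n cps ^ 'n \<Rightarrow> bool" where
  "is_conjugate \<phi> f f' \<longleftrightarrow>
     (\<forall>\<^sub>F x in nhds 0. map_at f' (map_at \<phi> x) = map_at \<phi> (map_at f x))"

end

theory Submission
  imports Defs
begin

text \<open>Two matrices \<open>C\<close> with \<open>C q = (x\<^sub>1\<^sup>M, \<dots>, x\<^sub>n\<^sup>M)\<close> have determinants that agree modulo the \<open>x\<^sub>i\<^sup>M\<close>,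
  which yields the transformation law of the residue. For \<open>t \<noteq> 0\<close> scaling of the coordinates and the
  transformation law show that the residue of the family \<open>Q(t)\<close> is \<open>t\<^sup>e \<lambda>(h)\<close>. For \<open>t = 0\<close> this
  follows by continuity: since the initial forms generate an ideal of finite colength, Nakayama's lemma,
  applied with control of the order along \<open>D\<close>, produces transition matrices from \<open>Q(t)\<close> to powers of the
  coordinates whose coefficients are polynomials in \<open>t\<close>.

  Independence of the coordinates reduces to Jacobi's formula
  \<open>Res [det J\<^sub>\<phi> dx / \<phi>\<^sup>a\<^sup>+\<^sup>1] = \<delta>\<^sub>a\<^sub>,\<^sub>0\<close>. It follows from the Piola identity and the vanishing of residues of
  exact forms; the latter is the uniqueness of transition determinants over the dual numbers \<open>R[\<epsilon>]\<close>,
  applied to the automorphism \<open>x\<^sub>j \<mapsto> x\<^sub>j + \<epsilon>\<close>. Finally \<open>\<phi> - \<phi> \<circ> f = M (x - f)\<close> with \<open>M\<close> congruent to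
  the Jacobian matrix of \<open>\<phi>\<close> modulo the fixed-point ideal.\<close>

section \<open>Ideals, determinants and dual numbers\<close>

text \<open>The specialisation coefficient is a derivative at t = 0, exactly where Q(t) degenerates,
  whereas scaling alone compares Q(t) with \<open>q\<close> only for t \<noteq> 0. A transition
  matrix for Q(t) comes from the dilated C by multiplying column j with t^(d_j) and dividing the
  rows of the z-coordinates by t^(N+1). These rows must therefore vanish to order N + 1 - d_j along
  the divisor, which an arbitrary C does not satisfy; this is why orders are tracked in Nakayama's
  lemma. No integral occurs anywhere: a residue is one coefficient of a product with a determinant.
  In the change of coordinates, knowing \<phi> - \<phi> \<circ> f modulo I would say nothing about
  M. It has to be known modulo I^2, so that the errors in the entries of M lie in I, where residues
  do not see them. Jacobi's formula uses characteristic 0 through the division by an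
  exponent.\<close>

lemma module_ring: "module ((*) :: 'a::comm_ring_1 \<Rightarrow> 'a \<Rightarrow> 'a)"
  by unfold_locales (auto simp: algebra_simps)

text \<open>Coefficients are indexed by \<open>i\<close> and not by the value \<open>f i\<close>, so
  that they form matrix rows even when generators coincide.\<close>

lemma ideal_gen_image_iff:
  fixes f :: "'i \<Rightarrow> 'a::comm_ring_1"
  assumes "finite S"
  shows "x \<in> ideal_gen (f ` S) \<longleftrightarrow> (\<exists>c. x = (\<Sum>i\<in>S. c i * f i))"
proof
  interpret module "(*) :: 'a \<Rightarrow> 'a \<Rightarrow> 'a" by (rule module_ring)
  show "\<exists>c. x = (\<Sum>i\<in>S. c i * f i) \<Longrightarrow> x \<in> ideal_gen (f ` S)"
    by (auto intro!: span_sum span_scale intro: span_base)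
  assume "x \<in> ideal_gen (f ` S)"
  then show "\<exists>c. x = (\<Sum>i\<in>S. c i * f i)"
  proof (induction rule: span_induct_alt)
    case base
    show ?case by (rule exI[of _ "\<lambda>_. 0"]) simp
  next
    case (step a y z)
    then obtain j c where "j \<in> S" "y = f j" "z = (\<Sum>i\<in>S. c i * f i)" by auto
    then have "a * y + z = (\<Sum>i\<in>S. (c i + (if i = j then a else 0)) * f i)"
      using assms by (simp add: distrib_right sum.distrib if_distrib[of "\<lambda>x. x * _"] cong: if_cong)
    then show ?case by (intro exI[of _ "\<lambda>i. c i + (if i = j then a else 0)"])
  qed
qed

lemma ideal_gen_range_iff:
  fixes f :: "'i::finite \<Rightarrow> 'a::comm_ring_1"
  shows "x \<in> ideal_gen (range f) \<longleftrightarrow> (\<exists>c. x = (\<Sum>i\<in>UNIV. c i * f i))"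
  by (rule ideal_gen_image_iff) simp

lemma is_ideal_ideal_gen: "is_ideal (ideal_gen (S :: 'a::comm_ring_1 set))"
  by (rule module.subspace_span[OF module_ring])

context
  fixes J :: "'a::comm_ring_1 set"
  assumes J: "is_ideal J"
begin

lemma ideal_0: "0 \<in> J"
  by (rule module.subspace_0[OF module_ring J])

lemma ideal_add: "a \<in> J \<Longrightarrow> b \<in> J \<Longrightarrow> a + b \<in> J"
  by (rule module.subspace_add[OF module_ring J])

lemma ideal_mult: "a \<in> J \<Longrightarrow> c * a \<in> J"
  by (rule module.subspace_scale[OF module_ring J])

lemma ideal_mult_right: "a \<in> J \<Longrightarrow> a * c \<in> J"
  using ideal_mult[of a c] by (simp add: mult.commute)

lemma ideal_neg: "a \<in> J \<Longrightarrow> - a \<in> J"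
  using ideal_mult[of a "-1"] by simp

lemma ideal_diff: "a \<in> J \<Longrightarrow> b \<in> J \<Longrightarrow> a - b \<in> J"
  using ideal_add[of a "- b"] ideal_neg[of b] by simp

lemma ideal_sum: "(\<And>i. i \<in> S \<Longrightarrow> f i \<in> J) \<Longrightarrow> sum f S \<in> J"
  by (induction S rule: infinite_finite_induct) (auto intro: ideal_0 ideal_add)

lemma prod_cong_ideal:
  assumes "\<And>i. i \<in> S \<Longrightarrow> f i - g i \<in> J"
  shows "prod f S - prod g S \<in> J"
  using assms
proof (induction S rule: infinite_finite_induct)
  case (insert x S)
  have "prod f (insert x S) - prod g (insert x S)
    = f x * (prod f S - prod g S) + (f x - g x) * prod g S"
    using insert.hyps by (simp add: algebra_simps)
  moreover have "f x - g x \<in> J" "prod f S - prod g S \<in> J" using insert by auto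
  ultimately show ?case by (metis ideal_add ideal_mult ideal_mult_right)
qed (auto simp: ideal_0)

lemma power_cong_ideal: "a - b \<in> J \<Longrightarrow> a ^ n - b ^ n \<in> J"
  using prod_cong_ideal[of "{..<n}" "\<lambda>_. a" "\<lambda>_. b"] by simp

lemma det_cong_ideal:
  assumes "\<And>i j. A $ i $ j - B $ i $ j \<in> J"
  shows "det A - det B \<in> J"
  unfolding det_def sum_subtractf[symmetric] right_diff_distrib[symmetric]
  by (intro ideal_sum ideal_mult prod_cong_ideal assms)

end

lemma ideal_gen_base: "x \<in> S \<Longrightarrow> (x :: 'a::comm_ring_1) \<in> ideal_gen S"
  by (rule module.span_base[OF module_ring])

lemma ideal_gen_minimal: "is_ideal J \<Longrightarrow> S \<subseteq> J \<Longrightarrow> ideal_gen S \<subseteq> (J :: 'a::comm_ring_1 set)"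
  using module.span_minimal[OF module_ring] by blast

text \<open>The (k, j) cofactor, encoded with row \<open>k\<close> replaced by a unit vector:
  linearity in that row gives the Laplace expansion without minors, which would need a smaller index
  type.\<close>

definition rcof :: "'a::comm_ring_1^'n^'n \<Rightarrow> 'n::finite \<Rightarrow> 'n \<Rightarrow> 'a" where
  "rcof A k j = det (\<chi> a. if a = k then axis j 1 else A $ a)"

lemma det_row_expand:
  fixes A :: "'a::comm_ring_1^'n::finite^'n"
  shows "det (\<chi> a. if a = k then v else A $ a) = (\<Sum>j\<in>UNIV. v $ j * rcof A k j)"
proof -
  have "v = (\<Sum>j\<in>UNIV. v $ j *s axis j 1)"
    by (simp add: vec_eq_iff axis_def if_distrib cong: if_cong)
  then have "det (\<chi> a. if a = k then v else A $ a)
      = det (\<chi> a. if a = k then (\<Sum>j\<in>UNIV. v $ j *s axis j 1) else A $ a)" by (rule arg_cong)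
  also have "\<dots> = (\<Sum>j\<in>UNIV. det (\<chi> a. if a = k then v $ j *s axis j 1 else A $ a))"
    by (rule det_linear_row_sum) simp
  also have "\<dots> = (\<Sum>j\<in>UNIV. v $ j * rcof A k j)"
    by (simp add: rcof_def det_row_mul)
  finally show ?thesis .
qed

lemma sum_row_rcof:
  fixes A :: "'a::comm_ring_1^'n::finite^'n"
  shows "(\<Sum>j\<in>UNIV. A $ l $ j * rcof A k j) = (if l = k then det A else 0)"
proof (cases "l = k")
  case True
  have "(\<chi> a. if a = k then A $ k else A $ a) = A" by (simp add: vec_eq_iff)
  then show ?thesis using True det_row_expand[of k "A $ k" A] by simp
next
  case False
  have "det (\<chi> a. if a = k then A $ l else A $ a) = 0"
    by (rule det_identical_rows[OF False]) (use False in \<open>simp add: row_def vec_eq_iff\<close>)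
  then show ?thesis using False det_row_expand[of k "A $ l" A] by simp
qed

text \<open>The adjugate identity, free of division: over every commutative ring it puts
  \<open>det A * x $ k\<close> into the ideal generated by the entries of \<open>A *v x\<close>. The
  transpose turns the row expansion into the column expansion.\<close>

lemma cramer_rcof:
  fixes A :: "'a::comm_ring_1^'n::finite^'n"
  shows "det A * x $ k = (\<Sum>i\<in>UNIV. (A *v x) $ i * rcof (transpose A) k i)"
proof -
  have "(\<Sum>i\<in>UNIV. (A *v x) $ i * rcof (transpose A) k i)
      = (\<Sum>i\<in>UNIV. \<Sum>l\<in>UNIV. x $ l * (transpose A $ l $ i * rcof (transpose A) k i))"
    by (simp add: matrix_vector_mult_def sum_distrib_right transpose_def mult_ac)
  also have "\<dots> = (\<Sum>l\<in>UNIV. x $ l * (\<Sum>i\<in>UNIV. transpose A $ l $ i * rcof (transpose A) k i))"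
    by (subst sum.swap) (simp add: sum_distrib_left)
  also have "\<dots> = det A * x $ k"
    by (simp add: sum_row_rcof if_distrib[of "\<lambda>y. _ * y"] mult.commute[of "det A"] cong: if_cong)
  finally show ?thesis by simp
qed

text \<open>The rows of \<open>D\<close> are replaced by those of \<open>D'\<close> one at a time; the difference of two consecutive
  determinants is the determinant of a matrix that annihilates \<open>q\<close> in one row.\<close>

lemma det_transition_unique:
  fixes D D' :: "'a::comm_ring_1^'n::finite^'n"
  assumes D: "D *v q = X" and D': "D' *v q = X"
    and reg: "\<And>i u. X $ i * u \<in> ideal_gen (($) X ` (- {i})) \<Longrightarrow> u \<in> ideal_gen (($) X ` (- {i}))"
  shows "det D - det D' \<in> ideal_gen (range (($) X))"
proof -
  let ?I = "ideal_gen (range (($) X))"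
  define M where "M S = (\<chi> i. if i \<in> S then D' $ i else D $ i)" for S
  have "det (M S) - det D \<in> ?I" if "finite S" for S
    using that
  proof (induction S)
    case empty
    have "M {} = D" by (simp add: M_def vec_eq_iff)
    then show ?case by (simp add: ideal_0[OF is_ideal_ideal_gen])
  next
    case (insert i S)
    define G where "G = (\<chi> a. if a = i then D' $ i - D $ i else M S $ a)"
    have 1: "M (insert i S) = (\<chi> a. if a = i then D $ i + (D' $ i - D $ i) else M S $ a)"
      and 2: "M S = (\<chi> a. if a = i then D $ i else M S $ a)"
      using insert.hyps by (auto simp: M_def vec_eq_iff)
    have "det (M (insert i S)) = det (M S) + det G"
      unfolding 1 by (subst det_row_add) (use 2 in \<open>simp add: G_def\<close>)
    moreover
    let ?I' = "ideal_gen (($) X ` (- {i}))"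
    have rowq: "(B *v q) $ a = (\<Sum>j\<in>UNIV. B $ a $ j * q $ j)" for B :: "'a^'n^'n" and a
      by (simp add: matrix_vector_mult_def)
    have Gq: "(G *v q) $ a = (if a = i then 0 else X $ a)" for a
      using arg_cong[OF D, of "\<lambda>v. v $ a"] arg_cong[OF D', of "\<lambda>v. v $ a"]
      by (auto simp: G_def M_def rowq left_diff_distrib sum_subtractf)
    have gq: "det G * q $ j \<in> ?I'" for j
      unfolding cramer_rcof Gq
    proof (intro ideal_sum[OF is_ideal_ideal_gen] ideal_mult_right[OF is_ideal_ideal_gen])
      show "(if a = i then 0 else X $ a) \<in> ?I'" for a
        by (auto intro: ideal_gen_base ideal_0[OF is_ideal_ideal_gen])
    qed
    \<comment> \<open>The entries of \<open>G *v q\<close> are those of \<open>X\<close> with the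
      i-th one replaced by 0, so the adjugate identity puts each \<open>det G * q $ j\<close> into
      the ideal of the other \<open>X $ a\<close>. As \<open>X $ i\<close> is a combination of the
      \<open>q $ j\<close>, regularity then cancels it.\<close>
    have "X $ i * det G = (\<Sum>j\<in>UNIV. D $ i $ j * (det G * q $ j))"
      unfolding D[symmetric] rowq by (simp add: sum_distrib_left mult_ac)
    then have "X $ i * det G \<in> ?I'"
      by (simp only:) (intro ideal_sum[OF is_ideal_ideal_gen] ideal_mult[OF is_ideal_ideal_gen] gq)
    then have "det G \<in> ?I'" by (rule reg)
    then have "det G \<in> ?I"
      using module.span_mono[OF module_ring, of "($) X ` (- {i})" "range (($) X)"] by blast
    ultimately show ?case
      using ideal_add[OF is_ideal_ideal_gen insert.IH \<open>det G \<in> ?I\<close>] by (simp add: algebra_simps)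
  qed
  from this[of UNIV] have "det D' - det D \<in> ?I"
    by (simp add: M_def)
  then show ?thesis using ideal_neg[OF is_ideal_ideal_gen] by fastforce
qed

lemma det_scale_rows:
  fixes A :: "'a::comm_ring_1^'n::finite^'n"
  shows "det (\<chi> i j. d i * A $ i $ j) = (\<Prod>i\<in>UNIV. d i) * det A"
proof -
  have "det (\<chi> i. d i *s A $ i) = (\<Prod>i\<in>UNIV. d i) * det (\<chi> i. A $ i)" by (rule det_rows_mul)
  moreover have "(\<chi> i. d i *s A $ i) = (\<chi> i j. d i * A $ i $ j)" by (simp add: vec_eq_iff)
  ultimately show ?thesis by simp
qed

lemma det_scale_cols:
  fixes A :: "'a::comm_ring_1^'n::finite^'n"
  shows "det (\<chi> i j. A $ i $ j * d j) = det A * (\<Prod>i\<in>UNIV. d i)"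
proof -
  have "transpose (\<chi> i j. A $ i $ j * d j) = (\<chi> i j. d i * transpose A $ i $ j)"
    by (simp add: vec_eq_iff transpose_def mult.commute)
  then show ?thesis
    using det_transpose[of "\<chi> i j. A $ i $ j * d j"] by (simp add: det_scale_rows mult.commute)
qed

section \<open>Ring homomorphisms and dual numbers\<close>

definition is_ring_hom :: "('a::comm_ring_1 \<Rightarrow> 'b::comm_ring_1) \<Rightarrow> bool" where
  "is_ring_hom h \<longleftrightarrow> h 1 = 1 \<and> (\<forall>x y. h (x + y) = h x + h y) \<and> (\<forall>x y. h (x * y) = h x * h y)"

context
  fixes h :: "'a::comm_ring_1 \<Rightarrow> 'b::comm_ring_1"
  assumes h: "is_ring_hom h"
begin

lemma hom_1: "h 1 = 1" and hom_add: "h (x + y) = h x + h y" and hom_mult: "h (x * y) = h x * h y"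
  using h by (auto simp: is_ring_hom_def)

lemma hom_0: "h 0 = 0"
  using hom_add[of 0 0] by simp

lemma hom_neg: "h (- x) = - h x"
  using hom_add[of x "- x"] by (simp add: hom_0 eq_neg_iff_add_eq_0 add.commute)

lemma hom_diff: "h (x - y) = h x - h y"
  using hom_add[of x "- y"] by (simp add: hom_neg)

lemma hom_sum: "h (sum f S) = (\<Sum>i\<in>S. h (f i))"
  by (induction S rule: infinite_finite_induct) (auto simp: hom_0 hom_add)

lemma hom_prod: "h (prod f S) = (\<Prod>i\<in>S. h (f i))"
  by (induction S rule: infinite_finite_induct) (auto simp: hom_1 hom_mult)

lemma hom_power: "h (x ^ n) = h x ^ n"
  by (induction n) (auto simp: hom_1 hom_mult)

lemma hom_of_int: "h (of_int k) = of_int k"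
proof -
  have "h (of_nat m) = of_nat m" for m by (induction m) (auto simp: hom_0 hom_1 hom_add)
  then show ?thesis by (cases k rule: int_diff_cases) (simp add: hom_diff)
qed

lemma hom_det: "h (det A) = det (\<chi> i j. h (A $ i $ j))"
  by (simp add: det_def hom_sum hom_mult hom_prod hom_of_int)

lemma hom_matrix_vector: "h ((A *v x) $ i) = ((\<chi> i j. h (A $ i $ j)) *v (\<chi> j. h (x $ j))) $ i"
  by (simp add: matrix_vector_mult_def hom_sum hom_mult)

end

text \<open>\<open>Dual a b\<close> is a + b \<epsilon> with \<epsilon>^2 = 0. A derivation d yields
  the ring homomorphism sending x to x + \<epsilon> d x, so identities between determinants can be
  differentiated by applying it entrywise.\<close>

datatype 'a dual = Dual (dfst: 'a) (deps: 'a)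

instantiation dual :: (comm_ring_1) comm_ring_1
begin
definition zero_dual :: "'a dual" where "zero_dual = Dual 0 0"
definition one_dual :: "'a dual" where "one_dual = Dual 1 0"
definition plus_dual :: "'a dual \<Rightarrow> 'a dual \<Rightarrow> 'a dual" where
  "plus_dual x y = Dual (dfst x + dfst y) (deps x + deps y)"
definition minus_dual :: "'a dual \<Rightarrow> 'a dual \<Rightarrow> 'a dual" where
  "minus_dual x y = Dual (dfst x - dfst y) (deps x - deps y)"
definition uminus_dual :: "'a dual \<Rightarrow> 'a dual" where
  "uminus_dual x = Dual (- dfst x) (- deps x)"
definition times_dual :: "'a dual \<Rightarrow> 'a dual \<Rightarrow> 'a dual" where
  "times_dual x y = Dual (dfst x * dfst y) (dfst x * deps y + deps x * dfst y)"
instance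
  by standard (auto simp: zero_dual_def one_dual_def plus_dual_def minus_dual_def uminus_dual_def
      times_dual_def dual.expand algebra_simps)
end

lemma dual_simps [simp]:
  "dfst 0 = 0" "deps 0 = 0" "dfst 1 = 1" "deps 1 = 0"
  "dfst (x + y) = dfst x + dfst y" "deps (x + y) = deps x + deps y"
  "dfst (x * y) = dfst x * dfst y" "deps (x * y) = dfst x * deps y + deps x * dfst y"
  by (simp_all add: zero_dual_def one_dual_def plus_dual_def times_dual_def)

lemma dfst_sum: "dfst (sum f S) = (\<Sum>i\<in>S. dfst (f i))"
  and deps_sum: "deps (sum f S) = (\<Sum>i\<in>S. deps (f i))"
  by (induction S rule: infinite_finite_induct) auto

lemma dfst_prod: "dfst (prod f S) = (\<Prod>i\<in>S. dfst (f i))"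
  by (induction S rule: infinite_finite_induct) auto

lemma deps_prod: "deps (prod f S) = (\<Sum>i\<in>S. deps (f i) * (\<Prod>l\<in>S - {i}. dfst (f l)))"
proof (induction S rule: infinite_finite_induct)
  case (insert x S)
  have "(\<Sum>i\<in>S. deps (f i) * (\<Prod>l\<in>insert x S - {i}. dfst (f l)))
      = (\<Sum>i\<in>S. dfst (f x) * (deps (f i) * (\<Prod>l\<in>S - {i}. dfst (f l))))"
  proof (rule sum.cong)
    fix i assume "i \<in> S"
    then have "insert x S - {i} = insert x (S - {i})" using insert.hyps by auto
    then show "deps (f i) * (\<Prod>l\<in>insert x S - {i}. dfst (f l))
      = dfst (f x) * (deps (f i) * (\<Prod>l\<in>S - {i}. dfst (f l)))"
      using insert.hyps by (simp add: mult_ac)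
  qed simp
  moreover have "insert x S - {x} = S" using insert.hyps by auto
  ultimately show ?case
    using insert by (simp add: dfst_prod sum_distrib_left mult_ac)
qed auto

lemma dual_eq_iff: "x = y \<longleftrightarrow> dfst x = dfst y \<and> deps x = deps y"
  using dual.expand[of x y] by auto

text \<open>Generators without \<epsilon>-part generate I + \<epsilon> I; hence regularity passes to
  the dual numbers componentwise.\<close>

lemma dual_ideal_gen:
  assumes "finite S"
  shows "x \<in> ideal_gen ((\<lambda>i. Dual (f i) 0) ` S) \<longleftrightarrow>
    dfst x \<in> ideal_gen (f ` S) \<and> deps x \<in> ideal_gen (f ` S)"
proof
  assume "x \<in> ideal_gen ((\<lambda>i. Dual (f i) 0) ` S)"
  then obtain c where "x = (\<Sum>i\<in>S. c i * Dual (f i) 0)"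
    by (auto simp: ideal_gen_image_iff[OF assms])
  then show "dfst x \<in> ideal_gen (f ` S) \<and> deps x \<in> ideal_gen (f ` S)"
    unfolding ideal_gen_image_iff[OF assms] by (auto simp: dfst_sum deps_sum)
next
  assume "dfst x \<in> ideal_gen (f ` S) \<and> deps x \<in> ideal_gen (f ` S)"
  then obtain a b where "dfst x = (\<Sum>i\<in>S. a i * f i)" "deps x = (\<Sum>i\<in>S. b i * f i)"
    unfolding ideal_gen_image_iff[OF assms] by blast
  then have "x = (\<Sum>i\<in>S. Dual (a i) (b i) * Dual (f i) 0)"
    by (simp add: dual_eq_iff dfst_sum deps_sum)
  then show "x \<in> ideal_gen ((\<lambda>i. Dual (f i) 0) ` S)"
    unfolding ideal_gen_image_iff[OF assms] by (intro exI[of _ "\<lambda>i. Dual (a i) (b i)"])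
qed

lemma derivation_hom_dual:
  assumes "d 1 = 0" "\<And>x y. d (x + y) = d x + d y" "\<And>x y. d (x * y) = x * d y + d x * y"
  shows "is_ring_hom (\<lambda>x. Dual x (d x))"
  using assms by (simp add: is_ring_hom_def dual_eq_iff)

text \<open>Over \<open>R[\<epsilon>]\<close> the images of \<open>C g = X\<close> and \<open>B g\<^sup>2 = X\<^sup>2\<close> under \<open>x \<mapsto> x + \<epsilon> d x\<close> give two transition
  matrices from \<open>g + \<epsilon> d g\<close> to \<open>X\<^sup>2\<close>, because \<open>(X - \<epsilon> d X) (X + \<epsilon> d X) = X\<^sup>2\<close>, and likewise for \<open>g\<close>.\<close>

lemma derivation_transition:
  fixes d :: "'a::comm_ring_1 \<Rightarrow> 'a" and C B :: "'a^'n::finite^'n"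
  assumes d: "d 1 = 0" "\<And>x y. d (x + y) = d x + d y" "\<And>x y. d (x * y) = x * d y + d x * y"
    and C: "C *v g = X" and B: "B *v (\<chi> i. g $ i * g $ i) = (\<chi> i. X $ i * X $ i)"
    and reg: "\<And>i u. X $ i * X $ i * u \<in> ideal_gen ((\<lambda>l. X $ l * X $ l) ` (- {i})) \<Longrightarrow>
       u \<in> ideal_gen ((\<lambda>l. X $ l * X $ l) ` (- {i}))"
  shows "(\<Prod>i\<in>UNIV. X $ i) * d (det C) - det C * (\<Sum>i\<in>UNIV. d (X $ i) * (\<Prod>l\<in>-{i}. X $ l))
      + det B * (\<Sum>k\<in>UNIV. d (g $ k) * (\<Prod>l\<in>-{k}. g $ l))
    \<in> ideal_gen (range (\<lambda>i. X $ i * X $ i))"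
proof -
  define \<tau> where "\<tau> x = Dual x (d x)" for x
  have \<tau>: "is_ring_hom \<tau>" unfolding \<tau>_def by (rule derivation_hom_dual[OF d])
  define \<tau>C where "\<tau>C = (\<chi> i j. \<tau> (C $ i $ j))"
  define q where "q = (\<chi> j. \<tau> (g $ j))"
  define XX where "XX = (\<chi> i. Dual (X $ i * X $ i) 0)"
  define D1 where "D1 = (\<chi> i j. Dual (X $ i) (- d (X $ i)) * \<tau>C $ i $ j)"
  define D2 where "D2 = (\<chi> i j. (\<chi> i j. Dual (B $ i $ j) 0) $ i $ j * Dual (g $ j) (- d (g $ j)))"
  have *: "Dual x (- d x) * \<tau> x = Dual (x * x) 0" for x
    by (simp add: \<tau>_def dual_eq_iff)
  have "(\<Sum>j\<in>UNIV. \<tau>C $ i $ j * q $ j) = \<tau> (X $ i)" for i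
    unfolding \<tau>C_def q_def C[symmetric] hom_matrix_vector[OF \<tau>]
    by (simp add: matrix_vector_mult_def)
  then have D1: "D1 *v q = XX"
    unfolding D1_def XX_def *[symmetric]
    by (simp add: vec_eq_iff matrix_vector_mult_def mult.assoc sum_distrib_left[symmetric])
  have "(\<Sum>j\<in>UNIV. B $ i $ j * (g $ j * g $ j)) = X $ i * X $ i" for i
    using arg_cong[OF B, of "\<lambda>v. v $ i"] by (simp add: matrix_vector_mult_def)
  then have D2: "D2 *v q = XX"
    by (simp add: vec_eq_iff D2_def XX_def matrix_vector_mult_def q_def mult.assoc * dual_eq_iff
        dfst_sum deps_sum)
  have "det D1 - det D2 \<in> ideal_gen (range (($) XX))"
  proof (rule det_transition_unique[OF D1 D2])
    fix i u assume "XX $ i * u \<in> ideal_gen (($) XX ` (- {i}))"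
    then show "u \<in> ideal_gen (($) XX ` (- {i}))"
      by (auto simp: XX_def dual_ideal_gen intro: reg)
  qed
  \<comment> \<open>Only the \<epsilon>-part is kept: \<open>det D1\<close>, the product of all X_i
    - \<epsilon> d X_i with det C + \<epsilon> d (det C), gives the first two terms, and
    \<open>det D2\<close> the third.\<close>
  then have "deps (det D1 - det D2) \<in> ideal_gen (range (\<lambda>i. X $ i * X $ i))"
    by (simp add: XX_def dual_ideal_gen)
  moreover have "det \<tau>C = \<tau> (det C)" unfolding \<tau>C_def by (rule hom_det[OF \<tau>, symmetric])
  then have "det D1 = (\<Prod>i\<in>UNIV. Dual (X $ i) (- d (X $ i))) * \<tau> (det C)"
    unfolding D1_def by (simp only: det_scale_rows)
  moreover have "is_ring_hom (\<lambda>x::'a. Dual x 0)" by (simp add: is_ring_hom_def dual_eq_iff)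
  then have "det (\<chi> i j. Dual (B $ i $ j) 0) = Dual (det B) 0"
    by (rule hom_det[symmetric])
  then have "det D2 = Dual (det B) 0 * (\<Prod>j\<in>UNIV. Dual (g $ j) (- d (g $ j)))"
    unfolding D2_def by (simp only: det_scale_cols)
  moreover have "deps (x - y) = deps x - deps y" for x y :: "'a dual"
    by (simp add: minus_dual_def)
  ultimately show ?thesis
    by (simp add: deps_prod dfst_prod \<tau>_def Compl_eq_Diff_UNIV sum_negf algebra_simps)
qed

section \<open>Coefficients of convergent power series\<close>

lemma cps_eqI: "(\<And>\<alpha>. coeff u \<alpha> = coeff v \<alpha>) \<Longrightarrow> u = v"
  by (simp add: coeff_inject[symmetric] fun_eq_iff)

lemma coeff_0 [simp]: "coeff 0 \<alpha> = 0"
  by (simp only: zero_cps.rep_eq)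

lemma coeff_add [simp]: "coeff (u + v) \<alpha> = coeff u \<alpha> + coeff v \<alpha>"
  by (simp only: plus_cps.rep_eq)

lemma coeff_uminus [simp]: "coeff (- u) \<alpha> = - coeff u \<alpha>"
  by (simp only: uminus_cps.rep_eq)

lemma coeff_diff [simp]: "coeff (u - v) \<alpha> = coeff u \<alpha> - coeff v \<alpha>"
  unfolding minus_cps_def by (simp only: coeff_add coeff_uminus diff_conv_add_uminus)

lemma coeff_1: "coeff 1 \<alpha> = (if \<alpha> = 0 then 1 else 0)"
  by (simp add: one_cps.rep_eq)

lemma coeff_mult: "coeff (u * v) \<alpha> = (\<Sum>(\<beta>, \<gamma>) | \<beta> + \<gamma> = \<alpha>. coeff u \<beta> * coeff v \<gamma>)"
  by (simp add: times_cps.rep_eq)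

lemma coeff_sum: "coeff (sum f S) \<alpha> = (\<Sum>i\<in>S. coeff (f i) \<alpha>)"
  by (induction S rule: infinite_finite_induct) auto

lemma coeff_mult_neq_0:
  assumes "coeff (u * v) \<alpha> \<noteq> 0"
  obtains \<beta> \<gamma> where "\<alpha> = \<beta> + \<gamma>" "coeff u \<beta> \<noteq> 0" "coeff v \<gamma> \<noteq> 0"
proof -
  have "\<exists>(\<beta>, \<gamma>)\<in>{(\<beta>, \<gamma>). \<beta> + \<gamma> = \<alpha>}. coeff u \<beta> * coeff v \<gamma> \<noteq> 0"
    using assms unfolding coeff_mult by (force intro: sum.neutral)
  then show ?thesis using that by auto
qed

lift_definition mon :: "nat ^ 'n::finite \<Rightarrow> 'n cps" is "\<lambda>\<gamma> \<alpha>. if \<alpha> = \<gamma> then 1 else 0"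
  by (rule summable_zero_one)

lift_definition cst :: "complex \<Rightarrow> 'n::finite cps" is "\<lambda>a \<alpha>. if \<alpha> = 0 then a else 0"
  by (rule summable_zero_one)

lemma vec_le_iff: "(\<gamma> :: nat ^ 'n::finite) \<le> \<alpha> \<longleftrightarrow> (\<exists>\<beta>. \<alpha> = \<gamma> + \<beta>)"
proof
  assume "\<gamma> \<le> \<alpha>"
  then have "\<alpha> = \<gamma> + (\<alpha> - \<gamma>)" by (simp add: vec_eq_iff less_eq_vec_def)
  then show "\<exists>\<beta>. \<alpha> = \<gamma> + \<beta>" by blast
qed (auto simp: less_eq_vec_def)

lemma vec_add_diff: "(\<gamma> :: nat ^ 'n::finite) \<le> \<alpha> \<Longrightarrow> \<gamma> + (\<alpha> - \<gamma>) = \<alpha>"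
  by (simp add: vec_eq_iff less_eq_vec_def)

lemma vec_diff_add: "(\<gamma> + \<beta> :: nat ^ 'n::finite) - \<gamma> = \<beta>"
  by (simp add: vec_eq_iff)

lemma coeff_mon_mult:
  "coeff (mon \<gamma> * u) \<alpha> = (if \<gamma> \<le> \<alpha> then coeff u (\<alpha> - \<gamma>) else 0)"
proof -
  have "coeff (mon \<gamma> * u) \<alpha> = (\<Sum>x | fst x + snd x = \<alpha>. if fst x = \<gamma> then coeff u (snd x) else 0)"
    by (simp add: coeff_mult mon.rep_eq case_prod_unfold if_distrib[of "\<lambda>x. x * _"] cong: if_cong)
  also have "\<dots> = (\<Sum>x | fst x + snd x = \<alpha> \<and> fst x = \<gamma>. coeff u (snd x))"
    using finite_splits[of \<alpha>]
    by (subst sum.inter_filter[symmetric]) (auto simp: case_prod_unfold intro: sum.cong)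
  also have "\<dots> = (if \<gamma> \<le> \<alpha> then coeff u (\<alpha> - \<gamma>) else 0)"
  proof (cases "\<gamma> \<le> \<alpha>")
    case True
    then obtain \<beta> where \<alpha>: "\<alpha> = \<gamma> + \<beta>" using vec_le_iff by blast
    then have "{x. fst x + snd x = \<alpha> \<and> fst x = \<gamma>} = {(\<gamma>, \<beta>)}" by auto
    then show ?thesis using True \<alpha> by (simp add: vec_diff_add)
  next
    case False
    then have *: "{x. fst x + snd x = \<alpha> \<and> fst x = \<gamma>} = {}" using vec_le_iff by auto
    show ?thesis unfolding * using False by simp
  qed
  finally show ?thesis .
qed

lemma coeff_mon_mult_add: "coeff (mon \<gamma> * u) (\<alpha> + \<gamma>) = coeff u \<alpha>"
  using vec_le_iff[of \<gamma> "\<alpha> + \<gamma>"] vec_diff_add[of \<gamma> \<alpha>]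
  by (auto simp: coeff_mon_mult add.commute)

lemma mon_add: "mon (\<beta> + \<gamma>) = mon \<beta> * mon \<gamma>"
  by (rule cps_eqI) (auto simp: coeff_mon_mult mon.rep_eq vec_le_iff vec_diff_add)

lemma mon_0: "mon 0 = 1"
  by (rule cps_eqI) (simp add: mon.rep_eq coeff_1)

lemma mon_sum: "mon (sum f S) = (\<Prod>i\<in>S. mon (f i))"
  by (induction S rule: infinite_finite_induct) (auto simp: mon_0 mon_add)

lemma coord_power: "coord (i :: 'n::finite) ^ k = mon (axis i k)"
proof (induction k)
  case 0
  have "axis i 0 = (0 :: nat ^ 'n)" by (simp add: vec_eq_iff axis_def)
  then show ?case using mon_0[where 'a='n] by (simp only: power_0)
next
  case (Suc k)
  have "axis i (Suc k) = axis i 1 + (axis i k :: nat ^ 'n)" by (simp add: vec_eq_iff axis_def)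
  moreover have "coord i = mon (axis i 1)" by (rule cps_eqI) (simp add: coord.rep_eq mon.rep_eq)
  ultimately show ?case using Suc by (simp add: mon_add)
qed

lemma coord_eq_mon: "coord i = mon (axis i 1)"
  using coord_power[of i 1] by simp

lemma mon_eq_prod: "mon \<alpha> = (\<Prod>i\<in>UNIV. coord i ^ (\<alpha> $ i))"
proof -
  have "\<alpha> = (\<Sum>i\<in>UNIV. axis i (\<alpha> $ i))"
    by (simp add: vec_eq_iff axis_def)
  then show ?thesis unfolding coord_power mon_sum[symmetric] by simp
qed

lemma prod_coord_power: "(\<Prod>i\<in>UNIV. coord i ^ N) = mon (\<chi> i. N)"
  by (simp add: mon_eq_prod)

lemma coeff_cst_mult [simp]: "coeff (cst a * u) \<alpha> = a * coeff u \<alpha>"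
proof -
  have "(\<Sum>(\<beta>, \<gamma>) | \<beta> + \<gamma> = \<alpha>. (if \<beta> = 0 then a else 0) * coeff u \<gamma>)
    = a * (\<Sum>(\<beta>, \<gamma>) | \<beta> + \<gamma> = \<alpha>. coeff (mon 0) \<beta> * coeff u \<gamma>)"
    unfolding sum_distrib_left by (rule sum.cong) (auto simp: mon.rep_eq)
  then show ?thesis unfolding coeff_mult[symmetric] by (simp add: coeff_mult cst.rep_eq mon_0)
qed

lemma coeff_cst: "coeff (cst a) \<alpha> = (if \<alpha> = 0 then a else 0)"
  by (simp add: cst.rep_eq)



lemma cst_1: "cst 1 = 1" and cst_0: "cst 0 = 0" and cst_add: "cst (a + b) = cst a + cst b"
  and cst_mult: "cst (a * b) = cst a * cst b"
  by (rule cps_eqI; simp add: coeff_cst coeff_1)+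

lemma cst_prod: "cst (prod f S) = (\<Prod>i\<in>S. cst (f i))"
  by (induction S rule: infinite_finite_induct) (auto simp: cst_1 cst_mult)

lemma hom_const_term: "is_ring_hom (\<lambda>u :: 'n::finite cps. coeff u 0)"
proof -
  have "coeff (u * v) 0 = coeff u 0 * coeff v 0" for u v :: "'n cps"
  proof -
    have "{(\<beta>, \<gamma>). \<beta> + \<gamma> = (0 :: nat ^ 'n)} = {(0, 0)}" by (auto simp: vec_eq_iff)
    then show ?thesis by (simp add: coeff_mult)
  qed
  then show ?thesis by (simp add: is_ring_hom_def coeff_1)
qed

lift_definition mask :: "(nat ^ 'n::finite \<Rightarrow> bool) \<Rightarrow> 'n cps \<Rightarrow> 'n cps" is
  "\<lambda>P c \<alpha>. if P \<alpha> then c \<alpha> else 0"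
proof -
  fix P :: "nat ^ 'n \<Rightarrow> bool" and c :: "nat ^ 'n \<Rightarrow> complex"
  assume "\<exists>r>0. (\<lambda>\<alpha>. norm (c \<alpha>) * r ^ mdeg \<alpha>) summable_on UNIV"
  then obtain r where r: "r > 0" "(\<lambda>\<alpha>. norm (c \<alpha>) * r ^ mdeg \<alpha>) summable_on UNIV" by blast
  then have "(\<lambda>\<alpha>. norm (if P \<alpha> then c \<alpha> else 0) * r ^ mdeg \<alpha>) summable_on UNIV"
    by (intro summable_on_comparison_test[OF r(2)]) auto
  then show "\<exists>r>0. (\<lambda>\<alpha>. norm (if P \<alpha> then c \<alpha> else 0) * r ^ mdeg \<alpha>) summable_on UNIV"
    using r(1) by blast
qed

lift_definition shift :: "nat ^ 'n::finite \<Rightarrow> 'n cps \<Rightarrow> 'n cps" is "\<lambda>\<gamma> c \<alpha>. c (\<alpha> + \<gamma>)"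
proof -
  fix \<gamma> :: "nat ^ 'n" and c :: "nat ^ 'n \<Rightarrow> complex"
  assume "\<exists>r>0. (\<lambda>\<alpha>. norm (c \<alpha>) * r ^ mdeg \<alpha>) summable_on UNIV"
  then obtain r where r: "r > 0" "(\<lambda>\<alpha>. norm (c \<alpha>) * r ^ mdeg \<alpha>) summable_on UNIV" by blast
  have inj: "inj (\<lambda>\<alpha> :: nat ^ 'n. \<alpha> + \<gamma>)" by (auto intro: injI)
  have "(\<lambda>\<alpha>. norm (c \<alpha>) * r ^ mdeg \<alpha>) summable_on range (\<lambda>\<alpha>. \<alpha> + \<gamma>)"
    using r(2) by (rule summable_on_subset_banach) simp
  then have "(\<lambda>\<alpha>. norm (c (\<alpha> + \<gamma>)) * r ^ mdeg (\<alpha> + \<gamma>)) summable_on UNIV"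
    by (subst (asm) summable_on_reindex[OF inj]) (simp add: o_def)
  then have "(\<lambda>\<alpha>. norm (c (\<alpha> + \<gamma>)) * r ^ mdeg (\<alpha> + \<gamma>) * inverse r ^ mdeg \<gamma>) summable_on UNIV"
    by (rule summable_on_cmult_left)
  then have "(\<lambda>\<alpha>. norm (c (\<alpha> + \<gamma>)) * r ^ mdeg \<alpha>) summable_on UNIV"
    using r(1) by (simp add: mdeg_add power_add mult.assoc power_mult_distrib[symmetric])
  then show "\<exists>r>0. (\<lambda>\<alpha>. norm (c (\<alpha> + \<gamma>)) * r ^ mdeg \<alpha>) summable_on UNIV"
    using r(1) by blast
qed

lemma mon_mult_shift: "mon \<gamma> * shift \<gamma> u = mask (\<lambda>\<alpha>. \<gamma> \<le> \<alpha>) u"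
  by (rule cps_eqI) (auto simp: coeff_mon_mult shift.rep_eq mask.rep_eq add.commute vec_add_diff)

lemma axis_le_iff: "(axis i (M::nat) :: nat ^ 'n::finite) \<le> \<alpha> \<longleftrightarrow> M \<le> \<alpha> $ i"
  by (auto simp: less_eq_vec_def axis_def)

text \<open>Each term is handed to one index whose power divides it. The second clause records that
  the quotients contain only shifted coefficients of \<open>u\<close>: lower bounds for the order of
  \<open>u\<close> along the divisor thus pass to them, which Nakayama's argument needs.\<close>

lemma split_by_powers:
  fixes u :: "'n::finite cps"
  assumes "\<And>\<alpha>. coeff u \<alpha> \<noteq> 0 \<Longrightarrow> \<exists>i\<in>S. M \<le> \<alpha> $ i"
  shows "\<exists>v. u = (\<Sum>i\<in>S. coord i ^ M * v i) \<and>
    (\<forall>i \<alpha>. coeff (v i) \<alpha> \<noteq> 0 \<longrightarrow> coeff u (\<alpha> + axis i M) \<noteq> 0)"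
proof -
  have "finite S" by simp
  then show ?thesis using assms
  proof (induction S arbitrary: u)
    case empty
    then have "u = 0" by (intro cps_eqI) auto
    then show ?case by (intro exI[of _ "\<lambda>_. 0"]) simp
  next
    case (insert i S)
    define u' where "u' = mask (\<lambda>\<alpha>. \<not> axis i M \<le> \<alpha>) u"
    have u: "u = u' + coord i ^ M * shift (axis i M) u"
      unfolding coord_power mon_mult_shift by (rule cps_eqI) (auto simp: u'_def mask.rep_eq)
    have "\<exists>j\<in>S. M \<le> \<alpha> $ j" if "coeff u' \<alpha> \<noteq> 0" for \<alpha>
      using that insert.prems[of \<alpha>] by (auto simp: u'_def mask.rep_eq axis_le_iff split: if_splits)
    from insert.IH[OF this] obtain v where v: "u' = (\<Sum>i\<in>S. coord i ^ M * v i)"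
      "\<And>i \<alpha>. coeff (v i) \<alpha> \<noteq> 0 \<Longrightarrow> coeff u' (\<alpha> + axis i M) \<noteq> 0" by blast
    define v' where "v' = v(i := shift (axis i M) u)"
    have "u = (\<Sum>j\<in>insert i S. coord j ^ M * v' j)"
    proof -
      have "(\<Sum>j\<in>S. coord j ^ M * v' j) = (\<Sum>j\<in>S. coord j ^ M * v j)"
        using insert.hyps by (intro sum.cong) (auto simp: v'_def)
      then show ?thesis
        using insert.hyps by (subst u) (simp add: v(1) v'_def add.commute)
    qed
    moreover have "coeff u (\<alpha> + axis j M) \<noteq> 0" if "coeff (v' j) \<alpha> \<noteq> 0" for j \<alpha>
      using that v(2)[of j \<alpha>] by (auto simp: v'_def shift.rep_eq u'_def mask.rep_eq split: if_splits)
    ultimately show ?case by blast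
  qed
qed

lemma ideal_gen_powers_iff:
  "u \<in> ideal_gen ((\<lambda>i. coord i ^ M) ` S) \<longleftrightarrow> (\<forall>\<alpha>. coeff u \<alpha> \<noteq> 0 \<longrightarrow> (\<exists>i\<in>S. M \<le> \<alpha> $ i))"
proof
  assume "u \<in> ideal_gen ((\<lambda>i. coord i ^ M) ` S)"
  then obtain c where u: "u = (\<Sum>i\<in>S. c i * coord i ^ M)"
    by (auto simp: ideal_gen_image_iff)
  show "\<forall>\<alpha>. coeff u \<alpha> \<noteq> 0 \<longrightarrow> (\<exists>i\<in>S. M \<le> \<alpha> $ i)"
  proof (intro allI impI)
    fix \<alpha> assume "coeff u \<alpha> \<noteq> 0"
    then obtain i where "i \<in> S" "coeff (c i * coord i ^ M) \<alpha> \<noteq> 0"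
      unfolding u coeff_sum by (meson sum.not_neutral_contains_not_neutral)
    then show "\<exists>i\<in>S. M \<le> \<alpha> $ i"
      by (auto simp: coord_power mult.commute[of "c i"] coeff_mon_mult axis_le_iff split: if_splits)
  qed
next
  assume "\<forall>\<alpha>. coeff u \<alpha> \<noteq> 0 \<longrightarrow> (\<exists>i\<in>S. M \<le> \<alpha> $ i)"
  then obtain v where "u = (\<Sum>i\<in>S. coord i ^ M * v i)"
    using split_by_powers[of u S M] by blast
  then show "u \<in> ideal_gen ((\<lambda>i. coord i ^ M) ` S)"
    by (auto simp: ideal_gen_image_iff mult.commute)
qed

text \<open>Multiplication by a power of one coordinate moves exponents in that direction only, so
  divisibility by the other powers is unaffected. Regularity holds with any one power placed last,
  as \<open>det_transition_unique\<close> demands.\<close>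

lemma powers_regular:
  assumes "coord i ^ M * u \<in> ideal_gen ((\<lambda>l. coord l ^ M) ` (- {i}))"
  shows "u \<in> ideal_gen ((\<lambda>l. coord l ^ M) ` (- {i}))"
  unfolding ideal_gen_powers_iff
proof (intro allI impI)
  fix \<alpha> assume "coeff u \<alpha> \<noteq> 0"
  then have "coeff (coord i ^ M * u) (\<alpha> + axis i M) \<noteq> 0"
    by (simp add: coord_power coeff_mon_mult_add)
  then show "\<exists>l\<in>-{i}. M \<le> \<alpha> $ l"
    using assms unfolding ideal_gen_powers_iff by (fastforce simp: axis_def)
qed

section \<open>Evaluation, the identity theorem and substitution\<close>

no_notation Infinite_Set_Sum.abs_summable_on (infix \<open>abs'_summable'_on\<close> 50)

text \<open>Fubini over pairs (\<beta>, \<gamma>), regrouped along the fibres of addition; these are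
  finite, so the inner infinite sums are the convolution sums.\<close>

lemma convolution_abs_summable:
  fixes f g :: "nat ^ 'n::finite \<Rightarrow> 'b::{real_normed_field,banach}"
  assumes f: "f abs_summable_on UNIV" and g: "g abs_summable_on UNIV"
  shows "(\<lambda>\<alpha>. \<Sum>(\<beta>, \<gamma>) | \<beta> + \<gamma> = \<alpha>. f \<beta> * g \<gamma>) abs_summable_on UNIV" (is ?A)
    and "(\<Sum>\<^sub>\<infinity>\<alpha>. \<Sum>(\<beta>, \<gamma>) | \<beta> + \<gamma> = \<alpha>. f \<beta> * g \<gamma>) = infsum f UNIV * infsum g UNIV" (is ?B)
proof -
  define F where "F = (\<lambda>p. f (fst p) * g (snd p))"
  define T where "T \<alpha> = {p :: (nat ^ 'n) \<times> (nat ^ 'n). fst p + snd p = \<alpha>}" for \<alpha>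
  have T: "finite (T \<alpha>)" for \<alpha>
    using finite_splits[of \<alpha>] by (simp add: T_def case_prod_unfold)
  have F: "F abs_summable_on UNIV \<times> UNIV"
    unfolding Infinite_Sum.abs_summable_on_Sigma_iff
    using summable_on_cmult_right[OF g] summable_on_cmult_left[OF f]
    by (simp add: F_def norm_mult infsum_cmult_right' infsum_nonneg)
  have bij: "bij_betw snd (SIGMA \<alpha>:UNIV. T \<alpha>) (UNIV \<times> UNIV)"
    by (rule bij_betwI[where g = "\<lambda>p. (fst p + snd p, p)"]) (auto simp: T_def)
  have S: "(\<lambda>x. F (snd x)) abs_summable_on (SIGMA \<alpha>:UNIV. T \<alpha>)"
    using F summable_on_reindex_bij_betw[OF bij, of "\<lambda>p. norm (F p)"] by simp
  have sum_eq: "(\<Sum>(\<beta>, \<gamma>) | \<beta> + \<gamma> = \<alpha>. f \<beta> * g \<gamma>) = infsum F (T \<alpha>)" for \<alpha>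
    using T by (simp add: F_def T_def case_prod_unfold)
  have "(\<lambda>\<alpha>. \<Sum>\<^sub>\<infinity>p\<in>T \<alpha>. norm (F p)) abs_summable_on UNIV"
    using S unfolding Infinite_Sum.abs_summable_on_Sigma_iff by simp
  then show ?A
    unfolding sum_eq
  proof (rule Infinite_Sum.abs_summable_on_comparison_test)
    fix \<alpha>
    have "norm (infsum F (T \<alpha>)) \<le> (\<Sum>\<^sub>\<infinity>p\<in>T \<alpha>. norm (F p))"
      using T by (intro norm_infsum_bound) auto
    then show "norm (infsum F (T \<alpha>)) \<le> norm (\<Sum>\<^sub>\<infinity>p\<in>T \<alpha>. norm (F p))" by simp
  qed
  have "(\<Sum>\<^sub>\<infinity>\<alpha>. infsum F (T \<alpha>)) = infsum (\<lambda>x. F (snd x)) (SIGMA \<alpha>:UNIV. T \<alpha>)"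
    using infsum_Sigma_banach[OF abs_summable_summable[OF S]] by simp
  also have "\<dots> = infsum F (UNIV \<times> UNIV)"
    by (rule infsum_reindex_bij_betw[OF bij])
  also have "\<dots> = (\<Sum>\<^sub>\<infinity>\<beta>. \<Sum>\<^sub>\<infinity>\<gamma>. F (\<beta>, \<gamma>))"
    using infsum_Sigma_banach[OF abs_summable_summable[OF F]] by simp
  also have "\<dots> = infsum f UNIV * infsum g UNIV"
    by (simp add: F_def infsum_cmult_right' infsum_cmult_left')
  finally show ?B unfolding sum_eq .
qed

definition summ :: "real \<Rightarrow> 'n::finite cps \<Rightarrow> bool" where
  "summ r u \<longleftrightarrow> (\<lambda>\<alpha>. norm (coeff u \<alpha>) * r ^ mdeg \<alpha>) summable_on UNIV"

text \<open>The weighted l^1 norm of polyradius \<open>r\<close>. It is submultiplicative and bounds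
  the values on the polydisc, so the estimates for substitution reduce to it.\<close>

definition nrm :: "real \<Rightarrow> 'n::finite cps \<Rightarrow> real" where
  "nrm r u = (\<Sum>\<^sub>\<infinity>\<alpha>. norm (coeff u \<alpha>) * r ^ mdeg \<alpha>)"

definition mval :: "complex ^ 'n::finite \<Rightarrow> nat ^ 'n \<Rightarrow> complex" where
  "mval x \<alpha> = (\<Prod>i\<in>UNIV. x $ i ^ (\<alpha> $ i))"

lemma val_at_eq: "val_at u x = (\<Sum>\<^sub>\<infinity>\<alpha>. coeff u \<alpha> * mval x \<alpha>)"
  by (simp add: val_at_def mval_def)

lemma ex_summ: "\<exists>r>0. summ r u"
  using coeff[of u] by (simp add: summ_def)

lemma summ_mono: "summ r u \<Longrightarrow> 0 < s \<Longrightarrow> s \<le> r \<Longrightarrow> summ s u"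
  unfolding summ_def by (rule summable_shrink)

lemma nrm_nonneg: "r \<ge> 0 \<Longrightarrow> nrm r u \<ge> 0"
  unfolding nrm_def by (rule infsum_nonneg) simp

lemma summ_mult:
  assumes r: "r > 0" and u: "summ r u" and v: "summ r v"
  shows "summ r (u * v)" and "nrm r (u * v) \<le> nrm r u * nrm r v"
proof -
  define f where "f = (\<lambda>\<alpha>. norm (coeff u \<alpha>) * r ^ mdeg \<alpha>)"
  define g where "g = (\<lambda>\<alpha>. norm (coeff v \<alpha>) * r ^ mdeg \<alpha>)"
  define c where "c \<alpha> = (\<Sum>(\<beta>, \<gamma>) | \<beta> + \<gamma> = \<alpha>. f \<beta> * g \<gamma>)" for \<alpha>
  have nn: "f \<alpha> \<ge> 0" "g \<alpha> \<ge> 0" for \<alpha> using r by (auto simp: f_def g_def)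
  have fg: "f abs_summable_on UNIV" "g abs_summable_on UNIV"
    using u v nn by (auto simp: summ_def f_def g_def)
  note C = convolution_abs_summable[OF fg, folded c_def]
  have le: "norm (coeff (u * v) \<alpha>) * r ^ mdeg \<alpha> \<le> c \<alpha>" for \<alpha>
  proof -
    have "norm (coeff (u * v) \<alpha>) * r ^ mdeg \<alpha>
      \<le> (\<Sum>(\<beta>, \<gamma>) | \<beta> + \<gamma> = \<alpha>. norm (coeff u \<beta> * coeff v \<gamma>)) * r ^ mdeg \<alpha>"
      unfolding coeff_mult using r norm_sum[of "\<lambda>(\<beta>, \<gamma>). coeff u \<beta> * coeff v \<gamma>"]
      by (intro mult_right_mono) (auto simp: case_prod_unfold)
    also have "\<dots> = c \<alpha>"
      unfolding sum_distrib_right c_def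
      by (rule sum.cong) (auto simp: f_def g_def norm_mult mdeg_add power_add)
    finally show ?thesis .
  qed
  have cs: "c summable_on UNIV" by (rule abs_summable_summable[OF C(1)])
  show S: "summ r (u * v)"
    unfolding summ_def by (rule summable_on_comparison_test[OF cs]) (use le r in auto)
  have "nrm r (u * v) \<le> infsum c UNIV"
    unfolding nrm_def by (rule infsum_mono) (use S cs le in \<open>auto simp: summ_def\<close>)
  then show "nrm r (u * v) \<le> nrm r u * nrm r v"
    using C(2) by (simp add: nrm_def f_def g_def)
qed

lemma summ_1: "summ r (1 :: 'a::finite cps)" and nrm_1: "nrm r (1 :: 'a cps) = 1"
proof -
  have *: "norm (coeff 1 \<alpha>) * r ^ mdeg \<alpha> = (if \<alpha> = 0 then 1 else 0)" for \<alpha> :: "nat ^ 'a"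
    by (simp add: coeff_1)
  have "((\<lambda>\<alpha> :: nat ^ 'a. if \<alpha> = 0 then 1 else 0 :: real) has_sum (\<Sum>\<alpha>\<in>{0 :: nat ^ 'a}. if \<alpha> = 0 then 1 else 0)) {0}"
    by (rule has_sum_finite[of "{0}"]) simp
  then have "((\<lambda>\<alpha> :: nat ^ 'a. if \<alpha> = 0 then 1 else 0 :: real) has_sum 1) UNIV"
    by (subst has_sum_cong_neutral[where T = "{0}"]) auto
  then show "summ r (1 :: 'a cps)" "nrm r (1 :: 'a cps) = 1"
    unfolding summ_def nrm_def * by (auto simp: summable_on_def infsumI)
qed

lemma summ_prod:
  assumes r: "r > 0" and "\<And>i. i \<in> S \<Longrightarrow> summ r (f i) \<and> nrm r (f i) \<le> b i"
  shows "summ r (prod f S) \<and> nrm r (prod f S) \<le> prod b S"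
  using assms(2)
proof (induction S rule: infinite_finite_induct)
  case (insert i S)
  then have 1: "summ r (f i)" "nrm r (f i) \<le> b i" "summ r (prod f S)" "nrm r (prod f S) \<le> prod b S"
    by auto
  have "nrm r (f i * prod f S) \<le> nrm r (f i) * nrm r (prod f S)"
    using summ_mult[OF r] 1 by blast
  also have "\<dots> \<le> b i * prod b S"
    using 1 nrm_nonneg[of r] r by (intro mult_mono) (auto intro: order_trans[of 0 "nrm r (f i)"])
  finally show ?case using insert.hyps 1 summ_mult(1)[OF r] by simp
qed (auto simp: summ_1 nrm_1)

lemma summ_power: "r > 0 \<Longrightarrow> summ r u \<Longrightarrow> nrm r u \<le> b \<Longrightarrow> summ r (u ^ n) \<and> nrm r (u ^ n) \<le> b ^ n"
  using summ_prod[of r "{..<n}" "\<lambda>_. u" "\<lambda>_. b"] by simp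

text \<open>Without constant term every monomial has degree at least 1, so shrinking the radius from
  s to r gains the factor r / s. The \<open>+ 1\<close> in the radius prevents a division by
  zero.\<close>

lemma small_norm:
  assumes "coeff u 0 = 0" and e: "e > 0"
  shows "\<exists>R>0. \<forall>r. 0 < r \<and> r \<le> R \<longrightarrow> summ r u \<and> nrm r u \<le> e"
proof -
  obtain s where s: "s > 0" "summ s u" using ex_summ by blast
  define R where "R = min s (e * s / (nrm s u + 1))"
  have pos: "nrm s u + 1 > 0" using nrm_nonneg[of s u] s by linarith
  have "summ r u \<and> nrm r u \<le> e" if r: "0 < r" "r \<le> R" for r
  proof
    have rs: "r \<le> s" "r \<le> e * s / (nrm s u + 1)" using r by (auto simp: R_def)
    show ru: "summ r u" by (rule summ_mono[OF s(2) r(1) rs(1)])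
    have "nrm r u \<le> (\<Sum>\<^sub>\<infinity>\<alpha>. (r / s) * (norm (coeff u \<alpha>) * s ^ mdeg \<alpha>))"
      unfolding nrm_def
    proof (rule infsum_mono)
      show "(\<lambda>\<alpha>. norm (coeff u \<alpha>) * r ^ mdeg \<alpha>) summable_on UNIV"
        using ru by (simp add: summ_def)
      show "(\<lambda>\<alpha>. (r / s) * (norm (coeff u \<alpha>) * s ^ mdeg \<alpha>)) summable_on UNIV"
        using s by (intro summable_on_cmult_right) (simp add: summ_def)
      fix \<alpha> :: "nat ^ 'a"
      show "norm (coeff u \<alpha>) * r ^ mdeg \<alpha> \<le> (r / s) * (norm (coeff u \<alpha>) * s ^ mdeg \<alpha>)"
      proof (cases "mdeg \<alpha>")
        case 0
        then have "\<alpha> = 0" using component_le_mdeg[of \<alpha>] by (simp add: vec_eq_iff)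
        then show ?thesis using assms(1) by simp
      next
        case (Suc n)
        have "r ^ n \<le> s ^ n" using r(1) rs(1) by (intro power_mono) auto
        then have "r ^ mdeg \<alpha> \<le> (r / s) * s ^ mdeg \<alpha>"
          using r(1) s(1) unfolding Suc by simp
        then show ?thesis
          using mult_left_mono[of "r ^ mdeg \<alpha>" "(r / s) * s ^ mdeg \<alpha>" "norm (coeff u \<alpha>)"]
          by (simp add: mult_ac)
      qed
    qed
    also have "\<dots> = (r / s) * nrm s u" unfolding infsum_cmult_right' nrm_def ..
    also have "\<dots> \<le> (e / (nrm s u + 1)) * nrm s u"
      using rs(2) s(1) nrm_nonneg[of s u] by (intro mult_right_mono) (auto simp: field_simps)
    also have "\<dots> \<le> e" using pos e by (simp add: field_simps)
    finally show "nrm r u \<le> e" .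
  qed
  moreover have "R > 0" using s e pos by (simp add: R_def)
  ultimately show ?thesis by blast
qed

section \<open>Values of power series on polydiscs\<close>

lemma norm_mval_le:
  assumes "\<And>i. norm (x $ i) \<le> r"
  shows "norm (mval x \<alpha>) \<le> r ^ mdeg \<alpha>"
proof -
  have "norm (mval x \<alpha>) \<le> (\<Prod>i\<in>UNIV. r ^ (\<alpha> $ i))"
    unfolding mval_def prod_norm[symmetric] norm_power using assms by (intro prod_mono) (auto intro: power_mono)
  then show ?thesis by (simp add: mdeg_def power_sum)
qed

lemma mval_add: "mval x (\<beta> + \<gamma>) = mval x \<beta> * mval x \<gamma>"
  by (simp add: mval_def power_add prod.distrib)

lemma val_at_abs_summable:
  assumes "summ r u" and x: "\<And>i. norm (x $ i) \<le> r"
  shows "(\<lambda>\<alpha>. coeff u \<alpha> * mval x \<alpha>) abs_summable_on UNIV"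
proof -
  have r: "r \<ge> 0" using x norm_ge_zero order_trans by blast
  have "(\<lambda>\<alpha>. norm (coeff u \<alpha>) * r ^ mdeg \<alpha>) abs_summable_on UNIV"
    using assms(1) r by (simp add: summ_def)
  then show ?thesis
    by (rule Infinite_Sum.abs_summable_on_comparison_test)
       (use norm_mval_le[OF x] r in \<open>auto simp: norm_mult intro!: mult_left_mono\<close>)
qed

lemma norm_val_at_le:
  assumes u: "summ r u" and x: "\<And>i. norm (x $ i) \<le> r"
  shows "norm (val_at u x) \<le> nrm r u"
proof -
  note s = val_at_abs_summable[OF u x]
  have "norm (val_at u x) \<le> (\<Sum>\<^sub>\<infinity>\<alpha>. norm (coeff u \<alpha> * mval x \<alpha>))"
    unfolding val_at_eq by (rule norm_infsum_bound[OF s])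
  also have "\<dots> \<le> nrm r u"
    unfolding nrm_def
    by (rule infsum_mono)
       (use s u norm_mval_le[OF x] in \<open>auto simp: summ_def norm_mult intro!: mult_left_mono\<close>)
  finally show ?thesis .
qed

lemma val_at_add:
  assumes "summ r u" "summ r v" and x: "\<And>i. norm (x $ i) \<le> r"
  shows "val_at (u + v) x = val_at u x + val_at v x"
  unfolding val_at_eq using assms
  by (simp add: distrib_right infsum_add abs_summable_summable[OF val_at_abs_summable])

lemma val_at_mult:
  assumes "summ r u" "summ r v" and x: "\<And>i. norm (x $ i) \<le> r"
  shows "val_at (u * v) x = val_at u x * val_at v x"
proof -
  have "coeff (u * v) \<alpha> * mval x \<alpha>
    = (\<Sum>(\<beta>, \<gamma>) | \<beta> + \<gamma> = \<alpha>. (coeff u \<beta> * mval x \<beta>) * (coeff v \<gamma> * mval x \<gamma>))" for \<alpha>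
    unfolding coeff_mult sum_distrib_right by (rule sum.cong) (auto simp: mval_add mult_ac)
  then show ?thesis
    unfolding val_at_eq
    by (simp add: convolution_abs_summable(2)[OF val_at_abs_summable[OF assms(1) x]
          val_at_abs_summable[OF assms(2) x]])
qed

lemma val_at_finite:
  assumes "finite S" "\<And>\<alpha>. \<alpha> \<notin> S \<Longrightarrow> coeff u \<alpha> = 0"
  shows "val_at u x = (\<Sum>\<alpha>\<in>S. coeff u \<alpha> * mval x \<alpha>)"
proof -
  have "val_at u x = (\<Sum>\<^sub>\<infinity>\<alpha>\<in>S. coeff u \<alpha> * mval x \<alpha>)"
    unfolding val_at_eq using assms by (intro infsum_cong_neutral) auto
  then show ?thesis using assms(1) by simp
qed

lemma val_at_cst: "val_at (cst a) x = a"
  using val_at_finite[of "{0}" "cst a" x] by (simp add: coeff_cst mval_def)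

lemma val_at_coord: "val_at (coord i) x = x $ i"
proof -
  have "mval x (axis i 1) = (\<Prod>j\<in>UNIV. if j = i then x $ i else 1)"
    unfolding mval_def by (rule prod.cong) (auto simp: axis_def)
  then show ?thesis
    using val_at_finite[of "{axis i 1}" "coord i" x] by (simp add: coord.rep_eq)
qed

lemma val_at_0_eq: "val_at u 0 = coeff u 0"
proof -
  have "mval 0 \<alpha> = 0" if "\<alpha> \<noteq> 0" for \<alpha> :: "nat ^ 'a"
    using that by (auto simp: mval_def vec_eq_iff)
  then have "val_at u 0 = (\<Sum>\<^sub>\<infinity>\<alpha>\<in>{0}. coeff u \<alpha> * mval 0 \<alpha>)"
    unfolding val_at_eq by (intro infsum_cong_neutral) auto
  then show ?thesis by (simp add: mval_def)
qed

lemma eventually_polydisc: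
  assumes "r > 0"
  shows "\<forall>\<^sub>F x in nhds (0 :: complex ^ 'n::finite). \<forall>i. norm (x $ i) \<le> r"
proof -
  have "\<forall>\<^sub>F x in nhds (0 :: complex ^ 'n). dist x 0 < r"
    by (rule eventually_nhds_metric[THEN iffD2]) (use assms in blast)
  then show ?thesis
  proof eventually_elim
    case (elim x)
    show ?case
      using elim by (auto intro!: order_trans[OF Finite_Cartesian_Product.norm_nth_le])
  qed
qed

lemma ex_summ2: "\<exists>r>0. summ r u \<and> summ r v"
proof -
  obtain r s where "r > 0" "summ r u" "s > 0" "summ s v" using ex_summ by metis
  then show ?thesis
    by (intro exI[of _ "min r s"]) (auto intro: summ_mono)
qed

lemma eventually_val_at_add: "\<forall>\<^sub>F x in nhds 0. val_at (u + v) x = val_at u x + val_at v x"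
proof -
  obtain r where r: "r > 0" "summ r u" "summ r v" using ex_summ2 by blast
  show ?thesis
    by (rule eventually_mono[OF eventually_polydisc[OF r(1)]]) (use r val_at_add in blast)
qed

lemma eventually_val_at_mult: "\<forall>\<^sub>F x in nhds 0. val_at (u * v) x = val_at u x * val_at v x"
proof -
  obtain r where r: "r > 0" "summ r u" "summ r v" using ex_summ2 by blast
  show ?thesis
    by (rule eventually_mono[OF eventually_polydisc[OF r(1)]]) (use r val_at_mult in blast)
qed

text \<open>Induction on the set of free variables: grouping by the exponent of a new variable gives
  a one-variable polynomial that vanishes identically. The exponents in \<open>F\<close> agree
  outside \<open>S\<close>, which makes \<open>F\<close> a singleton when no variable is
  left.\<close>

lemma polynomial_identity:
  fixes c :: "nat ^ 'n::finite \<Rightarrow> complex" and S :: "'n set"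
  assumes "finite F" and "\<And>\<alpha> \<beta>. \<alpha> \<in> F \<Longrightarrow> \<beta> \<in> F \<Longrightarrow> (\<forall>i. i \<notin> S \<longrightarrow> \<alpha> $ i = \<beta> $ i)"
    and "\<And>y :: 'n \<Rightarrow> complex. (\<Sum>\<alpha>\<in>F. c \<alpha> * (\<Prod>i\<in>S. y i ^ (\<alpha> $ i))) = 0"
    and "\<alpha> \<in> F"
  shows "c \<alpha> = 0"
proof -
  have "finite S" by simp
  then show ?thesis using assms
  proof (induction S arbitrary: F \<alpha>)
    case empty
    then have "F = {\<alpha>}" by (metis (no_types, lifting) empty_iff singletonI subsetI subset_antisym vec_eq_iff insertE)
    then show ?case using empty.prems(3)[of "\<lambda>_. 0"] by simp
  next
    case (insert i S)
    define G where "G k = {\<alpha>\<in>F. \<alpha> $ i = k}" for k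
    obtain n where n: "\<And>\<alpha>. \<alpha> \<in> F \<Longrightarrow> \<alpha> $ i \<le> n"
      using finite_nat_set_iff_bounded_le[of "(\<lambda>\<alpha>. \<alpha> $ i) ` F"] insert.prems(1) by auto
    have "(\<Sum>\<alpha>\<in>G k. c \<alpha> * (\<Prod>i\<in>S. y i ^ (\<alpha> $ i))) = 0" for k and y :: "'n \<Rightarrow> complex"
    proof -
      have "(\<Sum>k\<le>n. (\<Sum>\<alpha>\<in>G k. c \<alpha> * (\<Prod>i\<in>S. y i ^ (\<alpha> $ i))) * z ^ k) = 0" for z
      proof -
        have "(\<Sum>k\<le>n. (\<Sum>\<alpha>\<in>G k. c \<alpha> * (\<Prod>i\<in>S. y i ^ (\<alpha> $ i))) * z ^ k)
          = (\<Sum>k\<le>n. \<Sum>\<alpha>\<in>{\<alpha>\<in>F. \<alpha> $ i = k}. c \<alpha> * (\<Prod>i\<in>S. y i ^ (\<alpha> $ i)) * z ^ (\<alpha> $ i))"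
          unfolding sum_distrib_right G_def by (intro sum.cong) auto
        also have "\<dots> = (\<Sum>\<alpha>\<in>F. c \<alpha> * (\<Prod>i\<in>S. y i ^ (\<alpha> $ i)) * z ^ (\<alpha> $ i))"
          using n insert.prems(1) by (intro sum.group) auto
        also have "\<dots> = (\<Sum>\<alpha>\<in>F. c \<alpha> * (\<Prod>j\<in>insert i S. (y(i := z)) j ^ (\<alpha> $ j)))"
        proof (rule sum.cong)
          fix \<alpha>
          have "(\<Prod>j\<in>S. (y(i := z)) j ^ (\<alpha> $ j)) = (\<Prod>j\<in>S. y j ^ (\<alpha> $ j))"
            using insert.hyps by (intro prod.cong) auto
          then show "c \<alpha> * (\<Prod>i\<in>S. y i ^ (\<alpha> $ i)) * z ^ (\<alpha> $ i)
            = c \<alpha> * (\<Prod>j\<in>insert i S. (y(i := z)) j ^ (\<alpha> $ j))"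
            using insert.hyps by simp
        qed simp
        finally show ?thesis using insert.prems(3) by simp
      qed
      then have "k \<le> n \<Longrightarrow> ?thesis"
        using polyfun_eq_0[of "\<lambda>k. \<Sum>\<alpha>\<in>G k. c \<alpha> * (\<Prod>i\<in>S. y i ^ (\<alpha> $ i))" n] by blast
      moreover have "\<not> k \<le> n \<Longrightarrow> G k = {}" using n by (auto simp: G_def)
      ultimately show ?thesis by (cases "k \<le> n") auto
    qed
    then show ?case
      using insert.prems
    proof (intro insert.IH[of "G (\<alpha> $ i)"])
      fix \<beta> \<gamma> assume "\<beta> \<in> G (\<alpha> $ i)" "\<gamma> \<in> G (\<alpha> $ i)"
      then show "\<forall>l. l \<notin> S \<longrightarrow> \<beta> $ l = \<gamma> $ l"
        using insert.prems(2)[of \<beta> \<gamma>] by (simp add: G_def) metis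
    qed (auto simp: G_def)
  qed
qed

text \<open>The lowest homogeneous part of \<open>u\<close> vanishes, since it is the limit of \<open>s\<^sup>-\<^sup>d u(s y)\<close>.\<close>

lemma identity_theorem_zero:
  fixes u :: "'n::finite cps"
  assumes "\<forall>\<^sub>F x in nhds 0. val_at u x = 0"
  shows "u = 0"
proof (rule ccontr)
  assume "u \<noteq> 0"
  then have ex: "\<exists>d \<alpha>. mdeg \<alpha> = d \<and> coeff u \<alpha> \<noteq> 0" using cps_eqI[of u 0] by auto
  define d where "d = (LEAST d. \<exists>\<alpha>. mdeg \<alpha> = d \<and> coeff u \<alpha> \<noteq> 0)"
  have d: "\<exists>\<alpha>. mdeg \<alpha> = d \<and> coeff u \<alpha> \<noteq> 0" unfolding d_def by (rule LeastI_ex[OF ex])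
  have below: "coeff u \<alpha> = 0" if "mdeg \<alpha> < d" for \<alpha>
    using that not_less_Least unfolding d_def by blast
  define F where "F = {\<alpha> :: nat ^ 'n. mdeg \<alpha> = d}"
  have F: "finite F" unfolding F_def by (rule finite_subset[OF _ finite_mdeg_le[of d]]) auto
  define w where "w = mask (\<lambda>\<alpha>. mdeg \<alpha> = d) u"
  define v where "v = mask (\<lambda>\<alpha>. mdeg \<alpha> > d) u"
  have uwv: "u = w + v"
    by (rule cps_eqI) (use below in \<open>auto simp: w_def v_def mask.rep_eq not_less\<close>)
  obtain r where r: "r > 0" "summ r w" "summ r v" using ex_summ2 by blast
  obtain S where S: "open S" "0 \<in> S" "\<And>x. x \<in> S \<Longrightarrow> val_at u x = 0"
    using assms unfolding eventually_nhds by blast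
  have "(\<Sum>\<alpha>\<in>F. coeff u \<alpha> * mval y \<alpha>) = 0" for y :: "complex ^ 'n"
  proof -
    define p where "p = (\<Sum>\<alpha>\<in>F. coeff u \<alpha> * mval y \<alpha>)"
    define B where "B = norm y + 1"
    have B: "B > 0" by (simp add: B_def add_nonneg_pos)
    have yB: "norm (y $ i) \<le> B" for i
      using Finite_Cartesian_Product.norm_nth_le[of y i] by (simp add: B_def)
    define s0 where "s0 = r / B"
    have s0: "s0 > 0" using r(1) B by (simp add: s0_def)
    have mval_scale: "mval (s *s y) \<alpha> = s ^ mdeg \<alpha> * mval y \<alpha>" for s \<alpha>
      by (simp add: mval_def power_mult_distrib prod.distrib mdeg_def power_sum)
    \<comment> \<open>At s y the homogeneous part equals s^d p, while the tail is O(s^(d+1)); as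
      their sum is 0, p is O(s). The choice of \<open>s0\<close> keeps s y inside the polydisc of
      convergence.\<close>
    have bound: "norm p \<le> s * (nrm r v / s0 ^ (d + 1))"
      if s: "0 < s" "s \<le> s0" "of_real s *s y \<in> S" for s :: real
    proof -
      let ?x = "of_real s *s y"
      have xr: "norm (?x $ i) \<le> r" for i
      proof -
        have "norm (?x $ i) \<le> s0 * B"
          using s yB[of i] s0 B by (simp add: norm_mult) (intro mult_mono, auto)
        then show ?thesis using B by (simp add: s0_def)
      qed
      have "val_at w ?x = (\<Sum>\<alpha>\<in>F. coeff w \<alpha> * mval ?x \<alpha>)"
        by (rule val_at_finite[OF F]) (auto simp: w_def mask.rep_eq F_def)
      also have "\<dots> = of_real s ^ d * p"
        unfolding p_def sum_distrib_left
        by (rule sum.cong) (auto simp: mval_scale w_def mask.rep_eq F_def)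
      finally have w: "val_at w ?x = of_real s ^ d * p" .
      have "norm (val_at v ?x) \<le> (\<Sum>\<^sub>\<infinity>\<alpha>. norm (coeff v \<alpha> * mval ?x \<alpha>))"
        unfolding val_at_eq by (rule norm_infsum_bound[OF val_at_abs_summable[OF r(3) xr]])
      also have "\<dots> \<le> (\<Sum>\<^sub>\<infinity>\<alpha>. (s / s0) ^ (d + 1) * (norm (coeff v \<alpha>) * r ^ mdeg \<alpha>))"
      proof (rule infsum_mono)
        show "(\<lambda>\<alpha>. norm (coeff v \<alpha> * mval ?x \<alpha>)) summable_on UNIV"
          by (rule val_at_abs_summable[OF r(3) xr])
        show "(\<lambda>\<alpha>. (s / s0) ^ (d + 1) * (norm (coeff v \<alpha>) * r ^ mdeg \<alpha>)) summable_on UNIV"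
          using r(3) by (intro summable_on_cmult_right) (simp add: summ_def)
        fix \<alpha> :: "nat ^ 'n"
        have sy: "norm (?x $ i) \<le> s / s0 * r" for i
          using s yB[of i] s0 B r(1) by (simp add: norm_mult s0_def field_simps)
        show "norm (coeff v \<alpha> * mval ?x \<alpha>) \<le> (s / s0) ^ (d + 1) * (norm (coeff v \<alpha>) * r ^ mdeg \<alpha>)"
        proof (cases "coeff v \<alpha> = 0")
          case False
          then have \<alpha>: "d + 1 \<le> mdeg \<alpha>" by (auto simp: v_def mask.rep_eq split: if_splits)
          have "norm (mval ?x \<alpha>) \<le> (s / s0 * r) ^ mdeg \<alpha>" by (rule norm_mval_le[OF sy])
          also have "\<dots> \<le> (s / s0) ^ (d + 1) * r ^ mdeg \<alpha>"
            unfolding power_mult_distrib using s s0 r(1) \<alpha>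
            by (intro mult_right_mono power_decreasing) (auto simp: field_simps)
          finally show ?thesis
            using mult_left_mono[of "norm (mval ?x \<alpha>)" "(s / s0) ^ (d + 1) * r ^ mdeg \<alpha>" "norm (coeff v \<alpha>)"]
            by (simp add: norm_mult mult_ac)
        qed simp
      qed
      also have "\<dots> = (s / s0) ^ (d + 1) * nrm r v"
        unfolding infsum_cmult_right' nrm_def ..
      finally have v: "norm (val_at v ?x) \<le> (s / s0) ^ (d + 1) * nrm r v" .
      have "val_at w ?x + val_at v ?x = 0"
        using val_at_add[OF r(2,3) xr] S(3)[OF s(3)] uwv by simp
      then have "norm (val_at w ?x) = norm (val_at v ?x)"
        by (metis add_eq_0_iff norm_minus_cancel)
      then have "s ^ d * norm p \<le> (s / s0) ^ (d + 1) * nrm r v"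
        using v s by (simp add: w norm_mult norm_power)
      also have "\<dots> = s ^ d * (s * (nrm r v / s0 ^ (d + 1)))"
        by (simp add: power_divide)
      finally show ?thesis using s(1) by (simp only: mult_le_cancel_left_pos zero_less_power)
    qed
    have lim: "((\<lambda>s. of_real s *s y) \<longlongrightarrow> (0 :: complex ^ 'n)) (at_right 0)"
    proof (rule vec_tendstoI)
      fix i
      have "((\<lambda>s. of_real s * y $ i) \<longlongrightarrow> of_real 0 * y $ i) (at_right (0::real))"
        by (intro tendsto_intros)
      then show "((\<lambda>s. (of_real s *s y) $ i) \<longlongrightarrow> (0 :: complex ^ 'n) $ i) (at_right (0::real))" by simp
    qed
    have "\<forall>\<^sub>F s in at_right (0::real). of_real s *s y \<in> S"
      using lim S(1,2) unfolding tendsto_def by blast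
    moreover have "\<forall>\<^sub>F s in at_right (0::real). 0 < s \<and> s \<le> s0"
      unfolding eventually_at_right_field using s0 by (intro exI[of _ s0]) auto
    ultimately have "\<forall>\<^sub>F s in at_right (0::real). norm p \<le> s * (nrm r v / s0 ^ (d + 1))"
      by eventually_elim (use bound in blast)
    moreover have "((\<lambda>s. s * (nrm r v / s0 ^ (d + 1))) \<longlongrightarrow> 0 * (nrm r v / s0 ^ (d + 1))) (at_right (0::real))"
      by (intro tendsto_intros)
    ultimately have "norm p \<le> 0 * (nrm r v / s0 ^ (d + 1))"
      by (intro tendsto_lowerbound[OF _ _ trivial_limit_at_right_real]) auto
    then show ?thesis by (simp add: p_def)
  qed
  from polynomial_identity[OF F, of UNIV "coeff u", OF _ this[of "vec_lambda _", unfolded mval_def vec_lambda_beta]]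
  have "coeff u \<alpha> = 0" if "\<alpha> \<in> F" for \<alpha> using that by simp
  then show False using d by (auto simp: F_def)
qed

lemma identity_theorem:
  fixes u v :: "'n::finite cps"
  assumes "\<forall>\<^sub>F x in nhds 0. val_at u x = val_at v x"
  shows "u = v"
proof -
  have "\<forall>\<^sub>F x in nhds 0. val_at (u + cst (-1) * v) x = 0"
    using assms eventually_val_at_add[of u "cst (-1) * v"] eventually_val_at_mult[of "cst (-1)" v]
    by eventually_elim (simp add: val_at_cst)
  then have "u + cst (-1) * v = 0" by (rule identity_theorem_zero)
  then have "coeff (u + cst (-1) * v) \<alpha> = 0" for \<alpha> by simp
  then show ?thesis by (intro cps_eqI) simp
qed

section \<open>Substitution of series without constant term\<close>

lemma map_at_polydisc:
  fixes \<phi> :: "'n::finite cps ^ 'm::finite"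
  assumes "\<And>i. coeff (\<phi> $ i) 0 = 0" and "s > 0"
  shows "\<exists>R>0. \<forall>r. 0 < r \<and> r \<le> R \<longrightarrow> (\<forall>i. summ r (\<phi> $ i) \<and> nrm r (\<phi> $ i) \<le> s)"
proof -
  from small_norm[OF assms]
  obtain R where R: "\<And>i. R i > 0" "\<And>i r. 0 < r \<Longrightarrow> r \<le> R i \<Longrightarrow> summ r (\<phi> $ i) \<and> nrm r (\<phi> $ i) \<le> s"
    by metis
  then show ?thesis
    by (intro exI[of _ "Min (range R)"]) auto
qed

lemma map_at_tendsto:
  fixes \<phi> :: "'n::finite cps ^ 'm::finite"
  assumes "\<And>i. coeff (\<phi> $ i) 0 = 0"
  shows "filterlim (map_at \<phi>) (nhds 0) (nhds 0)"
proof (rule vec_tendstoI)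
  fix i
  show "((\<lambda>x. map_at \<phi> x $ i) \<longlongrightarrow> (0 :: complex ^ 'm) $ i) (nhds 0)"
    unfolding tendsto_iff
  proof (intro allI impI)
    fix e :: real assume "e > 0"
    then obtain r where r: "r > 0" "\<And>i. summ r (\<phi> $ i) \<and> nrm r (\<phi> $ i) \<le> e / 2"
      using map_at_polydisc[OF assms, of "e / 2"] by force
    show "\<forall>\<^sub>F x in nhds 0. dist (map_at \<phi> x $ i) ((0 :: complex ^ 'm) $ i) < e"
      using eventually_polydisc[OF r(1)]
    proof eventually_elim
      case (elim x)
      then have "norm (val_at (\<phi> $ i) x) \<le> e / 2"
        using norm_val_at_le[of r "\<phi> $ i" x] r(2)[of i] by force
      then show ?case using \<open>e > 0\<close> by (simp add: map_at_def)
    qed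
  qed
qed

text \<open>The double series of the coefficients of u_\<alpha> \<phi>^\<alpha> is rearranged by
  powers of x. It converges absolutely because \<open>r\<close> is so small that each \<phi>_i has
  norm at most \<open>s\<close>, a radius at which \<open>u\<close> converges; then \<phi>^\<alpha>
  has norm at most s^(mdeg \<alpha>).\<close>

lemma ex_substitution:
  fixes \<phi> :: "'n::finite cps ^ 'm::finite" and u :: "'m cps"
  assumes "\<And>i. coeff (\<phi> $ i) 0 = 0"
  shows "\<exists>v. \<forall>\<^sub>F x in nhds 0. val_at v x = val_at u (map_at \<phi> x)"
proof -
  obtain s where s: "s > 0" "summ s u" using ex_summ by blast
  obtain r where r: "r > 0" "\<And>i. summ r (\<phi> $ i) \<and> nrm r (\<phi> $ i) \<le> s"
    using map_at_polydisc[OF assms s(1)] by force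
  define P where "P \<alpha> = (\<Prod>i\<in>UNIV. (\<phi> $ i) ^ (\<alpha> $ i))" for \<alpha>
  have P: "summ r (P \<alpha>) \<and> nrm r (P \<alpha>) \<le> s ^ mdeg \<alpha>" for \<alpha>
    unfolding P_def mdeg_def power_sum using r by (intro summ_prod summ_power) auto
  define F where "F = (\<lambda>(\<alpha>, \<beta>). coeff u \<alpha> * coeff (P \<alpha>) \<beta>)"
  define G where "G = (\<lambda>p :: (nat ^ 'm) \<times> (nat ^ 'n). norm (F p) * r ^ mdeg (snd p))"
  have G0: "G p \<ge> 0" for p using r(1) by (simp add: G_def)
  have G: "G abs_summable_on UNIV \<times> UNIV"
    unfolding Infinite_Sum.abs_summable_on_Sigma_iff
  proof (intro conjI ballI)
    fix \<alpha>
    have "(\<lambda>\<beta>. norm (coeff u \<alpha>) * (norm (coeff (P \<alpha>) \<beta>) * r ^ mdeg \<beta>)) summable_on UNIV"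
      using P by (intro summable_on_cmult_right) (simp add: summ_def)
    then show "(\<lambda>\<beta>. G (\<alpha>, \<beta>)) abs_summable_on UNIV"
      using r(1) by (simp add: G_def F_def norm_mult mult_ac)
  next
    have "infsum (\<lambda>\<beta>. norm (G (\<alpha>, \<beta>))) UNIV = norm (coeff u \<alpha>) * nrm r (P \<alpha>)" for \<alpha>
      using r(1) by (simp add: G_def F_def norm_mult mult_ac nrm_def infsum_cmult_right'[symmetric])
    moreover have "(\<lambda>\<alpha>. norm (coeff u \<alpha>) * nrm r (P \<alpha>)) summable_on UNIV"
    proof (rule summable_on_comparison_test)
      show "(\<lambda>\<alpha>. norm (coeff u \<alpha>) * s ^ mdeg \<alpha>) summable_on UNIV"
        using s(2) by (simp add: summ_def)
    qed (use P nrm_nonneg[of r] r(1) in \<open>auto intro!: mult_left_mono mult_nonneg_nonneg simp: less_imp_le\<close>)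
    moreover have "norm (norm (coeff u \<alpha>) * nrm r (P \<alpha>)) = norm (coeff u \<alpha>) * nrm r (P \<alpha>)" for \<alpha>
      using r(1) nrm_nonneg[of r "P \<alpha>"] by simp
    ultimately show "(\<lambda>\<alpha>. infsum (\<lambda>\<beta>. norm (G (\<alpha>, \<beta>))) UNIV) abs_summable_on UNIV"
      by simp
  qed
  define c where "c \<beta> = (\<Sum>\<^sub>\<infinity>\<alpha>. F (\<alpha>, \<beta>))" for \<beta>
  have Gswap: "(\<lambda>p. G (snd p, fst p)) abs_summable_on UNIV \<times> UNIV"
  proof -
    have "bij_betw prod.swap (UNIV \<times> UNIV) (UNIV \<times> UNIV :: ((nat ^ 'm) \<times> (nat ^ 'n)) set)"
      by (rule bij_betwI[where g = prod.swap]) auto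
    from summable_on_reindex_bij_betw[OF this, of "\<lambda>p. norm (G p)"] G
    show ?thesis by (simp add: prod.swap_def)
  qed
  have Fs: "(\<lambda>\<alpha>. F (\<alpha>, \<beta>)) abs_summable_on UNIV" for \<beta>
  proof -
    have "(\<lambda>\<alpha>. G (\<alpha>, \<beta>)) abs_summable_on UNIV"
      using Gswap unfolding Infinite_Sum.abs_summable_on_Sigma_iff by auto
    then have "(\<lambda>\<alpha>. norm (F (\<alpha>, \<beta>)) * r ^ mdeg \<beta>) summable_on UNIV"
      using r(1) by (simp add: G_def)
    then show ?thesis using r(1) by (simp add: summable_on_cmult_left')
  qed
  have "(\<lambda>\<beta>. norm (c \<beta>) * r ^ mdeg \<beta>) summable_on UNIV"
  proof (rule summable_on_comparison_test)
    show "(\<lambda>\<beta>. \<Sum>\<^sub>\<infinity>\<alpha>. norm (G (\<alpha>, \<beta>))) summable_on UNIV"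
      using Gswap abs_summable_summable[of "\<lambda>\<beta>. \<Sum>\<^sub>\<infinity>\<alpha>. norm (G (\<alpha>, \<beta>))" UNIV]
      unfolding Infinite_Sum.abs_summable_on_Sigma_iff by simp
    show "norm (c \<beta>) * r ^ mdeg \<beta> \<le> (\<Sum>\<^sub>\<infinity>\<alpha>. norm (G (\<alpha>, \<beta>)))" for \<beta>
      using r(1) norm_infsum_bound[OF Fs[of \<beta>]]
      by (simp add: G_def c_def infsum_cmult_left' mult_right_mono)
  qed (use r in auto)
  note cs = this
  have cr: "coeff (Abs_cps c) = c"
    by (rule Abs_cps_inverse) (use cs r(1) in auto)
  have "\<forall>\<^sub>F x in nhds 0. val_at (Abs_cps c) x = val_at u (map_at \<phi> x)"
    using eventually_polydisc[OF r(1)]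
  proof eventually_elim
    case (elim x)
    then have x: "norm (x $ i) \<le> r" for i by simp
    define H where "H = (\<lambda>\<alpha> \<beta>. F (\<alpha>, \<beta>) * mval x \<beta>)"
    have "(\<lambda>p. H (fst p) (snd p)) abs_summable_on UNIV \<times> UNIV"
      using G by (rule Infinite_Sum.abs_summable_on_comparison_test)
        (use norm_mval_le[OF x] r(1) in \<open>auto simp: H_def G_def norm_mult intro!: mult_left_mono\<close>)
    then have Hs: "(\<lambda>(\<alpha>, \<beta>). H \<alpha> \<beta>) summable_on UNIV \<times> UNIV"
      by (simp add: case_prod_unfold abs_summable_summable)
    have "val_at (P \<alpha>) x = mval (map_at \<phi> x) \<alpha>" for \<alpha>
    proof -
      have pw: "val_at ((\<phi> $ i) ^ n) x = val_at (\<phi> $ i) x ^ n \<and> summ r ((\<phi> $ i) ^ n)" for i n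
      proof (induction n)
        case 0
        show ?case using val_at_cst[of 1 x] by (simp add: cst_1 summ_1)
      next
        case (Suc n)
        then show ?case using r x by (simp add: val_at_mult[of r] summ_mult)
      qed
      have "val_at (\<Prod>i\<in>S. (\<phi> $ i) ^ (\<alpha> $ i)) x = (\<Prod>i\<in>S. val_at (\<phi> $ i) x ^ (\<alpha> $ i))
        \<and> summ r (\<Prod>i\<in>S. (\<phi> $ i) ^ (\<alpha> $ i))" for S
      proof (induction S rule: infinite_finite_induct)
        case (insert i S)
        then show ?case using r(1) x pw by (simp add: val_at_mult[of r] summ_mult)
      qed (use val_at_cst[of 1 x] in \<open>auto simp: cst_1 summ_1\<close>)
      then show ?thesis by (simp add: P_def mval_def map_at_def)
    qed
    then have "coeff u \<alpha> * mval (map_at \<phi> x) \<alpha> = (\<Sum>\<^sub>\<infinity>\<beta>. H \<alpha> \<beta>)" for \<alpha>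
      by (simp add: H_def F_def val_at_eq mult.assoc infsum_cmult_right')
    then have "val_at u (map_at \<phi> x) = (\<Sum>\<^sub>\<infinity>\<alpha>. \<Sum>\<^sub>\<infinity>\<beta>. H \<alpha> \<beta>)"
      unfolding val_at_eq[of u] by simp
    also have "\<dots> = (\<Sum>\<^sub>\<infinity>\<beta>. \<Sum>\<^sub>\<infinity>\<alpha>. H \<alpha> \<beta>)"
      by (rule infsum_swap_banach[OF Hs])
    also have "\<dots> = val_at (Abs_cps c) x"
      by (simp add: val_at_eq cr H_def c_def infsum_cmult_left')
    finally show ?case by simp
  qed
  then show ?thesis by blast
qed

text \<open>Composition with \<phi>, specified by its values. The identity theorem makes the choice
  unique, so the ring laws of substitution are checked pointwise near 0 instead of on
  coefficients.\<close>

definition subst :: "'n::finite cps ^ 'm::finite \<Rightarrow> 'm cps \<Rightarrow> 'n cps" where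
  "subst \<phi> u = (SOME v. \<forall>\<^sub>F x in nhds 0. val_at v x = val_at u (map_at \<phi> x))"

context
  fixes \<phi> :: "'n::finite cps ^ 'm::finite"
  assumes \<phi>: "\<And>i. coeff (\<phi> $ i) 0 = 0"
begin

lemma val_at_subst: "\<forall>\<^sub>F x in nhds 0. val_at (subst \<phi> u) x = val_at u (map_at \<phi> x)"
  unfolding subst_def by (rule someI_ex[OF ex_substitution[OF \<phi>]])

lemma subst_unique:
  assumes "\<forall>\<^sub>F x in nhds 0. val_at v x = val_at u (map_at \<phi> x)"
  shows "v = subst \<phi> u"
  by (rule identity_theorem) (use assms val_at_subst[of u] in \<open>eventually_elim, simp\<close>)

lemma subst_coord: "subst \<phi> (coord i) = \<phi> $ i"
  by (rule subst_unique[symmetric]) (simp add: val_at_coord map_at_def)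

lemma subst_cst: "subst \<phi> (cst a) = cst a"
  by (rule subst_unique[symmetric]) (simp add: val_at_cst)

lemma subst_hom: "is_ring_hom (subst \<phi>)"
proof -
  have ev: "\<forall>\<^sub>F x in nhds 0. P (map_at \<phi> x)" if "\<forall>\<^sub>F x in nhds 0. P x" for P
    using map_at_tendsto[OF \<phi>] that unfolding filterlim_iff by blast
  have "subst \<phi> u + subst \<phi> v = subst \<phi> (u + v)" for u v
    by (rule subst_unique)
      (use val_at_subst[of u] val_at_subst[of v] ev[OF eventually_val_at_add[of u v]]
        eventually_val_at_add[of "subst \<phi> u" "subst \<phi> v"] in \<open>eventually_elim, simp\<close>)
  moreover have "subst \<phi> u * subst \<phi> v = subst \<phi> (u * v)" for u v
    by (rule subst_unique)
      (use val_at_subst[of u] val_at_subst[of v] ev[OF eventually_val_at_mult[of u v]]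
        eventually_val_at_mult[of "subst \<phi> u" "subst \<phi> v"] in \<open>eventually_elim, simp\<close>)
  ultimately show ?thesis
    using subst_cst[of 1] by (simp add: is_ring_hom_def cst_1)
qed

end

section \<open>Units and the residue\<close>

lemma ex_geometric: "\<exists>v. (1 - coord 1) * v = (1 :: 1 cps)"
proof -
  have bij: "bij_betw (\<lambda>n. \<chi> i. n) UNIV (UNIV :: (nat ^ 1) set)"
    by (rule bij_betwI[where g = "\<lambda>\<alpha>. \<alpha> $ 1"]) (auto simp: vec_eq_iff forall_1)
  have "(\<lambda>n. (1/2 :: real) ^ n) summable_on UNIV"
    by (rule norm_summable_imp_summable_on) simp
  then have "(\<lambda>n. (1/2 :: real) ^ mdeg ((\<chi> i. n) :: nat ^ 1)) summable_on UNIV"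
    by (simp add: mdeg_def)
  then have "(\<lambda>\<alpha> :: nat ^ 1. (1/2 :: real) ^ mdeg \<alpha>) summable_on UNIV"
    by (rule summable_on_reindex_bij_betw[OF bij, THEN iffD1])
  then have "coeff (Abs_cps (\<lambda>_. 1)) = (\<lambda>_ :: nat ^ 1. 1)"
    by (intro Abs_cps_inverse) (auto intro!: exI[of _ "1/2 :: real"])
  then have "(1 - coord 1) * Abs_cps (\<lambda>_. 1) = (1 :: 1 cps)"
    by (intro cps_eqI)
       (auto simp: left_diff_distrib coord_eq_mon coeff_mon_mult coeff_1 axis_le_iff vec_eq_iff forall_1)
  then show ?thesis by blast
qed

text \<open>After normalising the constant term to 1, the inverse is the geometric series in 1 - a.
  Substitution into the one-variable series spares an estimate in several variables.\<close>

lemma cps_unit: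
  fixes u :: "'n::finite cps"
  assumes "coeff u 0 \<noteq> 0"
  obtains v where "u * v = 1"
proof -
  define a where "a = cst (1 / coeff u 0) * u"
  define \<phi> :: "'n cps ^ 1" where "\<phi> = (\<chi> i. 1 - a)"
  have \<phi>: "coeff (\<phi> $ i) 0 = 0" for i using assms by (simp add: \<phi>_def a_def coeff_1)
  note h = subst_hom[OF \<phi>]
  obtain g where g: "(1 - coord 1) * g = (1 :: 1 cps)" using ex_geometric by blast
  have "(1 - \<phi> $ 1) * subst \<phi> g = 1"
    using arg_cong[OF g, of "subst \<phi>"]
    by (simp add: hom_mult[OF h] hom_diff[OF h] hom_1[OF h] subst_coord[OF \<phi>])
  then have "u * (cst (1 / coeff u 0) * subst \<phi> g) = 1"
    by (simp add: \<phi>_def a_def mult_ac)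
  then show ?thesis by (rule that)
qed

text \<open>(N, ..., N) is the largest exponent divisible by no x_i^(N+1) and spans the socle of the
  quotient; hence the coefficient read by the residue depends only on the class.\<close>

lemma coeff_powers_ideal:
  "v \<in> ideal_gen (range (\<lambda>i. coord i ^ Suc N)) \<Longrightarrow> coeff v (\<chi> i. N) = 0"
  unfolding ideal_gen_powers_iff by fastforce

text \<open>The definite description is legitimate: multiplying row i by x_i^N' resp. x_i^N brings
  two transition matrices to the common exponent N + N' + 1. Their determinants then agree modulo
  these powers, and the monomial that each determinant gains compensates the shift of the
  coefficient.\<close>

lemma residue_eq:
  fixes q :: "'n::finite cps ^ 'n"
  assumes C: "C *v q = (\<chi> i. coord i ^ Suc N)"
  shows "residue u q = coeff (det C * u) (\<chi> i. N)"
  unfolding residue_def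
proof (rule the_equality)
  show "\<exists>N' C'. C' *v q = (\<chi> i. coord i ^ Suc N') \<and>
      coeff (det C * u) (\<chi> i. N) = coeff (det C' * u) (\<chi> i. N')"
    using C by blast
next
  fix r assume "\<exists>N C. C *v q = (\<chi> i. coord i ^ Suc N) \<and> r = coeff (det C * u) (\<chi> i. N)"
  then obtain N' C' where C': "C' *v q = (\<chi> i. coord i ^ Suc N')"
    and r: "r = coeff (det C' * u) (\<chi> i. N')" by blast
  define D where "D = (\<chi> i j. coord i ^ N' * C $ i $ j)"
  define D' where "D' = (\<chi> i j. coord i ^ N * C' $ i $ j)"
  define X where "X = (\<chi> i :: 'n. coord i ^ Suc (N + N'))"
  have Cq: "(\<Sum>j\<in>UNIV. C $ i $ j * q $ j) = coord i ^ Suc N"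
    and Cq': "(\<Sum>j\<in>UNIV. C' $ i $ j * q $ j) = coord i ^ Suc N'" for i
    using arg_cong[OF C, of "\<lambda>v. v $ i"] arg_cong[OF C', of "\<lambda>v. v $ i"]
    by (simp_all add: matrix_vector_mult_def)
  have "det D - det D' \<in> ideal_gen (range (($) X))"
  proof (rule det_transition_unique)
    show "D *v q = X"
      by (simp add: vec_eq_iff D_def X_def matrix_vector_mult_def mult.assoc
          sum_distrib_left[symmetric] Cq del: power_Suc flip: power_add) (simp add: add.commute)
    show "D' *v q = X"
      by (simp add: vec_eq_iff D'_def X_def matrix_vector_mult_def mult.assoc
          sum_distrib_left[symmetric] Cq' del: power_Suc flip: power_add)
    show "X $ i * u \<in> ideal_gen (($) X ` (- {i})) \<Longrightarrow> u \<in> ideal_gen (($) X ` (- {i}))" for i u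
      using powers_regular[of i "Suc (N + N')" u] by (simp add: X_def cong: image_cong)
  qed
  then have "(det D - det D') * u \<in> ideal_gen (range (\<lambda>i. coord i ^ Suc (N + N')))"
    by (intro ideal_mult_right[OF is_ideal_ideal_gen]) (simp add: X_def)
  then have "coeff ((det D - det D') * u) (\<chi> i. N + N') = 0"
    by (rule coeff_powers_ideal)
  moreover have "coeff (det D * u) (\<chi> i. N + N') = coeff (det C * u) (\<chi> i. N)"
  proof -
    have "(\<chi> i :: 'n. N + N') = (\<chi> i. N) + (\<chi> i. N')" by (simp add: vec_eq_iff)
    then show ?thesis
      by (simp add: D_def det_scale_rows prod_coord_power mult.assoc coeff_mon_mult_add)
  qed
  moreover have "coeff (det D' * u) (\<chi> i. N + N') = coeff (det C' * u) (\<chi> i. N')"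
  proof -
    have "(\<chi> i :: 'n. N + N') = (\<chi> i. N') + (\<chi> i. N)" by (simp add: vec_eq_iff)
    then show ?thesis
      by (simp add: D'_def det_scale_rows prod_coord_power mult.assoc coeff_mon_mult_add)
  qed
  ultimately show "r = coeff (det C * u) (\<chi> i. N)"
    using r by (simp add: left_diff_distrib)
qed

text \<open>The condition under which the description in \<open>residue\<close> has a value.\<close>

definition primary :: "'n::finite cps ^ 'n \<Rightarrow> bool" where
  "primary q \<longleftrightarrow> (\<exists>N C. C *v q = (\<chi> i. coord i ^ Suc N))"

lemma primaryI:
  fixes q :: "'n::finite cps ^ 'n"
  assumes "\<And>i. coord i ^ M i \<in> ideal_gen (range (($) q))"
  shows "primary q"
proof -
  define N where "N = Max (range M)"
  have "coord i ^ Suc N \<in> ideal_gen (range (($) q))" for i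
  proof -
    have "M i \<le> Suc N" unfolding N_def by (simp add: le_SucI)
    then have "coord i ^ Suc N = coord i ^ (Suc N - M i) * coord i ^ M i"
      by (simp add: power_add[symmetric])
    then show ?thesis using ideal_mult[OF is_ideal_ideal_gen assms] by simp
  qed
  then have "\<forall>i. \<exists>c. coord i ^ Suc N = (\<Sum>j\<in>UNIV. c j * q $ j)"
    by (simp add: ideal_gen_range_iff)
  then obtain c where "\<And>i. coord i ^ Suc N = (\<Sum>j\<in>UNIV. c i j * q $ j)" by metis
  then have "(\<chi> i j. c i j) *v q = (\<chi> i. coord i ^ Suc N)"
    by (simp add: matrix_vector_mult_def vec_eq_iff)
  then show ?thesis unfolding primary_def by blast
qed

lemma ideal_gen_matrix: "range (($) (M *v q)) \<subseteq> ideal_gen (range (($) q))"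
  by (auto simp: ideal_gen_range_iff matrix_vector_mult_def)

lemma primary_ideal:
  assumes "primary p" "\<And>i. p $ i \<in> ideal_gen (range (($) q))"
  shows "primary q"
proof -
  obtain N C where "C *v p = (\<chi> i. coord i ^ Suc N)" using assms(1) primary_def by blast
  then have "coord i ^ Suc N \<in> ideal_gen (range (($) p))" for i
    using ideal_gen_matrix[of C p] by (auto simp: vec_eq_iff)
  moreover have "ideal_gen (range (($) p)) \<subseteq> ideal_gen (range (($) q))"
    using assms(2) by (intro ideal_gen_minimal is_ideal_ideal_gen) auto
  ultimately show ?thesis by (intro primaryI) blast
qed

lemma primary_matrix: "primary (M *v q) \<Longrightarrow> primary q"
  by (erule primary_ideal) (rule subsetD[OF ideal_gen_matrix], rule rangeI)

text \<open>A transition matrix \<open>C\<close> for \<open>M *v q\<close> gives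
  \<open>C ** M\<close> for \<open>q\<close>, and the determinant is multiplicative.\<close>

lemma residue_transform:
  assumes "primary (M *v q)"
  shows "residue (det M * u) (M *v q) = residue u q"
proof -
  obtain N C where C: "C *v (M *v q) = (\<chi> i. coord i ^ Suc N)" using assms primary_def by blast
  then have "(C ** M) *v q = (\<chi> i. coord i ^ Suc N)" by (simp add: matrix_vector_mul_assoc)
  from residue_eq[OF this, of u] residue_eq[OF C, of "det M * u"]
  show ?thesis by (simp add: det_mul mult.assoc)
qed

lemma residue_add: "primary q \<Longrightarrow> residue (u + v) q = residue u q + residue v q"
  unfolding primary_def by (auto simp: residue_eq distrib_left)

lemma residue_diff: "primary q \<Longrightarrow> residue (u - v) q = residue u q - residue v q"
  unfolding primary_def by (auto simp: residue_eq right_diff_distrib)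

lemma residue_cst: "primary q \<Longrightarrow> residue (cst a * u) q = a * residue u q"
  unfolding primary_def by (auto simp: residue_eq mult.left_commute[of _ "cst a"])

lemma residue_0: "primary q \<Longrightarrow> residue 0 q = 0"
  unfolding primary_def by (auto simp: residue_eq)

lemma residue_sum: "primary q \<Longrightarrow> residue (sum f S) q = (\<Sum>i\<in>S. residue (f i) q)"
  by (induction S rule: infinite_finite_induct) (auto simp: residue_0 residue_add)

text \<open>By the adjugate identity \<open>det C * q $ j\<close> lies in the ideal of the
  coordinate powers, where the coefficient at (N, ..., N) vanishes.\<close>

lemma residue_ideal:
  assumes "primary q" "v \<in> ideal_gen (range (($) q))"
  shows "residue v q = 0"
proof -
  obtain N C where C: "C *v q = (\<chi> i. coord i ^ Suc N)" using assms(1) primary_def by blast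
  obtain c where c: "v = (\<Sum>j\<in>UNIV. c j * q $ j)" using assms(2) by (auto simp: ideal_gen_range_iff)
  have "det C * q $ j \<in> ideal_gen (range (\<lambda>i. coord i ^ Suc N))" for j
    unfolding cramer_rcof C vec_lambda_beta
    by (intro ideal_sum[OF is_ideal_ideal_gen] ideal_mult_right[OF is_ideal_ideal_gen] ideal_gen_base) simp
  then have "(\<Sum>j\<in>UNIV. c j * (det C * q $ j)) \<in> ideal_gen (range (\<lambda>i. coord i ^ Suc N))"
    by (intro ideal_sum[OF is_ideal_ideal_gen]) (rule ideal_mult[OF is_ideal_ideal_gen])
  then have "det C * v \<in> ideal_gen (range (\<lambda>i. coord i ^ Suc N))"
    by (simp add: c sum_distrib_left mult_ac)
  then show ?thesis using coeff_powers_ideal residue_eq[OF C] by metis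
qed

lemma residue_cong_ideal:
  assumes "primary q" "u - v \<in> ideal_gen (range (($) q))"
  shows "residue u q = residue v q"
  using residue_ideal[OF assms] residue_diff[OF assms(1), of u v] by simp

text \<open>The powers of \<open>x\<^sub>i\<close> together with \<open>J\<close> generate a descending chain of ideals.\<close>

lemma finite_length_power:
  fixes J :: "'n::finite cps set"
  assumes fin: "finite_length_quotient J" and J: "is_ideal J"
  shows "\<exists>M. coord i ^ M \<in> J"
proof -
  define I where "I k = ideal_gen (J \<union> {coord i ^ k})" for k
  have mono: "I (Suc k) \<subseteq> I k" for k
    unfolding I_def
  proof (intro ideal_gen_minimal is_ideal_ideal_gen)
    have "coord i ^ Suc k \<in> ideal_gen (J \<union> {coord i ^ k})"
      unfolding power_Suc by (intro ideal_mult[OF is_ideal_ideal_gen] ideal_gen_base) simp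
    then show "J \<union> {coord i ^ Suc k} \<subseteq> ideal_gen (J \<union> {coord i ^ k})"
      by (auto intro: ideal_gen_base)
  qed
  have dec: "I l \<subseteq> I k" if "k \<le> l" for k l
    using that by (induction l rule: dec_induct) (use mono in auto)
  have "subset.chain {M. is_ideal M \<and> J \<subseteq> M} (range I)"
    unfolding subset.chain_def
  proof (intro conjI ballI)
    show "range I \<subseteq> {M. is_ideal M \<and> J \<subseteq> M}"
      by (auto simp: I_def is_ideal_ideal_gen intro: ideal_gen_base)
    fix A B assume "A \<in> range I" "B \<in> range I"
    then obtain k l where "A = I k" "B = I l" by blast
    then have "A \<subseteq> B \<or> B \<subseteq> A" using dec[of k l] dec[of l k] by (cases "k \<le> l") auto
    then show "(\<subset>)\<^sup>=\<^sup>= A B \<or> (\<subset>)\<^sup>=\<^sup>= B A" by auto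
  qed
  then have "finite (range I)"
    using fin unfolding finite_length_quotient_def by blast
  then have "\<not> inj I" using finite_imageD by blast
  then obtain k l where kl: "k < l" "I k = I l" by (metis injI linorder_neqE_nat)
  then have "I k = I (Suc k)" using dec[of "Suc k" l] mono[of k] by auto
  then have "coord i ^ k \<in> I (Suc k)" by (auto simp: I_def intro: ideal_gen_base)
  moreover have "I (Suc k) \<subseteq> {j + a * coord i ^ Suc k | j a. j \<in> J}"
    unfolding I_def
  proof (rule ideal_gen_minimal)
    show "is_ideal {j + a * coord i ^ Suc k | j a. j \<in> J}"
      unfolding module.subspace_def[OF module_ring]
    proof (intro conjI ballI allI)
      show "0 \<in> {j + a * coord i ^ Suc k | j a. j \<in> J}"
        by (rule CollectI) (metis add.right_neutral ideal_0[OF J] mult_zero_left)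
    next
      fix x y assume "x \<in> {j + a * coord i ^ Suc k | j a. j \<in> J}" "y \<in> {j + a * coord i ^ Suc k | j a. j \<in> J}"
      then obtain j a j' a' where "x = j + a * coord i ^ Suc k" "y = j' + a' * coord i ^ Suc k" "j \<in> J" "j' \<in> J"
        by blast
      then have "x + y = (j + j') + (a + a') * coord i ^ Suc k" "j + j' \<in> J"
        using ideal_add[OF J] by (auto simp: algebra_simps)
      then show "x + y \<in> {j + a * coord i ^ Suc k | j a. j \<in> J}" by blast
    next
      fix c x assume "x \<in> {j + a * coord i ^ Suc k | j a. j \<in> J}"
      then obtain j a where "x = j + a * coord i ^ Suc k" "j \<in> J" by blast
      then have "c * x = c * j + (c * a) * coord i ^ Suc k" "c * j \<in> J"
        using ideal_mult[OF J, of j c] by (simp_all add: algebra_simps)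
      then show "c * x \<in> {j + a * coord i ^ Suc k | j a. j \<in> J}" by blast
    qed
    have "x = x + 0 * coord i ^ Suc k" for x :: "'n cps" by simp
    then have "x \<in> {j + a * coord i ^ Suc k | j a. j \<in> J}" if "x \<in> J" for x
      using that by blast
    moreover have "coord i ^ Suc k = 0 + 1 * coord i ^ Suc k" by simp
    then have "coord i ^ Suc k \<in> {j + a * coord i ^ Suc k | j a. j \<in> J}"
      using ideal_0[OF J] by blast
    ultimately show "J \<union> {coord i ^ Suc k} \<subseteq> {j + a * coord i ^ Suc k | j a. j \<in> J}" by blast
  qed
  ultimately obtain j a where ja: "coord i ^ k = j + a * coord i ^ Suc k" "j \<in> J" by blast
  \<comment> \<open>Locality: x_i^k (1 - a x_i) lies in \<open>J\<close>, and 1 - a x_i is a unit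
    because its constant term is 1.\<close>
  have "coeff (a * coord i) 0 = 0"
    using hom_mult[OF hom_const_term, of a "coord i"] by (simp add: coord.rep_eq vec_eq_iff axis_def)
  then have "coeff (1 - a * coord i) 0 \<noteq> 0" by (simp add: coeff_1)
  then obtain v where v: "(1 - a * coord i) * v = 1" by (rule cps_unit)
  have "(1 - a * coord i) * coord i ^ k = j"
    using ja(1) by (simp add: algebra_simps)
  then have "coord i ^ k = v * j"
    by (metis v mult.assoc mult.commute mult_1)
  then show ?thesis using ideal_mult[OF J ja(2)] by metis
qed

section \<open>Change of variables for the residue\<close>

lemma coeff_partial: "coeff (cps_partial i u) \<alpha> = of_nat (\<alpha> $ i + 1) * coeff u (\<alpha> + axis i 1)"
  by (simp add: cps_partial.rep_eq)

lemma partial_add: "cps_partial i (u + v) = cps_partial i u + cps_partial i v"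
  by (rule cps_eqI) (simp only: coeff_partial coeff_add distrib_left)

lemma partial_1: "cps_partial i 1 = 0"
  by (rule cps_eqI) (auto simp: coeff_partial coeff_1 vec_eq_iff axis_def)

lemma partial_cst_mult: "cps_partial i (cst a * u) = cst a * cps_partial i u"
  by (rule cps_eqI) (simp add: coeff_partial del: of_nat_Suc)

text \<open>The weight \<alpha>_i + 1 splits over each pair as \<beta>_i + \<gamma>_i. In each of
  the two resulting sums the pairs of weight 0 drop out and the others can be lowered by one in
  direction i, which leaves a convolution at \<alpha>.\<close>

lemma partial_mult: "cps_partial i (u * v) = u * cps_partial i v + cps_partial i u * v"
proof -
  have *: "(\<Sum>(\<beta>, \<gamma>) | \<beta> + \<gamma> = \<alpha> + axis i 1. of_nat (\<gamma> $ i) * (coeff u \<beta> * coeff v \<gamma>))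
      = coeff (u * cps_partial i v) \<alpha>" for u v :: "'a cps" and \<alpha>
  proof -
    have "(\<Sum>(\<beta>, \<gamma>) | \<beta> + \<gamma> = \<alpha> + axis i 1. of_nat (\<gamma> $ i) * (coeff u \<beta> * coeff v \<gamma>))
      = (\<Sum>(\<beta>, \<gamma>) | \<beta> + \<gamma> = \<alpha> + axis i 1 \<and> 1 \<le> \<gamma> $ i. of_nat (\<gamma> $ i) * (coeff u \<beta> * coeff v \<gamma>))"
      using finite_splits[of "\<alpha> + axis i 1"] by (intro sum.mono_neutral_right) auto
    also have "\<dots> = (\<Sum>(\<beta>, \<gamma>) | \<beta> + \<gamma> = \<alpha>. coeff u \<beta> * (of_nat (\<gamma> $ i + 1) * coeff v (\<gamma> + axis i 1)))"
    proof (rule sum.reindex_bij_witness[where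
          i = "\<lambda>(\<beta>, \<gamma>). (\<beta>, \<gamma> + axis i 1)" and j = "\<lambda>(\<beta>, \<gamma>). (\<beta>, \<gamma> - axis i 1)"])
      fix p assume "p \<in> {(\<beta>, \<gamma>). \<beta> + \<gamma> = \<alpha> + axis i 1 \<and> 1 \<le> \<gamma> $ i}"
      then obtain \<beta> \<gamma> where p: "p = (\<beta>, \<gamma>)" "\<beta> + \<gamma> = \<alpha> + axis i 1" "1 \<le> \<gamma> $ i" by force
      then have "axis i 1 \<le> \<gamma>" by (simp add: axis_le_iff)
      then obtain \<delta> where \<delta>: "\<gamma> = axis i 1 + \<delta>" using vec_le_iff by blast
      then have s: "\<beta> + \<delta> = \<alpha>" using p(2) by (simp add: vec_eq_iff)
      have \<delta>': "\<gamma> - axis i 1 = \<delta>" using \<delta> by (simp add: vec_diff_add)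
      show "(case (case p of (\<beta>, \<gamma>) \<Rightarrow> (\<beta>, \<gamma> - axis i 1)) of (\<beta>, \<gamma>) \<Rightarrow> (\<beta>, \<gamma> + axis i 1)) = p"
        using \<delta> by (simp add: p(1) \<delta>' add.commute)
      show "(case p of (\<beta>, \<gamma>) \<Rightarrow> (\<beta>, \<gamma> - axis i 1)) \<in> {(\<beta>, \<gamma>). \<beta> + \<gamma> = \<alpha>}"
        unfolding p(1) case_prod_conv \<delta>' using s by simp
      have "\<gamma> $ i = \<delta> $ i + 1" using \<delta> by (simp add: axis_def)
      then show "(case (case p of (\<beta>, \<gamma>) \<Rightarrow> (\<beta>, \<gamma> - axis i 1)) of (\<beta>, \<gamma>) \<Rightarrow>
          coeff u \<beta> * (of_nat (\<gamma> $ i + 1) * coeff v (\<gamma> + axis i 1))) =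
         (case p of (\<beta>, \<gamma>) \<Rightarrow> of_nat (\<gamma> $ i) * (coeff u \<beta> * coeff v \<gamma>))"
        by (simp only: p(1) case_prod_conv \<delta> vec_diff_add add.commute[of \<delta>]) (simp only: mult.left_commute)
    next
      fix p assume "p \<in> {(\<beta>, \<gamma>). \<beta> + \<gamma> = \<alpha>}"
      then obtain \<beta> \<gamma> where p: "p = (\<beta>, \<gamma>)" "\<beta> + \<gamma> = \<alpha>" by auto
      show "(case (case p of (\<beta>, \<gamma>) \<Rightarrow> (\<beta>, \<gamma> + axis i 1)) of (\<beta>, \<gamma>) \<Rightarrow> (\<beta>, \<gamma> - axis i 1)) = p"
        by (simp add: p(1) vec_eq_iff)
      show "(case p of (\<beta>, \<gamma>) \<Rightarrow> (\<beta>, \<gamma> + axis i 1))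
          \<in> {(\<beta>, \<gamma>). \<beta> + \<gamma> = \<alpha> + axis i 1 \<and> 1 \<le> \<gamma> $ i}"
        using p by (simp add: axis_def add.assoc[symmetric])
    qed
    finally show ?thesis by (simp only: coeff_mult coeff_partial)
  qed
  show ?thesis
  proof (rule cps_eqI)
    fix \<alpha> :: "nat ^ 'a"
    have "coeff (cps_partial i (u * v)) \<alpha>
      = (\<Sum>(\<beta>, \<gamma>) | \<beta> + \<gamma> = \<alpha> + axis i 1. of_nat ((\<beta> + \<gamma>) $ i) * (coeff u \<beta> * coeff v \<gamma>))"
      unfolding coeff_partial coeff_mult sum_distrib_left
    proof (rule sum.cong)
      fix p :: "(nat ^ 'a) \<times> (nat ^ 'a)" assume "p \<in> {(\<beta>, \<gamma>). \<beta> + \<gamma> = \<alpha> + axis i 1}"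
      then obtain \<beta> \<gamma> where p: "p = (\<beta>, \<gamma>)" and s: "\<beta> + \<gamma> = \<alpha> + axis i 1" by auto
      have "(\<beta> + \<gamma>) $ i = \<alpha> $ i + 1" unfolding s by (simp add: axis_def)
      then show "of_nat (\<alpha> $ i + 1) * (case p of (\<beta>, \<gamma>) \<Rightarrow> coeff u \<beta> * coeff v \<gamma>) =
         (case p of (\<beta>, \<gamma>) \<Rightarrow> of_nat ((\<beta> + \<gamma>) $ i) * (coeff u \<beta> * coeff v \<gamma>))"
        unfolding p by (simp only: case_prod_conv)
    qed simp
    also have "\<dots> = (\<Sum>(\<beta>, \<gamma>) | \<beta> + \<gamma> = \<alpha> + axis i 1. of_nat (\<gamma> $ i) * (coeff u \<beta> * coeff v \<gamma>))
        + (\<Sum>(\<beta>, \<gamma>) | \<beta> + \<gamma> = \<alpha> + axis i 1. of_nat (\<beta> $ i) * (coeff u \<beta> * coeff v \<gamma>))"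
      unfolding sum.distrib[symmetric] by (rule sum.cong) (auto simp: algebra_simps)
    also have "(\<Sum>(\<beta>, \<gamma>) | \<beta> + \<gamma> = \<alpha> + axis i 1. of_nat (\<beta> $ i) * (coeff u \<beta> * coeff v \<gamma>))
      = (\<Sum>(\<beta>, \<gamma>) | \<beta> + \<gamma> = \<alpha> + axis i 1. of_nat (\<gamma> $ i) * (coeff v \<beta> * coeff u \<gamma>))"
      by (rule sum.reindex_bij_witness[of _ prod.swap prod.swap]) (auto simp: add.commute mult_ac)
    finally show "coeff (cps_partial i (u * v)) \<alpha> = coeff (u * cps_partial i v + cps_partial i u * v) \<alpha>"
      by (simp only: * coeff_add mult.commute[of "cps_partial i u"])
  qed
qed

lemmas partial_derivation = partial_1 partial_add partial_mult

lemma partial_coord: "cps_partial j (coord i) = (if i = j then 1 else 0)"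
proof (rule cps_eqI)
  fix \<alpha> :: "nat ^ 'a"
  have "\<alpha> + axis j 1 = axis i 1 \<longleftrightarrow> i = j \<and> \<alpha> = 0"
  proof
    assume *: "\<alpha> + axis j 1 = axis i 1"
    have "i = j" using arg_cong[OF *, of "\<lambda>v. v $ j"] by (auto simp: axis_def split: if_splits)
    then show "i = j \<and> \<alpha> = 0" using * by simp
  qed simp
  then show "coeff (cps_partial j (coord i)) \<alpha> = coeff (if i = j then 1 else 0) \<alpha>"
    by (auto simp: coeff_partial coord.rep_eq coeff_1)
qed

lemma partial_power: "cps_partial j (u ^ n) = cst (of_nat n) * u ^ (n - 1) * cps_partial j u"
proof (induction n)
  case 0
  show ?case by (simp add: partial_1 cst_0)
next
  case (Suc n)
  have *: "u * (cst (of_nat n) * u ^ (n - 1)) = cst (of_nat n) * u ^ n"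
    by (cases n) (simp_all add: cst_0 mult_ac)
  have "cps_partial j (u ^ Suc n)
      = (u * (cst (of_nat n) * u ^ (n - 1))) * cps_partial j u + cps_partial j u * u ^ n"
    by (simp only: power_Suc partial_mult Suc mult.assoc)
  also have "\<dots> = (cst (of_nat n) + 1) * u ^ n * cps_partial j u"
    unfolding * by (simp only: distrib_right mult_1_left mult.commute[of "cps_partial j u"])
  finally show ?case by (simp add: cst_add cst_1 add.commute)
qed

lemma partial_commute: "cps_partial i (cps_partial j u) = cps_partial j (cps_partial i u)"
proof (cases "i = j")
  case False
  then have "(axis i 1 :: nat ^ 'a) $ j = 0" "(axis j 1 :: nat ^ 'a) $ i = 0"
    by (simp_all add: axis_def)
  then show ?thesis
    by (intro cps_eqI)
      (simp only: coeff_partial vector_add_component add_0_right mult.left_commute add.assoc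
        add.commute[of "axis i 1" "axis j 1"])
qed simp

lemma partial_sum: "cps_partial j (sum f S) = (\<Sum>i\<in>S. cps_partial j (f i))"
proof -
  have "cps_partial j 0 = 0" using partial_cst_mult[of j 0 0] by (simp add: cst_0)
  then show ?thesis by (induction S rule: infinite_finite_induct) (auto simp: partial_add)
qed

context
  fixes d :: "'a::comm_ring_1 \<Rightarrow> 'a"
  assumes d: "d 1 = 0" "\<And>x y. d (x + y) = d x + d y" "\<And>x y. d (x * y) = x * d y + d x * y"
begin

lemma derivation_sum: "d (sum f S) = (\<Sum>i\<in>S. d (f i))"
  using arg_cong[OF hom_sum[OF derivation_hom_dual[OF d], of f S], of deps] by (simp add: deps_sum)

lemma derivation_prod: "d (prod f S) = (\<Sum>i\<in>S. d (f i) * (\<Prod>l\<in>S - {i}. f l))"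
  using arg_cong[OF hom_prod[OF derivation_hom_dual[OF d], of f S], of deps] by (simp add: deps_prod)

lemma derivation_of_int: "d (of_int k) = 0"
proof -
  have "is_ring_hom (\<lambda>x. Dual x (0::'a))" by (simp add: is_ring_hom_def dual_eq_iff)
  then have "Dual (of_int k) (d (of_int k)) = Dual (of_int k) (0::'a)"
    using hom_of_int[OF derivation_hom_dual[OF d], of k]
      hom_of_int[of "\<lambda>x. Dual x (0::'a)" k] by (simp only:)
  then show ?thesis by simp
qed

lemma derivation_det:
  fixes A :: "'a^'n::finite^'n"
  shows "d (det A) = (\<Sum>i\<in>UNIV. det (\<chi> a. if a = i then (\<chi> b. d (A $ i $ b)) else A $ a))"
proof -
  have "(\<Prod>a\<in>UNIV. (if a = i then (\<chi> b. d (A $ i $ b)) else A $ a) $ p a)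
      = d (A $ i $ p i) * (\<Prod>l\<in>UNIV - {i}. A $ l $ p l)" for i and p :: "'n \<Rightarrow> 'n"
  proof -
    have "(\<Prod>a\<in>insert i (UNIV - {i}). (if a = i then (\<chi> b. d (A $ i $ b)) else A $ a) $ p a)
      = d (A $ i $ p i) * (\<Prod>l\<in>UNIV - {i}. A $ l $ p l)"
      by (subst prod.insert) (auto intro!: arg_cong2[where f = "(*)"] prod.cong)
    then show ?thesis by (simp add: insert_absorb)
  qed
  then show ?thesis
    unfolding det_def
    by (simp add: derivation_sum d(3) derivation_of_int derivation_prod sum_distrib_left)
       (rule sum.swap)
qed

end

section \<open>Powers of primary systems\<close>

lemma radical_sum:
  fixes J :: "'a::comm_ring_1 set"
  assumes J: "is_ideal J" and "finite S" "\<And>i. i \<in> S \<Longrightarrow> y i ^ b i \<in> J"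
  shows "\<exists>m. (\<Sum>i\<in>S. y i) ^ m \<in> J"
  using assms(2,3)
proof (induction S)
  case empty
  have "(\<Sum>i\<in>{}. y i) ^ 1 \<in> J" using ideal_0[OF J] by simp
  then show ?case by blast
next
  case (insert x S)
  then obtain m where m: "(\<Sum>i\<in>S. y i) ^ m \<in> J" by auto
  have x: "y x ^ b x \<in> J" using insert.prems by simp
  \<comment> \<open>In the binomial expansion with this exponent each term contains
    \<open>y x\<close> to a power of at least \<open>b x\<close>, or the remaining sum to a power of
    at least m.\<close>
  have "(y x + (\<Sum>i\<in>S. y i)) ^ (b x + m) \<in> J"
    unfolding binomial_ring
  proof (rule ideal_sum[OF J])
    fix k assume "k \<in> {..b x + m}"
    show "of_nat (b x + m choose k) * y x ^ k * (\<Sum>i\<in>S. y i) ^ (b x + m - k) \<in> J"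
    proof (cases "b x \<le> k")
      case True
      then have "y x ^ k = y x ^ (k - b x) * y x ^ b x" by (simp add: power_add[symmetric])
      then have "of_nat (b x + m choose k) * y x ^ k * (\<Sum>i\<in>S. y i) ^ (b x + m - k)
        = (of_nat (b x + m choose k) * y x ^ (k - b x) * (\<Sum>i\<in>S. y i) ^ (b x + m - k)) * y x ^ b x"
        by (simp only: mult_ac)
      then show ?thesis using ideal_mult[OF J x] by simp
    next
      case False
      then have "(\<Sum>i\<in>S. y i) ^ (b x + m - k) = (\<Sum>i\<in>S. y i) ^ (b x - k) * (\<Sum>i\<in>S. y i) ^ m"
        by (simp add: power_add[symmetric])
      then show ?thesis using m by (simp add: ideal_mult[OF J])
    qed
  qed
  then show ?case using insert.hyps by auto
qed

lemma primary_powers: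
  fixes g :: "'n::finite cps ^ 'n"
  assumes "primary g"
  shows "primary (\<chi> i. g $ i ^ b i)"
proof -
  define J where "J = ideal_gen (range (($) (\<chi> i. g $ i ^ b i)))"
  have J: "is_ideal J" unfolding J_def by (rule is_ideal_ideal_gen)
  have gJ: "g $ i ^ b i \<in> J" for i
    unfolding J_def by (rule ideal_gen_base) (auto intro: range_eqI[of _ _ i])
  obtain N C where C: "C *v g = (\<chi> i. coord i ^ Suc N)" using assms primary_def by blast
  have "\<exists>m. coord i ^ m \<in> J" for i
  proof -
    have "(C $ i $ j * g $ j) ^ b j \<in> J" for j
      unfolding power_mult_distrib by (rule ideal_mult[OF J gJ])
    from radical_sum[OF J _ this, of UNIV "\<lambda>j. j"]
    obtain m where "(\<Sum>j\<in>UNIV. C $ i $ j * g $ j) ^ m \<in> J" by auto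
    moreover have "(\<Sum>j\<in>UNIV. C $ i $ j * g $ j) = coord i ^ Suc N"
      using arg_cong[OF C, of "\<lambda>v. v $ i"] by (simp add: matrix_vector_mult_def)
    ultimately have "coord i ^ (Suc N * m) \<in> J" by (simp only: power_mult)
    then show ?thesis by blast
  qed
  then show ?thesis unfolding J_def using primaryI by metis
qed

text \<open>Used where the exponents of two transition matrices must be in a prescribed relation, or
  an exponent must exceed given orders; rows are multiplied by further coordinate powers.\<close>

lemma primary_large:
  fixes q :: "'n::finite cps ^ 'n"
  assumes "primary q"
  shows "\<exists>N0. \<forall>N\<ge>N0. \<exists>C. C *v q = (\<chi> i. coord i ^ Suc N)"
proof -
  obtain N0 C where C: "C *v q = (\<chi> i. coord i ^ Suc N0)" using assms primary_def by blast
  have Cq: "(\<Sum>j\<in>UNIV. C $ i $ j * q $ j) = coord i ^ Suc N0" for i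
    using arg_cong[OF C, of "\<lambda>v. v $ i"] by (simp add: matrix_vector_mult_def)
  have "(\<chi> i j. coord i ^ (N - N0) * C $ i $ j) *v q = (\<chi> i. coord i ^ Suc N)" if "N \<ge> N0" for N
    using that by (simp add: matrix_vector_mult_def vec_eq_iff mult.assoc sum_distrib_left[symmetric] Cq
        del: power_Suc flip: power_add)
  then show ?thesis by blast
qed

lemma diag_mult_vec: "(\<chi> i j. if i = j then m i else 0) *v v = (\<chi> i. m i * v $ i)"
  for v :: "'a::comm_ring_1^'n::finite"
  by (simp add: matrix_vector_mult_def vec_eq_iff if_distrib[of "\<lambda>x. x * _"] cong: if_cong)

lemma det_diag: "det (\<chi> i j. if i = j then m i else 0) = (\<Prod>i\<in>UNIV. m i)"
  for m :: "'n::finite \<Rightarrow> 'a::comm_ring_1"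
  by (subst det_diagonal) auto

text \<open>The diagonal case of the transformation law: factors common to numerator and
  denominators cancel.\<close>

lemma residue_scale:
  fixes q :: "'n::finite cps ^ 'n"
  assumes "primary (\<chi> i. m i * q $ i)"
  shows "residue ((\<Prod>i\<in>UNIV. m i) * u) (\<chi> i. m i * q $ i) = residue u q"
  using residue_transform[of "\<chi> i j. if i = j then m i else 0" q u] assms
  by (simp add: diag_mult_vec det_diag)

text \<open>The residue of an exact form vanishes: \<open>\<partial>\<^sub>j (u / (g\<^sub>1 \<cdots> g\<^sub>n))\<close> has residue \<open>0\<close>.\<close>

lemma residue_partial:
  fixes g :: "'n::finite cps ^ 'n"
  assumes g: "primary g"
  shows "residue (cps_partial j u) g
    = (\<Sum>k\<in>UNIV. residue (u * cps_partial j (g $ k)) (\<chi> i. if i = k then g $ i * g $ i else g $ i))"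
proof -
  define G where "G = (\<chi> i. g $ i * g $ i)"
  have G: "primary G"
    using primary_powers[OF g, of "\<lambda>_. 2"] by (simp add: G_def power2_eq_square)
  obtain N1 where N1: "\<And>N. N \<ge> N1 \<Longrightarrow> \<exists>C. C *v g = (\<chi> i. coord i ^ Suc N)" using primary_large[OF g] by blast
  obtain N2 where N2: "\<And>N. N \<ge> N2 \<Longrightarrow> \<exists>C. C *v G = (\<chi> i. coord i ^ Suc N)" using primary_large[OF G] by blast
  define N where "N = max N1 N2"
  obtain C where C: "C *v g = (\<chi> i. coord i ^ Suc N)" using N1[of N] by (auto simp: N_def)
  \<comment> \<open>With this exponent the target powers of \<open>B\<close> are the squares of
    those of \<open>C\<close>, since 2 N + 2 = 2 (N + 1).\<close>
  have "N2 \<le> 2 * N + 1" by (simp add: N_def)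
  then obtain B where B: "B *v G = (\<chi> i. coord i ^ Suc (2 * N + 1))" using N2 by blast
  define X where "X = (\<chi> i :: 'n. coord i ^ Suc N)"
  have XX: "X $ i * X $ i = coord i ^ Suc (2 * N + 1)" for i
    by (simp only: X_def vec_lambda_beta power_add[symmetric]) (simp add: mult_2)
  define \<Phi> where "\<Phi> v = coeff v (\<chi> i :: 'n. 2 * N + 1)" for v
  define c where "c = det C"
  let ?d = "cps_partial j"
  have "(\<Prod>i\<in>UNIV. X $ i) * ?d c - c * (\<Sum>i\<in>UNIV. ?d (X $ i) * (\<Prod>l\<in>-{i}. X $ l))
      + det B * (\<Sum>k\<in>UNIV. ?d (g $ k) * (\<Prod>l\<in>-{k}. g $ l)) \<in> ideal_gen (range (\<lambda>i. X $ i * X $ i))"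
    unfolding c_def
  proof (rule derivation_transition)
    show "C *v g = X" using C by (simp add: X_def)
    show "B *v (\<chi> i. g $ i * g $ i) = (\<chi> i. X $ i * X $ i)"
      using B unfolding XX G_def by simp
    show "X $ i * X $ i * v \<in> ideal_gen ((\<lambda>l. X $ l * X $ l) ` (- {i})) \<Longrightarrow>
       v \<in> ideal_gen ((\<lambda>l. X $ l * X $ l) ` (- {i}))" for i v
      unfolding XX by (rule powers_regular)
  qed (fact partial_1 partial_add partial_mult)+
  then have "u * ((\<Prod>i\<in>UNIV. X $ i) * ?d c - c * (\<Sum>i\<in>UNIV. ?d (X $ i) * (\<Prod>l\<in>-{i}. X $ l))
      + det B * (\<Sum>k\<in>UNIV. ?d (g $ k) * (\<Prod>l\<in>-{k}. g $ l))) \<in> ideal_gen (range (\<lambda>i. X $ i * X $ i))"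
    by (rule ideal_mult[OF is_ideal_ideal_gen])
  then have "\<Phi> (u * ((\<Prod>i\<in>UNIV. X $ i) * ?d c - c * (\<Sum>i\<in>UNIV. ?d (X $ i) * (\<Prod>l\<in>-{i}. X $ l))
      + det B * (\<Sum>k\<in>UNIV. ?d (g $ k) * (\<Prod>l\<in>-{k}. g $ l)))) = 0"
    unfolding XX \<Phi>_def by (rule coeff_powers_ideal)
  then have main: "\<Phi> ((\<Prod>i\<in>UNIV. X $ i) * (u * ?d c))
      - (\<Sum>i\<in>UNIV. \<Phi> ((c * u) * (?d (X $ i) * (\<Prod>l\<in>-{i}. X $ l))))
      + (\<Sum>k\<in>UNIV. \<Phi> (det B * ((\<Prod>l\<in>-{k}. g $ l) * (u * ?d (g $ k))))) = 0"
    by (simp add: \<Phi>_def distrib_left right_diff_distrib sum_distrib_left coeff_sum mult_ac)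
  have \<Phi>_mon: "\<Phi> (mon \<gamma> * v) = coeff v \<beta>" if "\<beta> + \<gamma> = (\<chi> i. 2 * N + 1)" for \<beta> \<gamma> v
    unfolding \<Phi>_def that[symmetric] by (rule coeff_mon_mult_add)
  have 1: "\<Phi> ((\<Prod>i\<in>UNIV. X $ i) * (u * ?d c)) = coeff (u * ?d c) (\<chi> i. N)"
    unfolding X_def vec_lambda_beta prod_coord_power by (rule \<Phi>_mon) (simp add: vec_eq_iff)
  \<comment> \<open>Only i = j contributes. The factor N + 1 from differentiating x_j^(N+1) is also
    the factor in the coefficient of \<partial>_j (c u) at (N, ..., N).\<close>
  have 2: "(\<Sum>i\<in>UNIV. \<Phi> ((c * u) * (?d (X $ i) * (\<Prod>l\<in>-{i}. X $ l)))) = coeff (?d (c * u)) (\<chi> i. N)"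
  proof -
    define \<gamma> :: "nat ^ 'n" where "\<gamma> = (\<chi> l. if l = j then N else Suc N)"
    have "(\<Prod>l\<in>insert j (- {j}). coord l ^ (\<gamma> $ l)) = coord j ^ N * (\<Prod>l\<in>-{j}. X $ l)"
      by (subst prod.insert) (auto simp: \<gamma>_def X_def intro!: arg_cong2[where f = "(*)"] prod.cong)
    moreover have "insert j (- {j}) = UNIV" by auto
    ultimately have mon: "mon \<gamma> = coord j ^ N * (\<Prod>l\<in>-{j}. X $ l)"
      unfolding mon_eq_prod by simp
    have "\<Phi> ((c * u) * (?d (X $ i) * (\<Prod>l\<in>-{i}. X $ l)))
        = (if i = j then coeff (?d (c * u)) (\<chi> i. N) else 0)" for i
    proof (cases "i = j")
      case True
      have "?d (X $ j) = cst (of_nat (Suc N)) * coord j ^ N"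
        unfolding X_def vec_lambda_beta partial_power partial_coord by simp
      then have "(c * u) * (?d (X $ j) * (\<Prod>l\<in>-{j}. X $ l)) = mon \<gamma> * (cst (of_nat (Suc N)) * (c * u))"
        unfolding mon by (simp only: mult_ac)
      moreover have "\<Phi> (mon \<gamma> * (cst (of_nat (Suc N)) * (c * u)))
          = coeff (cst (of_nat (Suc N)) * (c * u)) ((\<chi> i. N) + axis j 1)"
        by (rule \<Phi>_mon) (simp add: vec_eq_iff \<gamma>_def axis_def)
      ultimately show ?thesis
        using True by (simp only: coeff_partial coeff_cst_mult if_True vec_lambda_beta Suc_eq_plus1 simp_thms)
    next
      case False
      then show ?thesis by (simp add: X_def partial_power partial_coord \<Phi>_def del: power_Suc)
    qed
    then show ?thesis by simp
  qed
  \<comment> \<open>Cancelling g_l for l \<noteq> k turns the system of all squares into the one in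
    which only g_k is squared.\<close>
  have 3: "\<Phi> (det B * ((\<Prod>l\<in>-{k}. g $ l) * (u * ?d (g $ k))))
      = residue (u * ?d (g $ k)) (\<chi> i. if i = k then g $ i * g $ i else g $ i)" for k
  proof -
    define m where "m i = (if i = k then 1 else g $ i)" for i
    have mG: "G = (\<chi> i. m i * (\<chi> i. if i = k then g $ i * g $ i else g $ i) $ i)"
      by (simp add: G_def m_def vec_eq_iff)
    have "(\<Prod>i\<in>insert k (-{k}). m i) = (\<Prod>l\<in>-{k}. g $ l)"
      by (subst prod.insert) (auto simp: m_def intro!: prod.cong)
    moreover have "insert k (-{k}) = UNIV" by auto
    ultimately have "(\<Prod>i\<in>UNIV. m i) = (\<Prod>l\<in>-{k}. g $ l)" by simp
    then have "residue (u * ?d (g $ k)) (\<chi> i. if i = k then g $ i * g $ i else g $ i)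
      = residue ((\<Prod>l\<in>-{k}. g $ l) * (u * ?d (g $ k))) G"
      using residue_scale[of m "\<chi> i. if i = k then g $ i * g $ i else g $ i" "u * ?d (g $ k)"]
        G mG by simp
    then show ?thesis unfolding residue_eq[OF B] \<Phi>_def by simp
  qed
  have "residue (?d u) g = coeff (c * ?d u) (\<chi> i. N)"
    unfolding c_def by (rule residue_eq[OF C])
  also have "\<dots> = coeff (?d (c * u)) (\<chi> i. N) - coeff (u * ?d c) (\<chi> i. N)"
    by (simp add: partial_mult mult.commute)
  also have "\<dots> = (\<Sum>k\<in>UNIV. \<Phi> (det B * ((\<Prod>l\<in>-{k}. g $ l) * (u * ?d (g $ k)))))"
    using main unfolding 1 2 by (simp add: algebra_simps)
  finally show ?thesis unfolding 3 .
qed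

text \<open>The cofactors of one row of a Jacobian matrix form a divergence-free field:
  differentiating another row i yields second derivatives of \<phi>_i, symmetric in j and l,
  contracted with determinants \<open>T i j l\<close> that change sign when j and l are
  exchanged.\<close>

lemma piola:
  fixes \<phi> :: "'n::finite cps ^ 'n"
  shows "(\<Sum>j\<in>UNIV. cps_partial j (rcof (jac \<phi>) k j)) = 0"
proof -
  define T where "T i j l = det (\<chi> a. if a = i then axis l 1 else if a = k then axis j 1 else jac \<phi> $ a)"
    for i j l
  have anti: "T i j l = - T i l j" if "i \<noteq> k" for i j l
  proof -
    let ?A = "\<chi> a. if a = i then axis j 1 else if a = k then axis l 1 else jac \<phi> $ a"
    let ?p = "Transposition.transpose i k"
    have "(\<chi> a. ?A $ ?p a) = (\<chi> a. if a = i then axis l 1 else if a = k then axis j 1 else jac \<phi> $ a)"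
      using that by (auto simp: vec_eq_iff Transposition.transpose_def)
    moreover have "det (\<chi> a. ?A $ ?p a) = of_int (sign ?p) * det ?A"
      by (rule det_permute_rows) (simp add: permutes_swap_id)
    ultimately show ?thesis using that by (simp add: T_def sign_swap_id)
  qed
  \<comment> \<open>Contracting symmetric with antisymmetric terms yields only u = - u;
    characteristic 0 then gives u = 0.\<close>
  have zero: "u = 0" if "u = - u" for u :: "'n cps"
  proof (rule cps_eqI)
    fix \<alpha>
    have "coeff u \<alpha> = - coeff u \<alpha>" using arg_cong[OF that, of "\<lambda>v. coeff v \<alpha>"] by simp
    then show "coeff u \<alpha> = coeff 0 \<alpha>" by simp
  qed
  define h where "h i j l = cps_partial j (cps_partial l (\<phi> $ i))" for i j l
  have "cps_partial j (rcof (jac \<phi>) k j) = (\<Sum>i\<in>-{k}. \<Sum>l\<in>UNIV. h i j l * T i j l)" for j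
  proof -
    define R where "R = (\<chi> a. if a = k then axis j 1 else jac \<phi> $ a)"
    have "cps_partial j (rcof (jac \<phi>) k j)
        = (\<Sum>i\<in>UNIV. det (\<chi> a. if a = i then (\<chi> b. cps_partial j (R $ i $ b)) else R $ a))"
      unfolding rcof_def R_def[symmetric] by (rule derivation_det[OF partial_derivation])
    also have "\<dots> = (\<Sum>i\<in>-{k}. det (\<chi> a. if a = i then (\<chi> b. cps_partial j (R $ i $ b)) else R $ a))"
    proof (rule sum.mono_neutral_right)
      have "cps_partial j (axis j 1 $ b) = 0" for b
        using partial_1[of j] partial_cst_mult[of j 0 0] by (auto simp: axis_def cst_0)
      then have 0: "(\<chi> b. cps_partial j (R $ k $ b)) = 0" by (simp add: R_def vec_eq_iff)
      have "det (\<chi> a. if a = k then (\<chi> b. cps_partial j (R $ k $ b)) else R $ a) = 0"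
        unfolding 0 by (rule det_row_0)
      moreover have "UNIV - - {k} = {k}" by auto
      ultimately show "\<forall>i\<in>UNIV - - {k}.
          det (\<chi> a. if a = i then (\<chi> b. cps_partial j (R $ i $ b)) else R $ a) = 0"
        by (metis singletonD)
    qed auto
    also have "\<dots> = (\<Sum>i\<in>-{k}. \<Sum>l\<in>UNIV. h i j l * T i j l)"
    proof (rule sum.cong)
      fix i assume i: "i \<in> - {k}"
      have "rcof R i l = T i j l" for l
        unfolding rcof_def T_def R_def by (rule arg_cong[where f = det]) (simp add: vec_eq_iff)
      then show "det (\<chi> a. if a = i then (\<chi> b. cps_partial j (R $ i $ b)) else R $ a)
          = (\<Sum>l\<in>UNIV. h i j l * T i j l)"
        using i by (simp add: det_row_expand R_def h_def jac_def)
    qed simp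
    finally show ?thesis .
  qed
  then have "(\<Sum>j\<in>UNIV. cps_partial j (rcof (jac \<phi>) k j))
      = (\<Sum>i\<in>-{k}. \<Sum>j\<in>UNIV. \<Sum>l\<in>UNIV. h i j l * T i j l)"
    by simp (rule sum.swap)
  also have "\<dots> = 0"
  proof (rule sum.neutral, rule ballI, rule zero)
    fix i assume i: "i \<in> -{k}"
    have "(\<Sum>j\<in>UNIV. \<Sum>l\<in>UNIV. h i j l * T i j l) = (\<Sum>j\<in>UNIV. \<Sum>l\<in>UNIV. - (h i l j * T i l j))"
    proof (intro sum.cong refl)
      fix j l
      show "h i j l * T i j l = - (h i l j * T i l j)"
        using anti[of i j l] i partial_commute[of j l "\<phi> $ i"] by (simp add: h_def)
    qed
    also have "\<dots> = - (\<Sum>l\<in>UNIV. \<Sum>j\<in>UNIV. h i l j * T i l j)"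
      unfolding sum_negf by (subst sum.swap) (rule refl)
    finally show "(\<Sum>j\<in>UNIV. \<Sum>l\<in>UNIV. h i j l * T i j l) = - (\<Sum>j\<in>UNIV. \<Sum>l\<in>UNIV. h i j l * T i j l)" .
  qed
  finally show ?thesis .
qed

text \<open>The vanishing of residues of exact forms is applied to the cofactors c_j of row k over
  the denominators \<phi>^b and summed over j. The terms with \<partial>_j c_j vanish by the Piola
  identity; in the others the row expansion leaves only l = k, which is b_k times the residue
  sought. Dividing by b_k \<ge> 1 concludes.\<close>

lemma residue_jacobian_powers:
  fixes \<phi> :: "'n::finite cps ^ 'n"
  assumes \<phi>: "primary \<phi>" and b: "b k \<ge> 1"
  shows "residue (det (jac \<phi>)) (\<chi> i. \<phi> $ i ^ (b(k := Suc (b k))) i) = 0"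
proof -
  define g where "g = (\<chi> i. \<phi> $ i ^ b i)"
  have g: "primary g" unfolding g_def by (rule primary_powers[OF \<phi>])
  define g2 where "g2 l = (\<chi> i. if i = l then g $ i * g $ i else g $ i)" for l
  have g2: "primary (g2 l)" for l
  proof -
    have "g2 l = (\<chi> i. g $ i ^ (if i = l then 2 else 1))" by (simp add: g2_def vec_eq_iff power2_eq_square)
    then show ?thesis using primary_powers[OF g] by simp
  qed
  let ?c = "rcof (jac \<phi>) k"
  have "0 = (\<Sum>j\<in>UNIV. residue (cps_partial j (?c j)) g)"
    unfolding residue_sum[OF g, symmetric] piola residue_0[OF g] ..
  also have "\<dots> = (\<Sum>j\<in>UNIV. \<Sum>l\<in>UNIV. residue (?c j * cps_partial j (g $ l)) (g2 l))"
    unfolding residue_partial[OF g] g2_def ..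
  also have "\<dots> = (\<Sum>l\<in>UNIV. residue (\<Sum>j\<in>UNIV. ?c j * cps_partial j (g $ l)) (g2 l))"
    by (subst sum.swap) (simp add: residue_sum[OF g2])
  also have "\<dots> = (\<Sum>l\<in>UNIV. if l = k then
      of_nat (b k) * residue (\<phi> $ k ^ (b k - 1) * det (jac \<phi>)) (g2 k) else 0)"
  proof (rule sum.cong)
    fix l
    have "(\<Sum>j\<in>UNIV. ?c j * cps_partial j (g $ l))
        = cst (of_nat (b l)) * (\<phi> $ l ^ (b l - 1) * (\<Sum>j\<in>UNIV. jac \<phi> $ l $ j * ?c j))"
      by (simp add: g_def partial_power jac_def sum_distrib_left mult_ac)
    also have "\<dots> = (if l = k then cst (of_nat (b k)) * (\<phi> $ k ^ (b k - 1) * det (jac \<phi>)) else 0)"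
      by (simp add: sum_row_rcof)
    finally show "residue (\<Sum>j\<in>UNIV. ?c j * cps_partial j (g $ l)) (g2 l)
      = (if l = k then of_nat (b k) * residue (\<phi> $ k ^ (b k - 1) * det (jac \<phi>)) (g2 k) else 0)"
      by (simp add: residue_0[OF g2] residue_cst[OF g2])
  qed simp
  also have "\<dots> = of_nat (b k) * residue (\<phi> $ k ^ (b k - 1) * det (jac \<phi>)) (g2 k)" by simp
  finally have "residue (\<phi> $ k ^ (b k - 1) * det (jac \<phi>)) (g2 k) = 0" using b by simp
  moreover
  define m where "m i = (if i = k then \<phi> $ k ^ (b k - 1) else 1)" for i
  \<comment> \<open>The squared denominator is \<phi>_k^(2 b_k), and cancelling \<phi>_k^(b_k - 1)
    with the numerator leaves the exponent b_k + 1.\<close>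
  have eq: "g2 k = (\<chi> i. m i * (\<chi> i. \<phi> $ i ^ (b(k := Suc (b k))) i) $ i)"
    using b by (simp add: g2_def g_def m_def vec_eq_iff mult_2 del: power_Suc flip: power_add)
  have "residue ((\<Prod>i\<in>UNIV. m i) * det (jac \<phi>)) (g2 k)
      = residue (det (jac \<phi>)) (\<chi> i. \<phi> $ i ^ (b(k := Suc (b k))) i)"
    unfolding eq by (rule residue_scale) (use g2[of k] in \<open>simp only: eq\<close>)
  moreover have "(\<Prod>i\<in>UNIV. m i) = \<phi> $ k ^ (b k - 1)" by (simp add: m_def)
  ultimately show ?thesis by simp
qed

section \<open>Jacobi's formula and the change of variables\<close>

lemma finite_box: "finite {\<beta> :: nat ^ 'n::finite. \<forall>i. \<beta> $ i \<le> N}"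
proof (rule finite_subset[OF _ finite_mdeg_le])
  show "{\<beta> :: nat ^ 'n. \<forall>i. \<beta> $ i \<le> N} \<subseteq> {\<beta>. mdeg \<beta> \<le> CARD('n) * N}"
    using sum_bounded_above[of "UNIV :: 'n set" _ N] by (auto simp: mdeg_def)
qed

lemma box_decomposition:
  fixes v :: "'n::finite cps"
  shows "\<exists>w. v = (\<Sum>\<beta> | \<forall>i. \<beta> $ i \<le> N. cst (coeff v \<beta>) * mon \<beta>) + (\<Sum>i\<in>UNIV. coord i ^ Suc N * w i)"
proof -
  define Box where "Box = {\<beta> :: nat ^ 'n. \<forall>i. \<beta> $ i \<le> N}"
  have Box: "finite Box" unfolding Box_def by (rule finite_box)
  define r where "r = mask (\<lambda>\<alpha>. \<alpha> \<notin> Box) v"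
  have "coeff (\<Sum>\<beta>\<in>Box. cst (coeff v \<beta>) * mon \<beta>) \<alpha> = (if \<alpha> \<in> Box then coeff v \<alpha> else 0)" for \<alpha>
    using Box by (simp add: coeff_sum mon.rep_eq if_distrib[of "\<lambda>x. _ * x"] cong: if_cong)
  then have v: "v = (\<Sum>\<beta>\<in>Box. cst (coeff v \<beta>) * mon \<beta>) + r"
    by (intro cps_eqI) (auto simp: r_def mask.rep_eq)
  have "\<exists>i\<in>UNIV. Suc N \<le> \<alpha> $ i" if "coeff r \<alpha> \<noteq> 0" for \<alpha>
    using that by (auto simp: r_def mask.rep_eq Box_def not_le Suc_le_eq split: if_splits)
  from split_by_powers[OF this] obtain w where "r = (\<Sum>i\<in>UNIV. coord i ^ Suc N * w i)" by blast
  then show ?thesis using v unfolding Box_def by blast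
qed

context
  fixes \<phi> :: "'n::finite cps ^ 'n"
  assumes \<phi>0: "\<And>i. coeff (\<phi> $ i) 0 = 0" and jac0: "coeff (det (jac \<phi>)) 0 \<noteq> 0"
begin

text \<open>With \<phi> = B x the product rule shows that B and the Jacobian matrix agree at 0, so
  \<open>det B\<close> is a unit and the coordinates lie in the ideal of \<phi>. The transformation
  law then gives the quotient of the two determinants at 0 as residue.\<close>

lemma coordinates_primary: "primary \<phi>"
  and residue_jacobian: "residue (det (jac \<phi>)) \<phi> = 1"
proof -
  have "\<forall>i. \<exists>v. \<phi> $ i = (\<Sum>j\<in>UNIV. coord j * v j)"
  proof
    fix i
    have "\<exists>j\<in>UNIV. 1 \<le> \<alpha> $ j" if "coeff (\<phi> $ i) \<alpha> \<noteq> 0" for \<alpha>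
    proof (rule ccontr)
      assume "\<not> (\<exists>j\<in>UNIV. 1 \<le> \<alpha> $ j)"
      then have "\<alpha> = 0" by (auto simp: vec_eq_iff not_le)
      then show False using that \<phi>0 by simp
    qed
    from split_by_powers[OF this] show "\<exists>v. \<phi> $ i = (\<Sum>j\<in>UNIV. coord j * v j)"
      unfolding power_one_right by blast
  qed
  from choice[OF this] obtain v where v: "\<And>i. \<phi> $ i = (\<Sum>j\<in>UNIV. coord j * v i j)" by blast
  define B where "B = (\<chi> i j. v i j)"
  have B: "B *v (\<chi> i. coord i) = \<phi>"
    by (simp add: vec_eq_iff matrix_vector_mult_def B_def v mult.commute)
  note h = hom_const_term[where 'n = 'n]
  have coord0: "coeff (coord j) 0 = 0" for j :: 'n by (simp add: coord.rep_eq vec_eq_iff axis_def)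
  have "coeff (jac \<phi> $ i $ j) 0 = coeff (B $ i $ j) 0" for i j
  proof -
    have "coeff (jac \<phi> $ i $ j) 0 = (\<Sum>l\<in>UNIV. coeff (coord l) 0 * coeff (cps_partial j (v i l)) 0
        + coeff (cps_partial j (coord l)) 0 * coeff (v i l) 0)"
      by (simp add: jac_def v partial_sum partial_mult coeff_sum hom_mult[OF h]
          hom_add[OF h])
    also have "\<dots> = (\<Sum>l\<in>UNIV. if l = j then coeff (v i j) 0 else 0)"
      by (intro sum.cong refl) (auto simp: coord0 partial_coord coeff_1)
    finally show ?thesis by (simp add: B_def)
  qed
  then have eq: "coeff (det (jac \<phi>)) 0 = coeff (det B) 0"
    by (simp add: hom_det[OF h])
  then obtain w where w: "det B * w = 1" using jac0 cps_unit by metis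
  have "coord i ^ 1 \<in> ideal_gen (range (($) \<phi>))" for i
  proof -
    have "coord i = w * (det B * coord i)" using w by (metis mult.assoc mult.commute mult_1)
    also have "det B * coord i = (\<Sum>l\<in>UNIV. \<phi> $ l * rcof (transpose B) i l)"
      using cramer_rcof[of B "\<chi> i. coord i" i] B by simp
    finally show ?thesis
      by (simp only: power_one_right)
        (intro ideal_mult[OF is_ideal_ideal_gen] ideal_sum[OF is_ideal_ideal_gen]
          ideal_mult_right[OF is_ideal_ideal_gen] ideal_gen_base rangeI)
  qed
  then show p: "primary \<phi>" by (rule primaryI)
  have "residue (det B * (w * det (jac \<phi>))) (B *v (\<chi> i. coord i)) = residue (w * det (jac \<phi>)) (\<chi> i. coord i)"
    using p B by (intro residue_transform) simp
  moreover have "det B * (w * det (jac \<phi>)) = det (jac \<phi>)" using w by (simp add: mult.assoc[symmetric])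
  moreover have "mat 1 *v (\<chi> i. coord i) = (\<chi> i :: 'n. coord i ^ Suc 0)" by (simp add: matrix_vector_mul_lid)
  from residue_eq[OF this, of "w * det (jac \<phi>)"]
  have "residue (w * det (jac \<phi>)) (\<chi> i. coord i) = coeff (w * det (jac \<phi>)) (\<chi> i. 0)"
    by simp
  moreover have "coeff (w * det (jac \<phi>)) 0 = coeff (det B * w) 0"
    by (simp add: hom_mult[OF h] eq)
  moreover have "(\<chi> i. 0) = (0 :: nat ^ 'n)" by (simp add: vec_eq_iff)
  ultimately show "residue (det (jac \<phi>)) \<phi> = 1"
    using w B by (simp add: coeff_1)
qed

lemma residue_coordinate_powers:
  assumes "\<And>i. \<beta> $ i \<le> N"
  shows "residue (subst \<phi> (mon \<beta>) * det (jac \<phi>)) (\<chi> i. \<phi> $ i ^ Suc N)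
    = (if \<beta> = (\<chi> i. N) then 1 else 0)"
proof -
  note h = subst_hom[OF \<phi>0]
  have prim: "primary (\<chi> i. \<phi> $ i ^ Suc N)" by (rule primary_powers[OF coordinates_primary])
  have mon: "subst \<phi> (mon \<beta>) = (\<Prod>i\<in>UNIV. \<phi> $ i ^ (\<beta> $ i))"
    by (simp add: mon_eq_prod hom_prod[OF h] hom_power[OF h] subst_coord[OF \<phi>0])
  have "(\<chi> i. \<phi> $ i ^ Suc N) = (\<chi> i. \<phi> $ i ^ (\<beta> $ i) * (\<chi> i. \<phi> $ i ^ (Suc N - \<beta> $ i)) $ i)"
    using assms by (simp add: vec_eq_iff le_SucI del: power_Suc flip: power_add)
  then have "residue (subst \<phi> (mon \<beta>) * det (jac \<phi>)) (\<chi> i. \<phi> $ i ^ Suc N)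
      = residue (det (jac \<phi>)) (\<chi> i. \<phi> $ i ^ (Suc N - \<beta> $ i))"
    using residue_scale[of "\<lambda>i. \<phi> $ i ^ (\<beta> $ i)" "\<chi> i. \<phi> $ i ^ (Suc N - \<beta> $ i)" "det (jac \<phi>)"] prim mon
    by simp
  also have "\<dots> = (if \<beta> = (\<chi> i. N) then 1 else 0)"
  proof (cases "\<beta> = (\<chi> i. N)")
    case True
    then have "(\<chi> i. \<phi> $ i ^ (Suc N - \<beta> $ i)) = \<phi>" by (simp add: vec_eq_iff)
    then show ?thesis using True residue_jacobian by simp
  next
    case False
    then obtain k where k: "\<beta> $ k \<noteq> N" by (auto simp: vec_eq_iff)
    then have "\<beta> $ k < N" using assms[of k] by simp
    \<comment> \<open>At k this is one less than the actual exponent: the vanishing statement raises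
      it by one again, and \<beta>_k < N keeps it positive.\<close>
    define b where "b i = (if i = k then N - \<beta> $ k else Suc N - \<beta> $ i)" for i
    have "(\<chi> i. \<phi> $ i ^ (Suc N - \<beta> $ i)) = (\<chi> i. \<phi> $ i ^ (b(k := Suc (b k))) i)"
      using \<open>\<beta> $ k < N\<close> by (auto simp: vec_eq_iff b_def Suc_diff_le)
    moreover have "b k \<ge> 1" using \<open>\<beta> $ k < N\<close> by (simp add: b_def)
    ultimately show ?thesis
      using False residue_jacobian_powers[OF coordinates_primary, of b k] by simp
  qed
  finally show ?thesis .
qed

text \<open>The change of variables for coordinate powers, to which all primary systems reduce.
  Terms outside the box substitute into the ideal of the \<phi>_i^(N+1), so finitely many monomials
  remain.\<close>

lemma residue_subst_powers:
  "residue (subst \<phi> v * det (jac \<phi>)) (\<chi> i. \<phi> $ i ^ Suc N) = coeff v (\<chi> i. N)"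
proof -
  note h = subst_hom[OF \<phi>0]
  have prim: "primary (\<chi> i. \<phi> $ i ^ Suc N)" by (rule primary_powers[OF coordinates_primary])
  define Box where "Box = {\<beta> :: nat ^ 'n. \<forall>i. \<beta> $ i \<le> N}"
  have Box: "finite Box" unfolding Box_def by (rule finite_box)
  obtain w where v: "v = (\<Sum>\<beta>\<in>Box. cst (coeff v \<beta>) * mon \<beta>) + (\<Sum>i\<in>UNIV. coord i ^ Suc N * w i)"
    unfolding Box_def using box_decomposition by blast
  define r where "r = (\<Sum>i\<in>UNIV. coord i ^ Suc N * w i)"
  have "subst \<phi> r = (\<Sum>i\<in>UNIV. \<phi> $ i ^ Suc N * subst \<phi> (w i))"
    unfolding r_def hom_sum[OF h] hom_mult[OF h] hom_power[OF h] subst_coord[OF \<phi>0] ..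
  then have "subst \<phi> r * det (jac \<phi>) \<in> ideal_gen (range (($) (\<chi> i. \<phi> $ i ^ Suc N)))"
    by (simp only:) (intro ideal_mult_right[OF is_ideal_ideal_gen] ideal_sum[OF is_ideal_ideal_gen]
        ideal_gen_base, auto)
  then have 0: "residue (subst \<phi> r * det (jac \<phi>)) (\<chi> i. \<phi> $ i ^ Suc N) = 0"
    by (rule residue_ideal[OF prim])
  have "residue (subst \<phi> v * det (jac \<phi>)) (\<chi> i. \<phi> $ i ^ Suc N)
      = (\<Sum>\<beta>\<in>Box. coeff v \<beta> * residue (subst \<phi> (mon \<beta>) * det (jac \<phi>)) (\<chi> i. \<phi> $ i ^ Suc N))"
    unfolding arg_cong[OF v[folded r_def], of "subst \<phi>"] hom_add[OF h] hom_sum[OF h] hom_mult[OF h] subst_cst[OF \<phi>0]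
    by (simp only: distrib_right residue_add[OF prim] 0 sum_distrib_right residue_sum[OF prim]
        mult.assoc residue_cst[OF prim] add_0_right)
  also have "\<dots> = (\<Sum>\<beta>\<in>Box. if \<beta> = (\<chi> i. N) then coeff v \<beta> else 0)"
    using residue_coordinate_powers[of _ N] by (intro sum.cong refl) (auto simp: Box_def simp del: power_Suc)
  also have "\<dots> = coeff v (\<chi> i. N)" using Box by (simp add: Box_def)
  finally show ?thesis .
qed

lemma change_of_variables:
  assumes "primary g"
  shows "primary (\<chi> i. subst \<phi> (g $ i))"
    and "residue (subst \<phi> u * det (jac \<phi>)) (\<chi> i. subst \<phi> (g $ i)) = residue u g"
proof -
  note h = subst_hom[OF \<phi>0]
  obtain N C where C: "C *v g = (\<chi> i. coord i ^ Suc N)" using assms primary_def by blast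
  define SC where "SC = (\<chi> i j. subst \<phi> (C $ i $ j))"
  have SC: "SC *v (\<chi> i. subst \<phi> (g $ i)) = (\<chi> i. \<phi> $ i ^ Suc N)"
    unfolding vec_eq_iff SC_def hom_matrix_vector[OF h, symmetric] C
    by (simp add: hom_power[OF h] subst_coord[OF \<phi>0] del: power_Suc)
  have prim: "primary (\<chi> i. \<phi> $ i ^ Suc N)" by (rule primary_powers[OF coordinates_primary])
  show "primary (\<chi> i. subst \<phi> (g $ i))"
    by (rule primary_matrix[of SC]) (use SC prim in simp)
  have "residue (subst \<phi> u * det (jac \<phi>)) (\<chi> i. subst \<phi> (g $ i))
      = residue (det SC * (subst \<phi> u * det (jac \<phi>))) (\<chi> i. \<phi> $ i ^ Suc N)"
    using residue_transform[of SC "\<chi> i. subst \<phi> (g $ i)"] SC prim by simp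
  also have "det SC * (subst \<phi> u * det (jac \<phi>)) = subst \<phi> (det C * u) * det (jac \<phi>)"
    by (simp add: SC_def hom_det[OF h] hom_mult[OF h] mult.assoc)
  also have "residue \<dots> (\<chi> i. \<phi> $ i ^ Suc N) = residue u g"
    unfolding residue_subst_powers residue_eq[OF C] ..
  finally show "residue (subst \<phi> u * det (jac \<phi>)) (\<chi> i. subst \<phi> (g $ i)) = residue u g" .
qed

end

section \<open>The specialisation coefficient\<close>

text \<open>An inequality form of the order: unlike \<open>nu\<close>, whose value at 0 is a dummy,
  it covers 0 and is stable under sums even when terms cancel.\<close>

definition ordge :: "'n::finite set \<Rightarrow> nat \<Rightarrow> 'n cps \<Rightarrow> bool" where
  "ordge K d u \<longleftrightarrow> (\<forall>\<alpha>. coeff u \<alpha> \<noteq> 0 \<longrightarrow> d \<le> zdeg K \<alpha>)"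

lemma zdeg_add: "zdeg K (\<alpha> + \<beta>) = zdeg K \<alpha> + zdeg K \<beta>"
  by (simp add: zdeg_def sum.distrib)

lemma zdeg_axis: "zdeg K (axis i M) = (if i \<in> K then M else 0)"
  by (simp add: zdeg_def axis_def)

lemma ordge_nu: "ordge K (nu K u) u"
  using coeff_below_nu unfolding ordge_def by (metis not_le)

lemma ordge_mono: "ordge K d u \<Longrightarrow> e \<le> d \<Longrightarrow> ordge K e u"
  by (auto simp: ordge_def)

lemma ordge_trivial [simp]: "ordge K d 0" "ordge K 0 u"
  by (simp_all add: ordge_def)

lemma ordge_add: "ordge K d u \<Longrightarrow> ordge K d v \<Longrightarrow> ordge K d (u + v)"
  unfolding ordge_def by (metis add_0 coeff_add)

lemma ordge_diff: "ordge K d u \<Longrightarrow> ordge K d v \<Longrightarrow> ordge K d (u - v)"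
  unfolding ordge_def by (metis diff_zero coeff_diff)

lemma ordge_sum: "(\<And>i. i \<in> S \<Longrightarrow> ordge K d (f i)) \<Longrightarrow> ordge K d (sum f S)"
  by (induction S rule: infinite_finite_induct) (auto intro: ordge_add)

lemma ordge_mult: "ordge K d u \<Longrightarrow> ordge K e v \<Longrightarrow> ordge K (d + e) (u * v)"
  unfolding ordge_def by (metis add_mono coeff_mult_neq_0 zdeg_add)

lemma ordge_mult_left: "ordge K d v \<Longrightarrow> ordge K d (u * v)"
  using ordge_mult[of K 0 u d v] by simp

lemma ordge_power: "ordge K d u \<Longrightarrow> ordge K (d * n) (u ^ n)"
  by (induction n) (auto intro: ordge_mult)

lemma ordge_coord_power: "i \<in> K \<Longrightarrow> ordge K M (coord i ^ M)"
  by (simp add: ordge_def coord_power mon.rep_eq zdeg_axis)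

text \<open>Pigeonhole: if all exponents in \<open>K\<close> are below M, the degree in z is at most
  \<open>card K * M\<close>. The \<open>+ 1\<close> makes the contradiction strict, also for empty
  \<open>K\<close>.\<close>

lemma ordge_split:
  assumes "ordge K (card K * M + 1) u"
  shows "\<exists>v. u = (\<Sum>i\<in>K. coord i ^ M * v i) \<and>
    (\<forall>i \<alpha>. coeff (v i) \<alpha> \<noteq> 0 \<longrightarrow> coeff u (\<alpha> + axis i M) \<noteq> 0)"
proof (rule split_by_powers, rule ccontr)
  fix \<alpha> assume "coeff u \<alpha> \<noteq> 0" and "\<not> (\<exists>i\<in>K. M \<le> \<alpha> $ i)"
  then have "zdeg K \<alpha> \<le> of_nat (card K) * M"
    unfolding zdeg_def by (intro sum_bounded_above) auto
  moreover have "card K * M + 1 \<le> zdeg K \<alpha>"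
    using assms \<open>coeff u \<alpha> \<noteq> 0\<close> unfolding ordge_def by blast
  ultimately show False by simp
qed

lemma coeff_zpart: "coeff (zpart K d u) \<alpha> = (if zdeg K \<alpha> = d then coeff u \<alpha> else 0)"
  by (simp add: zpart.rep_eq)

lemma zpart_sum: "zpart K d (sum f S) = (\<Sum>i\<in>S. zpart K d (f i))"
  by (rule cps_eqI) (simp add: coeff_zpart coeff_sum)

lemma zpart_mult_homogeneous:
  "zpart K d (c * zpart K e u) = (if e \<le> d then zpart K (d - e) c * zpart K e u else 0)"
proof (rule cps_eqI)
  fix \<alpha>
  have "(if zdeg K (\<beta> + \<gamma>) = d then coeff c \<beta> * coeff (zpart K e u) \<gamma> else 0)
      = (if e \<le> d then coeff (zpart K (d - e) c) \<beta> * coeff (zpart K e u) \<gamma> else 0)" for \<beta> \<gamma>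
    by (auto simp: coeff_zpart zdeg_add)
  then have "(\<Sum>(\<beta>, \<gamma>) | \<beta> + \<gamma> = \<alpha>. if zdeg K \<alpha> = d then coeff c \<beta> * coeff (zpart K e u) \<gamma> else 0)
      = (\<Sum>(\<beta>, \<gamma>) | \<beta> + \<gamma> = \<alpha>. if e \<le> d then coeff (zpart K (d - e) c) \<beta> * coeff (zpart K e u) \<gamma> else 0)"
    by (intro sum.cong) auto
  then show "coeff (zpart K d (c * zpart K e u)) \<alpha>
      = coeff (if e \<le> d then zpart K (d - e) c * zpart K e u else 0) \<alpha>"
    unfolding coeff_zpart[of K d] coeff_mult[of c] by (cases "e \<le> d") (auto simp: coeff_mult)
qed

lemma coeff_rescale:
  "coeff (rescale K d t u) \<alpha> = (if d \<le> zdeg K \<alpha> then t ^ (zdeg K \<alpha> - d) * coeff u \<alpha> else 0)"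
  by (simp add: rescale.rep_eq)

lemma rescale_sum: "rescale K d t (sum f S) = (\<Sum>i\<in>S. rescale K d t (f i))"
  by (rule cps_eqI) (simp add: coeff_rescale coeff_sum sum_distrib_left)

text \<open>\<open>rescale\<close> drops the terms below the given degree; the order bounds ensure
  that there are none, as such terms of one factor could meet high terms of the other in the
  product.\<close>

lemma rescale_mult:
  assumes u: "ordge K d u" and v: "ordge K e v"
  shows "rescale K (d + e) t (u * v) = rescale K d t u * rescale K e t v"
proof (rule cps_eqI)
  fix \<alpha>
  have "(if d + e \<le> zdeg K (\<beta> + \<gamma>) then t ^ (zdeg K (\<beta> + \<gamma>) - (d + e)) * (coeff u \<beta> * coeff v \<gamma>) else 0)
      = coeff (rescale K d t u) \<beta> * coeff (rescale K e t v) \<gamma>" for \<beta> \<gamma>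
  proof (cases "coeff u \<beta> = 0 \<or> coeff v \<gamma> = 0")
    case False
    then have "d \<le> zdeg K \<beta>" "e \<le> zdeg K \<gamma>" using u v by (auto simp: ordge_def)
    moreover from this have "t ^ (zdeg K \<beta> - d) * t ^ (zdeg K \<gamma> - e) = t ^ (zdeg K \<beta> + zdeg K \<gamma> - (d + e))"
      by (simp flip: power_add)
    ultimately show ?thesis by (simp add: coeff_rescale zdeg_add)
  qed (auto simp: coeff_rescale)
  then have "(\<Sum>(\<beta>, \<gamma>) | \<beta> + \<gamma> = \<alpha>.
        if d + e \<le> zdeg K \<alpha> then t ^ (zdeg K \<alpha> - (d + e)) * (coeff u \<beta> * coeff v \<gamma>) else 0)
      = coeff (rescale K d t u * rescale K e t v) \<alpha>"
    unfolding coeff_mult[of "rescale K d t u"] by (intro sum.cong) auto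
  then show "coeff (rescale K (d + e) t (u * v)) \<alpha> = coeff (rescale K d t u * rescale K e t v) \<alpha>"
    unfolding coeff_rescale[of K "d + e"] coeff_mult[of u]
    by (auto simp: sum_distrib_left case_prod_unfold split: if_splits)
qed

lemma dilate_mult: "dilate K t (u * v) = dilate K t u * dilate K t v"
  using rescale_mult[of K 0 u 0 v] by simp

lemma dilate_hom: "is_ring_hom (dilate K t)"
  unfolding is_ring_hom_def
proof (intro conjI allI)
  show "dilate K t 1 = 1" by (rule cps_eqI) (auto simp: coeff_rescale coeff_1 zdeg_def)
  show "dilate K t (u + v) = dilate K t u + dilate K t v" for u v
    by (rule cps_eqI) (simp add: coeff_rescale distrib_left)
qed (rule dilate_mult)

lemma power_mult_rescale: "ordge K d u \<Longrightarrow> cst (t ^ d) * rescale K d t u = dilate K t u"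
  by (rule cps_eqI) (auto simp: coeff_rescale ordge_def power_add[symmetric])

lemma rescale_coord_power: "rescale K (if i \<in> K then M else 0) t (coord i ^ M) = coord i ^ M"
  by (rule cps_eqI) (auto simp: coeff_rescale coord_power mon.rep_eq zdeg_axis)

lemma rescale_at_0: "rescale K d 0 u = zpart K d u"
  by (rule cps_eqI) (auto simp: coeff_rescale coeff_zpart)

section \<open>Transition matrices with controlled order along the divisor\<close>

context
  fixes K :: "'n::finite set" and q :: "'n cps ^ 'n"
  assumes fin: "finite_length_quotient (ideal_gen (range (\<lambda>j. initial_form K (q $ j))))"
begin

abbreviation (input) initial_ideal where
  "initial_ideal \<equiv> ideal_gen (range (\<lambda>j. initial_form K (q $ j)))"

text \<open>With \<nu>_j the order of q_j, the component of degree d - \<nu>_j of a coefficient of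
  the initial form of q_j serves as coefficient of q_j itself, which removes the degree-d part of
  \<open>u\<close>. For \<nu>_j > d, where the difference is truncated to 0, the coefficient is
  0.\<close>

lemma approximation_step:
  assumes u: "ordge K d u" and P: "zpart K d u \<in> initial_ideal"
  shows "\<exists>c. (\<forall>j. ordge K (d - nu K (q $ j)) (c j)) \<and> ordge K (d + 1) (u - (\<Sum>j\<in>UNIV. c j * q $ j))"
proof -
  let ?n = "\<lambda>j. nu K (q $ j)"
  let ?P = "\<lambda>j. zpart K (?n j) (q $ j)"
  obtain b where b: "zpart K d u = (\<Sum>j\<in>UNIV. b j * ?P j)"
    using P unfolding ideal_gen_range_iff initial_form_def by blast
  define c where "c j = (if ?n j \<le> d then zpart K (d - ?n j) (b j) else 0)" for j
  have "zpart K d u = zpart K d (zpart K d u)" by (rule cps_eqI) (simp add: coeff_zpart)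
  also have "\<dots> = (\<Sum>j\<in>UNIV. c j * ?P j)"
    unfolding b zpart_sum zpart_mult_homogeneous c_def by (intro sum.cong) auto
  finally have eq: "u - (\<Sum>j\<in>UNIV. c j * q $ j)
      = (u - zpart K d u) - (\<Sum>j\<in>UNIV. c j * (q $ j - ?P j))"
    by (simp add: right_diff_distrib sum_subtractf)
  have c: "ordge K (d - ?n j) (c j)" for j
    by (auto simp: c_def ordge_def coeff_zpart)
  have tail: "ordge K (e + 1) (v - zpart K e v)" if "ordge K e v" for e v
    using that by (auto simp: ordge_def coeff_zpart Suc_le_eq le_less)
  have "ordge K (d + 1) (c j * (q $ j - ?P j))" for j
  proof (cases "?n j \<le> d")
    case True
    then show ?thesis
      using ordge_mult[OF c[of j] tail[OF ordge_nu[of K "q $ j"]]] by simp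
  qed (simp add: c_def)
  then have "ordge K (d + 1) (u - (\<Sum>j\<in>UNIV. c j * q $ j))"
    unfolding eq by (intro ordge_diff tail[OF u] ordge_sum)
  then show ?thesis using c by blast
qed

lemma ex_initial_power: "\<exists>N. \<forall>i. coord i ^ N \<in> initial_ideal"
proof -
  have "\<forall>i. \<exists>N. coord i ^ N \<in> initial_ideal"
    using finite_length_power[OF fin is_ideal_ideal_gen] by blast
  then obtain N where N: "\<And>i. coord i ^ N i \<in> initial_ideal" by metis
  have "coord i ^ Max (range N) \<in> initial_ideal" for i
  proof -
    have "coord i ^ Max (range N) = coord i ^ (Max (range N) - N i) * coord i ^ N i"
      by (simp flip: power_add)
    then show ?thesis using ideal_mult[OF is_ideal_ideal_gen N] by simp
  qed
  then show ?thesis by blast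
qed

text \<open>Beyond degree \<open>card K * N\<close> every homogeneous part lies in the ideal of the
  z_i^N, hence in the initial ideal, so the step can be repeated. Later corrections have at least
  the required order and preserve the bound on \<open>c j\<close>.\<close>

lemma approximation:
  assumes N: "\<And>i. i \<in> K \<Longrightarrow> coord i ^ N \<in> initial_ideal"
    and d: "d \<ge> card K * N + 1" and u: "ordge K d u"
  shows "\<exists>c. (\<forall>j. ordge K (d - nu K (q $ j)) (c j)) \<and> ordge K (d + k) (u - (\<Sum>j\<in>UNIV. c j * q $ j))"
proof (induction k)
  case 0
  show ?case using u by (intro exI[of _ "\<lambda>_. 0"]) simp
next
  case (Suc k)
  then obtain c where c: "\<And>j. ordge K (d - nu K (q $ j)) (c j)"
    and r: "ordge K (d + k) (u - (\<Sum>j\<in>UNIV. c j * q $ j))" (is "ordge K _ ?r") by blast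
  have "ordge K (card K * N + 1) (zpart K (d + k) ?r)"
    using d by (auto simp: ordge_def coeff_zpart)
  from ordge_split[OF this] obtain v where "zpart K (d + k) ?r = (\<Sum>i\<in>K. coord i ^ N * v i)" by blast
  then have "zpart K (d + k) ?r \<in> initial_ideal"
    by (simp only:) (intro ideal_sum[OF is_ideal_ideal_gen] ideal_mult_right[OF is_ideal_ideal_gen] N)
  from approximation_step[OF r this] obtain b where
    b: "\<And>j. ordge K (d + k - nu K (q $ j)) (b j)" "ordge K (d + k + 1) (?r - (\<Sum>j\<in>UNIV. b j * q $ j))"
    by blast
  have "ordge K (d - nu K (q $ j)) (c j + b j)" for j
    by (intro ordge_add c ordge_mono[OF b(1)]) simp
  moreover have eq: "u - (\<Sum>j\<in>UNIV. (c j + b j) * q $ j) = ?r - (\<Sum>j\<in>UNIV. b j * q $ j)"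
    by (simp add: distrib_right sum.distrib)
  have "ordge K (d + Suc k) (u - (\<Sum>j\<in>UNIV. (c j + b j) * q $ j))"
    unfolding eq using b(2) by simp
  ultimately show ?case by (intro exI[of _ "\<lambda>j. c j + b j"]) blast
qed

text \<open>Nakayama's lemma for the ideal generated by the powers \<open>z\<^sub>i\<^sup>M\<close>, keeping track of orders.\<close>

lemma z_powers:
  assumes N: "\<And>i. i \<in> K \<Longrightarrow> coord i ^ N \<in> initial_ideal"
    and M: "M \<ge> card K * N + 1" and i: "i \<in> K"
  shows "\<exists>c. coord i ^ M = (\<Sum>j\<in>UNIV. c j * q $ j) \<and> (\<forall>j. ordge K (M - nu K (q $ j)) (c j))"
proof -
  have "\<exists>c v. coord i ^ M - (\<Sum>j\<in>UNIV. c j * q $ j) = (\<Sum>l\<in>K. v l * coord l ^ M) \<and>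
      (\<forall>j. ordge K (M - nu K (q $ j)) (c j)) \<and> (\<forall>l\<in>K. coeff (v l) 0 = 0)" if "i \<in> K" for i
  proof -
    \<comment> \<open>The remainder is pushed \<open>card K * M + 1\<close> orders beyond M: it then
      splits into multiples of the z_l^M whose quotients still have positive order, hence no
      constant term.\<close>
    from approximation[OF N M ordge_coord_power[OF that], of "card K * M + 1"]
    obtain c where c: "\<And>j. ordge K (M - nu K (q $ j)) (c j)"
      and r: "ordge K (M + (card K * M + 1)) (coord i ^ M - (\<Sum>j\<in>UNIV. c j * q $ j))" (is "ordge K _ ?r")
      by blast
    have "card K * M + 1 \<le> M + (card K * M + 1)" by simp
    from ordge_split[OF ordge_mono[OF r this]] obtain v where
      v: "?r = (\<Sum>l\<in>K. coord l ^ M * v l)" "\<And>l \<alpha>. coeff (v l) \<alpha> \<noteq> 0 \<Longrightarrow> coeff ?r (\<alpha> + axis l M) \<noteq> 0"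
      by blast
    have "coeff (v l) 0 = 0" if "l \<in> K" for l
    proof (rule ccontr)
      assume "coeff (v l) 0 \<noteq> 0"
      from v(2)[OF this] r have "M + (card K * M + 1) \<le> zdeg K (0 + axis l M)"
        unfolding ordge_def by blast
      then show False by (simp add: zdeg_axis that)
    qed
    then show ?thesis using c v(1) by (auto simp: mult.commute)
  qed
  then have "\<forall>i\<in>K. \<exists>c v. coord i ^ M - (\<Sum>j\<in>UNIV. c j * q $ j) = (\<Sum>l\<in>K. v l * coord l ^ M) \<and>
      (\<forall>j. ordge K (M - nu K (q $ j)) (c j)) \<and> (\<forall>l\<in>K. coeff (v l) 0 = 0)" by blast
  from bchoice[OF this] obtain c where "\<forall>i\<in>K. \<exists>v. coord i ^ M - (\<Sum>j\<in>UNIV. c i j * q $ j)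
      = (\<Sum>l\<in>K. v l * coord l ^ M) \<and>
      (\<forall>j. ordge K (M - nu K (q $ j)) (c i j)) \<and> (\<forall>l\<in>K. coeff (v l) 0 = 0)" by blast
  from bchoice[OF this] obtain v where
    cv: "\<And>i. i \<in> K \<Longrightarrow> coord i ^ M - (\<Sum>j\<in>UNIV. c i j * q $ j) = (\<Sum>l\<in>K. v i l * coord l ^ M)"
    and c: "\<And>i j. i \<in> K \<Longrightarrow> ordge K (M - nu K (q $ j)) (c i j)"
    and v0: "\<And>i l. i \<in> K \<Longrightarrow> l \<in> K \<Longrightarrow> coeff (v i l) 0 = 0"
    by blast
  define E where "E i l = (if i \<in> K \<and> l \<in> K then v i l else 0)" for i l
  \<comment> \<open>This is 1 - E, and \<open>E\<close> vanishes at 0, so \<open>det D\<close> is a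
    unit. Solving by the adjugate only combines rows of \<open>B\<close>, and all rows carry the
    same order bound in column j, so the bounds survive.\<close>
  define D where "D = (\<chi> i l. (if i = l then 1 else 0) - E i l)"
  define Z where "Z = (\<chi> i. if i \<in> K then coord i ^ M else 0)"
  define B where "B i j = (if i \<in> K then c i j else 0)" for i j
  have DZ: "(D *v Z) $ i = (\<Sum>j\<in>UNIV. B i j * q $ j)" for i
  proof -
    have "(D *v Z) $ i = Z $ i - (\<Sum>l\<in>UNIV. E i l * Z $ l)"
      by (simp add: D_def matrix_vector_mult_def left_diff_distrib sum_subtractf
          if_distrib[of "\<lambda>x. x * _"] cong: if_cong)
    also have "(\<Sum>l\<in>UNIV. E i l * Z $ l) = (\<Sum>l\<in>K. E i l * coord l ^ M)"
      by (rule sum.mono_neutral_cong_right) (auto simp: Z_def E_def)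
    also have "Z $ i - \<dots> = (\<Sum>j\<in>UNIV. B i j * q $ j)"
    proof (cases "i \<in> K")
      case True
      then have "(\<Sum>l\<in>K. E i l * coord l ^ M) = coord i ^ M - (\<Sum>j\<in>UNIV. c i j * q $ j)"
        unfolding cv[OF True] by (intro sum.cong) (auto simp: E_def)
      then show ?thesis using True by (simp add: Z_def B_def)
    qed (simp add: Z_def B_def E_def)
    finally show ?thesis .
  qed
  have "coeff (det D) 0 = det (mat 1 :: complex^'n^'n)"
    unfolding hom_det[OF hom_const_term]
    by (rule arg_cong[where f = det]) (auto simp: vec_eq_iff D_def E_def mat_def v0 coeff_1)
  then obtain w where w: "det D * w = 1" using cps_unit[of "det D"] by auto
  have "coord i ^ M = w * (det D * Z $ i)"
    using w i by (simp add: Z_def mult.assoc[symmetric] mult.commute[of w])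
  also have "\<dots> = (\<Sum>j\<in>UNIV. (w * (\<Sum>l\<in>UNIV. rcof (transpose D) i l * B l j)) * q $ j)"
    unfolding cramer_rcof DZ sum_distrib_left sum_distrib_right
    by (subst sum.swap) (simp only: mult_ac)
  finally have "coord i ^ M = (\<Sum>j\<in>UNIV. (w * (\<Sum>l\<in>UNIV. rcof (transpose D) i l * B l j)) * q $ j)" .
  moreover have "ordge K (M - nu K (q $ j)) (w * (\<Sum>l\<in>UNIV. rcof (transpose D) i l * B l j))" for j
    by (intro ordge_mult_left ordge_sum) (auto simp: B_def c)
  ultimately show ?thesis
    by (intro exI[of _ "\<lambda>j. w * (\<Sum>l\<in>UNIV. rcof (transpose D) i l * B l j)"]) simp
qed

text \<open>Only the rows of the z-coordinates need an order bound, since only they will be divided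
  by t^(N+1). For a w-coordinate, x_i^N0 lies in the initial ideal and has degree 0 in z, so modulo
  the ideal of \<open>q\<close> it is congruent to a series of order at least 1; a high power of
  that series is a combination of the z_l^M.\<close>

lemma ordered_transition:
  "\<exists>N C. C *v q = (\<chi> i. coord i ^ Suc N) \<and> (\<forall>j. nu K (q $ j) \<le> Suc N) \<and>
    (\<forall>i\<in>K. \<forall>j. ordge K (Suc N - nu K (q $ j)) (C $ i $ j))"
proof -
  let ?I = "ideal_gen (range (($) q))"
  obtain N0 where N0: "\<And>i. coord i ^ N0 \<in> initial_ideal" using ex_initial_power by blast
  define M where "M = card K * N0 + 1"
  have z: "\<exists>c. coord i ^ M' = (\<Sum>j\<in>UNIV. c j * q $ j) \<and> (\<forall>j. ordge K (M' - nu K (q $ j)) (c j))"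
    if "M' \<ge> M" "i \<in> K" for i M'
    by (rule z_powers[OF N0 _ that(2)]) (use that(1) in \<open>simp add: M_def\<close>)
  have zI: "coord i ^ M \<in> ?I" if "i \<in> K" for i
    using z[OF order_refl that] unfolding ideal_gen_range_iff by blast
  have "\<exists>L. coord i ^ L \<in> ?I" for i
  proof (cases "i \<in> K")
    case False
    have "zpart K 0 (coord i ^ N0) = coord i ^ N0"
      by (rule cps_eqI) (use False in \<open>auto simp: coeff_zpart coord_power mon.rep_eq zdeg_axis\<close>)
    then have "\<exists>c. ordge K (0 + 1) (coord i ^ N0 - (\<Sum>j\<in>UNIV. c j * q $ j))"
      using approximation_step[of 0 "coord i ^ N0"] N0[of i] by auto
    then obtain c where "ordge K 1 (coord i ^ N0 - (\<Sum>j\<in>UNIV. c j * q $ j))" (is "ordge K 1 ?r") by auto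
    from ordge_power[OF this, of "card K * M + 1"] ordge_split[of K M "?r ^ (card K * M + 1)"]
    obtain v where v: "?r ^ (card K * M + 1) = (\<Sum>l\<in>K. coord l ^ M * v l)" by auto
    have r: "?r ^ (card K * M + 1) \<in> ?I"
      unfolding v by (intro ideal_sum[OF is_ideal_ideal_gen] ideal_mult_right[OF is_ideal_ideal_gen] zI)
    have "coord i ^ N0 - ?r \<in> ?I" by (auto simp: ideal_gen_range_iff)
    from ideal_add[OF is_ideal_ideal_gen power_cong_ideal[OF is_ideal_ideal_gen this, of "card K * M + 1"] r]
    have "coord i ^ (N0 * (card K * M + 1)) \<in> ?I" by (simp only: power_mult diff_add_cancel)
    then show ?thesis by blast
  qed (use zI in blast)
  then have "primary q" using primaryI by metis
  from primary_large[OF this] obtain N1 where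
    N1: "\<And>N. N \<ge> N1 \<Longrightarrow> \<exists>C. C *v q = (\<chi> i. coord i ^ Suc N)" by blast
  define N where "N = Max ({N1, M} \<union> range (\<lambda>j. nu K (q $ j)))"
  have N: "N1 \<le> N" "M \<le> N" "\<And>j. nu K (q $ j) \<le> N" unfolding N_def by (rule Max_ge; simp)+
  obtain C where C: "C *v q = (\<chi> i. coord i ^ Suc N)" using N1[OF N(1)] by blast
  have "\<forall>i\<in>K. \<exists>c. coord i ^ Suc N = (\<Sum>j\<in>UNIV. c j * q $ j) \<and> (\<forall>j. ordge K (Suc N - nu K (q $ j)) (c j))"
    using z[of "Suc N"] N(2) by simp
  from bchoice[OF this] obtain c where
    c: "\<And>i. i \<in> K \<Longrightarrow> coord i ^ Suc N = (\<Sum>j\<in>UNIV. c i j * q $ j)"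
    "\<And>i j. i \<in> K \<Longrightarrow> ordge K (Suc N - nu K (q $ j)) (c i j)" by blast
  define C' where "C' = (\<chi> i j. if i \<in> K then c i j else C $ i $ j)"
  have "(\<Sum>j\<in>UNIV. C $ i $ j * q $ j) = coord i ^ Suc N" for i
    using arg_cong[OF C, of "\<lambda>v. v $ i"] by (simp add: matrix_vector_mult_def)
  then have "(\<Sum>j\<in>UNIV. (if i \<in> K then c i j else C $ i $ j) * q $ j) = coord i ^ Suc N" for i
    using c(1)[of i] by (cases "i \<in> K") simp_all
  then have "C' *v q = (\<chi> i. coord i ^ Suc N)"
    by (simp add: vec_eq_iff matrix_vector_mult_def C'_def del: power_Suc)
  moreover have "\<forall>i\<in>K. \<forall>j. ordge K (Suc N - nu K (q $ j)) (C' $ i $ j)"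
    using c(2) by (simp add: C'_def)
  ultimately show ?thesis using N(3) by (intro exI[of _ N] exI[of _ C']) (simp add: le_SucI)
qed

end

text \<open>Coefficientwise continuity is enough: each coefficient of a product or determinant is a
  polynomial in finitely many coefficients, and for a fixed exponent N the residue reads just one of
  them.\<close>

definition coeff_continuous :: "(complex \<Rightarrow> 'n::finite cps) \<Rightarrow> bool" where
  "coeff_continuous U \<longleftrightarrow> (\<forall>\<alpha>. continuous_on UNIV (\<lambda>t. coeff (U t) \<alpha>))"

lemma coeff_continuous_mult:
  "coeff_continuous U \<Longrightarrow> coeff_continuous V \<Longrightarrow> coeff_continuous (\<lambda>t. U t * V t)"
  unfolding coeff_continuous_def coeff_mult case_prod_unfold by (intro allI continuous_intros) auto

lemma coeff_continuous_const: "coeff_continuous (\<lambda>t. u)"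
  by (simp add: coeff_continuous_def)

lemma coeff_continuous_sum:
  "(\<And>i. i \<in> S \<Longrightarrow> coeff_continuous (f i)) \<Longrightarrow> coeff_continuous (\<lambda>t. \<Sum>i\<in>S. f i t)"
  unfolding coeff_continuous_def coeff_sum by (intro allI continuous_intros) auto

lemma coeff_continuous_prod:
  "(\<And>i. i \<in> S \<Longrightarrow> coeff_continuous (f i)) \<Longrightarrow> coeff_continuous (\<lambda>t. \<Prod>i\<in>S. f i t)"
  by (induction S rule: infinite_finite_induct) (auto intro: coeff_continuous_const coeff_continuous_mult)

lemma coeff_continuous_det:
  assumes "\<And>i j. coeff_continuous (\<lambda>t. M t $ i $ j)"
  shows "coeff_continuous (\<lambda>t. det (M t))"
  unfolding det_def
  by (intro coeff_continuous_sum coeff_continuous_mult coeff_continuous_const coeff_continuous_prod assms)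

lemma coeff_continuous_rescale: "coeff_continuous (\<lambda>t. rescale K d t u)"
  unfolding coeff_continuous_def coeff_rescale
proof
  show "continuous_on UNIV (\<lambda>t. if d \<le> zdeg K \<alpha> then t ^ (zdeg K \<alpha> - d) * coeff u \<alpha> else 0)" for \<alpha>
    by (cases "d \<le> zdeg K \<alpha>") (auto intro!: continuous_intros)
qed

lemma coeff_continuous_cst: "coeff_continuous (\<lambda>t. cst (t ^ d))"
  unfolding coeff_continuous_def coeff_cst
proof
  show "continuous_on UNIV (\<lambda>t :: complex. if \<alpha> = 0 then t ^ d else 0)" for \<alpha> :: "nat ^ 'a"
    by (cases "\<alpha> = 0") (auto intro!: continuous_intros)
qed

lemma continuous_eq_at_0:
  fixes F G :: "complex \<Rightarrow> complex"
  assumes "continuous_on UNIV F" "continuous_on UNIV G" "\<And>t. t \<noteq> 0 \<Longrightarrow> F t = G t"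
  shows "F = G"
proof
  fix t
  have "F \<midarrow>0\<rightarrow> F 0" "G \<midarrow>0\<rightarrow> G 0"
    using assms(1,2) by (auto simp: continuous_on_eq_continuous_at isCont_def)
  moreover have "\<forall>\<^sub>F t in at 0. F t = G t"
    using assms(3) by (auto simp: eventually_at_filter)
  ultimately have "F \<midarrow>0\<rightarrow> G 0" using tendsto_cong by blast
  then have "F 0 = G 0" using \<open>F \<midarrow>0\<rightarrow> F 0\<close> LIM_unique by blast
  then show "F t = G t" using assms(3) by (cases "t = 0") auto
qed

text \<open>In the rows of \<open>K\<close> the order bound lets \<open>rescale\<close> absorb the
  division by t^(N+1). In the other rows the factor t^(\<nu>_j) suffices, because powers of
  w-coordinates are fixed by dilation. Thus \<open>D t\<close> makes sense at t = 0 as well.\<close>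

lemma family_transition:
  fixes K :: "'n::finite set"
  assumes fin: "finite_length_quotient (ideal_gen (range (\<lambda>j. initial_form K (q $ j))))"
    and card: "card K \<le> (\<Sum>j\<in>UNIV. nu K (q $ j))"
  obtains N D where "\<And>t. D t *v Q_family K q t = (\<chi> i. coord i ^ Suc N)"
    and "coeff_continuous (\<lambda>t. det (D t))"
    and "\<And>t w. t \<noteq> 0 \<Longrightarrow> coeff (det (D t) * dilate K t w) (\<chi> i. N) = t ^ excess K q * residue w q"
    and "primary q"
proof -
  let ?n = "\<lambda>j. nu K (q $ j)"
  obtain N C where C: "C *v q = (\<chi> i. coord i ^ Suc N)" and n: "\<And>j. ?n j \<le> Suc N"
    and ord: "\<And>i j. i \<in> K \<Longrightarrow> ordge K (Suc N - ?n j) (C $ i $ j)"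
    using ordered_transition[OF fin] by blast
  have Cq: "(\<Sum>j\<in>UNIV. C $ i $ j * q $ j) = coord i ^ Suc N" for i
    using arg_cong[OF C, of "\<lambda>v. v $ i"] by (simp add: matrix_vector_mult_def)
  define D where "D t = (\<chi> i j. if i \<in> K then rescale K (Suc N - ?n j) t (C $ i $ j)
      else cst (t ^ ?n j) * dilate K t (C $ i $ j))" for t
  have "(D t *v Q_family K q t) $ i = coord i ^ Suc N" for t i
  proof (cases "i \<in> K")
    case True
    have "(D t *v Q_family K q t) $ i
        = (\<Sum>j\<in>UNIV. rescale K (Suc N - ?n j + ?n j) t (C $ i $ j * q $ j))"
      unfolding rescale_mult[OF ord[OF True] ordge_nu]
      using True by (simp add: matrix_vector_mult_def D_def Q_family_def)
    also have "\<dots> = rescale K (if i \<in> K then Suc N else 0) t (coord i ^ Suc N)"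
      using n True by (simp only: le_add_diff_inverse2 rescale_sum[symmetric] Cq if_True)
    finally show ?thesis by (simp only: rescale_coord_power)
  next
    case False
    have "(D t *v Q_family K q t) $ i
        = (\<Sum>j\<in>UNIV. dilate K t (C $ i $ j) * (cst (t ^ ?n j) * rescale K (?n j) t (q $ j)))"
      using False by (simp add: matrix_vector_mult_def D_def Q_family_def mult_ac)
    also have "\<dots> = rescale K (if i \<in> K then Suc N else 0) t (coord i ^ Suc N)"
      using False by (simp only: power_mult_rescale[OF ordge_nu] dilate_mult[symmetric]
          rescale_sum[symmetric] Cq if_False)
    finally show ?thesis by (simp only: rescale_coord_power)
  qed
  then have DQ: "D t *v Q_family K q t = (\<chi> i. coord i ^ Suc N)" for t by (simp add: vec_eq_iff)
  have cont: "coeff_continuous (\<lambda>t. det (D t))"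
  proof (rule coeff_continuous_det)
    show "coeff_continuous (\<lambda>t. D t $ i $ j)" for i j
      by (cases "i \<in> K") (auto simp: D_def intro!: coeff_continuous_mult coeff_continuous_cst
          coeff_continuous_rescale)
  qed
  have val: "coeff (det (D t) * dilate K t w) (\<chi> i. N) = t ^ excess K q * residue w q"
    if t: "t \<noteq> 0" for t w
  proof -
    define r where "r i = (if i \<in> K then 1 / t ^ Suc N else 1)" for i
    define C1 where "C1 = (\<chi> i j. dilate K t (C $ i $ j))"
    have "D t $ i $ j = cst (r i) * (\<chi> i j. C1 $ i $ j * cst (t ^ ?n j)) $ i $ j" for i j
    proof (cases "i \<in> K")
      case True
      have "t ^ Suc N = t ^ ?n j * t ^ (Suc N - ?n j)"
        using n[of j] by (simp flip: power_add)
      then have "1 / t ^ Suc N * t ^ ?n j * t ^ (Suc N - ?n j) = 1" using t by simp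
      then have "rescale K (Suc N - ?n j) t (C $ i $ j)
          = cst (1 / t ^ Suc N * t ^ ?n j * t ^ (Suc N - ?n j)) * rescale K (Suc N - ?n j) t (C $ i $ j)"
        by (simp only: cst_1 mult_1_left)
      also have "\<dots> = cst (1 / t ^ Suc N) * cst (t ^ ?n j) * dilate K t (C $ i $ j)"
        by (simp only: cst_mult mult.assoc power_mult_rescale[OF ord[OF True]])
      finally show ?thesis using True by (simp add: D_def r_def C1_def mult_ac)
    next
      case False
      then show ?thesis by (simp add: D_def r_def C1_def cst_1 mult.commute)
    qed
    then have "D t = (\<chi> i j. cst (r i) * (\<chi> i j. C1 $ i $ j * cst (t ^ ?n j)) $ i $ j)"
      by (simp add: vec_eq_iff)
    then have "det (D t) = cst (\<Prod>i\<in>UNIV. r i) * (det C1 * cst (\<Prod>j\<in>UNIV. t ^ ?n j))"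
      by (simp only: det_scale_rows det_scale_cols cst_prod)
    moreover have "det C1 = dilate K t (det C)"
      unfolding C1_def by (rule hom_det[OF dilate_hom, symmetric])
    ultimately have "det (D t) * dilate K t w
        = cst ((\<Prod>i\<in>UNIV. r i) * (\<Prod>j\<in>UNIV. t ^ ?n j)) * dilate K t (det C * w)"
      by (simp only: cst_mult dilate_mult mult_ac)
    moreover have "(\<Prod>i\<in>UNIV. r i) = (\<Prod>i\<in>K. 1 / t ^ Suc N)"
      unfolding r_def by (simp add: prod.If_cases)
    then have "(\<Prod>i\<in>UNIV. r i) = 1 / t ^ (Suc N * card K)"
      by (simp only: prod_constant power_one_over power_mult)
    moreover have "(\<Prod>j\<in>UNIV. t ^ ?n j) = t ^ (\<Sum>j\<in>UNIV. ?n j)" by (simp add: power_sum)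
    moreover have "zdeg K (\<chi> i. N) = card K * N" by (simp add: zdeg_def)
    ultimately have "coeff (det (D t) * dilate K t w) (\<chi> i. N)
        = (1 / t ^ (Suc N * card K) * t ^ (\<Sum>j\<in>UNIV. ?n j) * t ^ (card K * N)) * residue w q"
      by (simp add: coeff_rescale residue_eq[OF C])
    \<comment> \<open>The balance that defines the excess: the columns give the sum of the \<nu>_j,
      dilation gives \<open>card K * N\<close> at (N, ..., N), and the rows take away
      \<open>card K * Suc N\<close>. The inequality \<open>card\<close> makes the truncated
      subtraction exact.\<close>
    moreover have "t ^ (\<Sum>j\<in>UNIV. ?n j) * t ^ (card K * N) = t ^ (Suc N * card K) * t ^ excess K q"
      using card by (simp add: excess_def algebra_simps flip: power_add)
    then have "1 / t ^ (Suc N * card K) * t ^ (\<Sum>j\<in>UNIV. ?n j) * t ^ (card K * N) = t ^ excess K q"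
      using t by (simp add: mult.assoc del: mult_Suc)
    ultimately show ?thesis by (simp only:)
  qed
  have "primary q" unfolding primary_def using C by blast
  from that[OF DQ cont val this] show ?thesis .
qed

lemma higher_deriv_monomial: "(deriv ^^ m) (\<lambda>t :: complex. t ^ m * c) = (\<lambda>t. fact m * c)"
proof -
  have "k \<le> m \<Longrightarrow> (deriv ^^ k) (\<lambda>t :: complex. t ^ m * c) = (\<lambda>t. fact m / fact (m - k) * t ^ (m - k) * c)" for k
  proof (induction k)
    case (Suc k)
    have "((\<lambda>t. fact m / fact (m - k) * t ^ (m - k) * c) has_field_derivative
        fact m / fact (m - k) * (of_nat (m - k) * t ^ (m - k - 1)) * c) (at t)" for t :: complex
      by (auto intro!: derivative_eq_intros)
    moreover have "fact m / fact (m - k) * (of_nat (m - k) * t ^ (m - k - 1)) * c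
        = fact m / fact (m - Suc k) * t ^ (m - Suc k) * c" for t :: complex
    proof -
      have mk: "m - k = Suc (m - Suc k)" using Suc.prems by simp
      have "of_nat (Suc (m - Suc k)) \<noteq> (0 :: complex)" by (simp del: of_nat_Suc)
      then show ?thesis unfolding mk by (simp add: fact_Suc del: of_nat_Suc)
    qed
    ultimately have "deriv (\<lambda>t. fact m / fact (m - k) * t ^ (m - k) * c)
        = (\<lambda>t. fact m / fact (m - Suc k) * t ^ (m - Suc k) * c)"
      by (intro ext DERIV_imp_deriv) (simp only:)
    then show ?case using Suc by simp
  qed simp
  from this[of m] show ?thesis by simp
qed

text \<open>The reference system \<open>g\<close> is arbitrary, since this is applied to the
  fixed-point equations of \<open>f\<close>, to those of a conjugate map and to transported
  equations. The residue of the family is an exact monomial in t of degree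
  \<open>excess K q\<close>, so the derivative of that order over its factorial is the
  coefficient.\<close>

lemma SpTr_eq_residue:
  assumes adm: "normally_admissible K I q" and q: "q = A *v g"
  shows "SpTr K q A h = residue h g" and "primary g"
proof -
  let ?w = "h * det A"
  have fin: "finite_length_quotient (ideal_gen (range (\<lambda>j. initial_form K (q $ j))))"
    and card: "card K \<le> (\<Sum>j\<in>UNIV. nu K (q $ j))"
    using adm by (auto simp: normally_admissible_def)
  obtain N D where D: "\<And>t. D t *v Q_family K q t = (\<chi> i. coord i ^ Suc N)"
    and cont: "coeff_continuous (\<lambda>t. det (D t))"
    and val: "\<And>t w. t \<noteq> 0 \<Longrightarrow> coeff (det (D t) * dilate K t w) (\<chi> i. N) = t ^ excess K q * residue w q"
    and prim: "primary q"
    by (rule family_transition[OF fin card]) blast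
  show "primary g" by (rule primary_matrix[of A]) (use prim q in simp)
  have w: "residue ?w q = residue h g"
    using residue_transform[of A g h] prim q by (simp add: mult.commute)
  have "residue (dilate K t h * dilate K t (det A)) (Q_family K q t)
      = coeff (det (D t) * dilate K t ?w) (\<chi> i. N)" for t
    by (simp add: residue_eq[OF D] dilate_mult)
  moreover have "(\<lambda>t. coeff (det (D t) * dilate K t ?w) (\<chi> i. N)) = (\<lambda>t. t ^ excess K q * residue ?w q)"
  proof (rule continuous_eq_at_0)
    show "continuous_on UNIV (\<lambda>t. coeff (det (D t) * dilate K t ?w) (\<chi> i. N))"
      using coeff_continuous_mult[OF cont coeff_continuous_rescale] by (simp add: coeff_continuous_def)
  qed (use val in \<open>auto intro!: continuous_intros\<close>)
  ultimately show "SpTr K q A h = residue h g"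
    unfolding SpTr_def by (simp add: higher_deriv_monomial w)
qed

section \<open>The trace of the normal-cone class\<close>

lemma mdeg_with_t: "mdeg (with_t n \<alpha>) = n + mdeg \<alpha>"
  by (simp add: mdeg_def with_t_def UNIV_option_conv sum.reindex)

lemma mval_with_t: "mval (with_t t x) (with_t n \<alpha>) = t ^ n * mval x \<alpha>"
  by (simp add: mval_def with_t_def UNIV_option_conv prod.reindex)

lemma val_at_coord_power: "val_at (coord i ^ n) x = x $ i ^ n"
proof -
  have "mval x (axis i n) = (\<Prod>j\<in>UNIV. if j = i then x $ i ^ n else 1)"
    unfolding mval_def by (rule prod.cong) (auto simp: axis_def)
  then show ?thesis
    using val_at_finite[of "{axis i n}" "coord i ^ n" x] by (simp add: coord_power mon.rep_eq)
qed

lemma with_t_eq_iff: "with_t s \<alpha> = with_t t \<beta> \<longleftrightarrow> s = t \<and> \<alpha> = \<beta>"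
proof
  assume *: "with_t s \<alpha> = with_t t \<beta>"
  then have "with_t s \<alpha> $ i = with_t t \<beta> $ i" for i by simp
  from this[of None] this[of "Some _"] show "s = t \<and> \<alpha> = \<beta>" by (simp add: with_t_def vec_eq_iff)
qed simp

lemma with_t_surj: "with_t (y $ None) (\<chi> i. y $ Some i) = y"
  by (auto simp: with_t_def vec_eq_iff split: option.split)

text \<open>Encodes u(t z, w) as one series in (t, x), each coefficient moving to the t-exponent
  \<open>zdeg K \<alpha>\<close>; the identity theorem then applies in the joint variables.\<close>

lemma dilation_series:
  fixes K :: "'n::finite set" and u :: "'n cps"
  obtains G where "\<And>n \<alpha>. coeff G (with_t n \<alpha>) = (if n = zdeg K \<alpha> then coeff u \<alpha> else 0)"
    and "\<And>t x. val_at G (with_t t x) = val_at (dilate K t u) x"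
proof -
  define c where "c \<gamma> = (let \<alpha> = \<chi> i. \<gamma> $ Some i in if \<gamma> $ None = zdeg K \<alpha> then coeff u \<alpha> else 0)" for \<gamma>
  define e where "e \<alpha> = with_t (zdeg K \<alpha>) \<alpha>" for \<alpha> :: "nat ^ 'n"
  have c: "c (with_t n \<alpha>) = (if n = zdeg K \<alpha> then coeff u \<alpha> else 0)" for n \<alpha>
    by (simp add: c_def with_t_def vec_eq_iff Let_def)
  have inj: "inj e" by (auto simp: e_def with_t_eq_iff intro: injI)
  have outside: "c \<gamma> = 0" if "\<gamma> \<notin> range e" for \<gamma>
    using that with_t_surj[of \<gamma>] by (auto simp: c_def Let_def e_def image_iff split: if_splits) metis
  have transfer: "(\<Sum>\<^sub>\<infinity>\<gamma>. c \<gamma> * f \<gamma>) = (\<Sum>\<^sub>\<infinity>\<alpha>. c (e \<alpha>) * f (e \<alpha>))" for f :: "nat ^ 'n option \<Rightarrow> complex"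
  proof -
    have "(\<Sum>\<^sub>\<infinity>\<gamma>. c \<gamma> * f \<gamma>) = (\<Sum>\<^sub>\<infinity>\<gamma>\<in>range e. c \<gamma> * f \<gamma>)"
      by (rule infsum_cong_neutral) (auto simp: outside)
    then show ?thesis by (simp add: infsum_reindex[OF inj] o_def)
  qed
  obtain r where r: "r > 0" "summ r u" using ex_summ by blast
  \<comment> \<open>A radius of at most 1 compensates that attaching a power of t can raise the
    total degree.\<close>
  define s where "s = min r 1"
  have s: "0 < s" "s \<le> 1" "s \<le> r" using r by (auto simp: s_def)
  have "(\<lambda>\<alpha>. norm (c (e \<alpha>)) * s ^ mdeg (e \<alpha>)) summable_on UNIV"
  proof (rule summable_on_comparison_test)
    show "(\<lambda>\<alpha>. norm (coeff u \<alpha>) * s ^ mdeg \<alpha>) summable_on UNIV"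
      using summ_mono[OF r(2) s(1,3)] by (simp add: summ_def)
    show "norm (c (e \<alpha>)) * s ^ mdeg (e \<alpha>) \<le> norm (coeff u \<alpha>) * s ^ mdeg \<alpha>" for \<alpha>
      using s by (auto simp: e_def c mdeg_with_t intro!: mult_left_mono power_decreasing)
  qed (use s in auto)
  then have "(\<lambda>\<gamma>. norm (c \<gamma>) * s ^ mdeg \<gamma>) summable_on range e"
    by (simp add: summable_on_reindex[OF inj] o_def)
  then have "(\<lambda>\<gamma>. norm (c \<gamma>) * s ^ mdeg \<gamma>) summable_on UNIV"
    by (rule summable_on_cong_neutral[THEN iffD1, rotated -1]) (auto simp: outside)
  then have G: "coeff (Abs_cps c) = c"
    using s by (intro Abs_cps_inverse) auto
  have "val_at (Abs_cps c) (with_t t x) = val_at (dilate K t u) x" for t x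
    unfolding val_at_eq G transfer
    by (simp add: e_def c mval_with_t coeff_rescale mult_ac)
  then show ?thesis using that[of "Abs_cps c"] c G by simp
qed

text \<open>The identity theorem in (t, x) turns the pointwise equation into G = t^e H for series.
  So the part of \<open>H\<close> constant in t is the part of t-degree e of G, and G has no terms
  of lower t-degree; the t-degree in G is the z-degree in \<open>h * det A\<close>.\<close>

lemma divided_numerator_at_0:
  fixes K :: "'n::finite set"
  assumes H: "divided_numerator K q A h H"
  shows "at_t0 H = zpart K (excess K q) (h * det A)" and "ordge K (excess K q) (h * det A)"
proof -
  let ?e = "excess K q" and ?w = "h * det A"
  obtain G where G: "\<And>n \<alpha>. coeff G (with_t n \<alpha>) = (if n = zdeg K \<alpha> then coeff ?w \<alpha> else 0)"
    and val: "\<And>t x. val_at G (with_t t x) = val_at (dilate K t ?w) x"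
    by (rule dilation_series[of K ?w]) blast
  let ?F = "\<lambda>y :: complex ^ 'n option. (y $ None, (\<chi> i. y $ Some i) :: complex ^ 'n)"
  have "isCont ?F 0"
    unfolding isCont_def by (intro tendsto_Pair tendsto_vec_lambda tendsto_vec_nth tendsto_ident_at)
  then have "filterlim ?F (nhds (?F 0)) (nhds 0)"
    unfolding isCont_def by (rule tendsto_at_iff_tendsto_nhds[of ?F 0, THEN iffD1])
  moreover have "?F 0 = (0, 0)" by (simp add: vec_eq_iff)
  ultimately have "filterlim ?F (nhds (0, 0)) (nhds 0)" by (simp only:)
  from this[unfolded filterlim_iff, rule_format, OF H[unfolded divided_numerator_def]]
  have "\<forall>\<^sub>F y in nhds (0 :: complex ^ 'n option). val_at (dilate K (y $ None) h * dilate K (y $ None) (det A)) (\<chi> i. y $ Some i)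
      = y $ None ^ ?e * val_at H y"
    by (simp add: with_t_surj)
  then have "\<forall>\<^sub>F y in nhds 0. val_at G y = val_at (coord None ^ ?e * H) y"
    using eventually_val_at_mult[of "coord None ^ ?e" H]
  proof eventually_elim
    case (elim y)
    have "val_at G y = y $ None ^ ?e * val_at H y"
      using val[of "y $ None" "\<chi> i. y $ Some i"] elim(1) by (simp add: with_t_surj dilate_mult)
    then show ?case using elim(2) by (simp add: val_at_coord_power)
  qed
  then have eq: "G = coord None ^ ?e * H" by (rule identity_theorem)
  have shift: "with_t n \<alpha> + axis None ?e = with_t (n + ?e) \<alpha>" for n and \<alpha> :: "nat ^ 'n"
    by (auto simp: vec_eq_iff with_t_def axis_def split: option.split)
  have "coeff (at_t0 H) \<alpha> = coeff (zpart K ?e ?w) \<alpha>" for \<alpha>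
    using coeff_mon_mult_add[of "axis None ?e" H "with_t 0 \<alpha>"] G[of ?e \<alpha>]
    by (auto simp: at_t0.rep_eq shift eq coord_power coeff_zpart)
  then show "at_t0 H = zpart K ?e ?w" by (rule cps_eqI)
  show "ordge K ?e ?w"
    unfolding ordge_def
  proof (intro allI impI)
    fix \<alpha> assume "coeff ?w \<alpha> \<noteq> 0"
    then have "coeff (coord None ^ ?e * H) (with_t (zdeg K \<alpha>) \<alpha>) \<noteq> 0" using G eq by simp
    then show "?e \<le> zdeg K \<alpha>"
      by (simp add: coord_power coeff_mon_mult axis_le_iff with_t_def split: if_splits)
  qed
qed

text \<open>Dividing the numerator of the family by t^e makes the residue constant for t \<noteq> 0.
  It is continuous at 0, where the equations become the initial forms and the numerator becomes
  \<open>at_t0 H\<close>.\<close>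

lemma trace_Sp_log:
  assumes adm: "normally_admissible K I q" and q: "q = A *v g" and H: "divided_numerator K q A h H"
  shows "duality_trace (Sp_log K q H) = residue h g"
proof -
  let ?w = "h * det A" and ?e = "excess K q"
  have fin: "finite_length_quotient (ideal_gen (range (\<lambda>j. initial_form K (q $ j))))"
    and card: "card K \<le> (\<Sum>j\<in>UNIV. nu K (q $ j))"
    using adm by (auto simp: normally_admissible_def)
  obtain N D where D: "\<And>t. D t *v Q_family K q t = (\<chi> i. coord i ^ Suc N)"
    and cont: "coeff_continuous (\<lambda>t. det (D t))"
    and val: "\<And>t w. t \<noteq> 0 \<Longrightarrow> coeff (det (D t) * dilate K t w) (\<chi> i. N) = t ^ ?e * residue w q"
    and prim: "primary q"
    by (rule family_transition[OF fin card]) blast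
  have "(\<lambda>t. coeff (det (D t) * rescale K ?e t ?w) (\<chi> i. N)) = (\<lambda>t. residue ?w q)"
  proof (rule continuous_eq_at_0)
    show "continuous_on UNIV (\<lambda>t. coeff (det (D t) * rescale K ?e t ?w) (\<chi> i. N))"
      using coeff_continuous_mult[OF cont coeff_continuous_rescale] by (simp add: coeff_continuous_def)
    fix t :: complex assume t: "t \<noteq> 0"
    have "t ^ ?e * coeff (det (D t) * rescale K ?e t ?w) (\<chi> i. N)
        = coeff (det (D t) * (cst (t ^ ?e) * rescale K ?e t ?w)) (\<chi> i. N)"
      by (simp add: mult.left_commute[of "det (D t)" "cst (t ^ ?e)"])
    also have "\<dots> = t ^ ?e * residue ?w q"
      by (simp only: power_mult_rescale[OF divided_numerator_at_0(2)[OF H]] val[OF t])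
    finally show "coeff (det (D t) * rescale K ?e t ?w) (\<chi> i. N) = residue ?w q" using t by simp
  qed simp
  from fun_cong[OF this, of 0]
  have "coeff (det (D 0) * at_t0 H) (\<chi> i. N) = residue ?w q"
    by (simp only: rescale_at_0 divided_numerator_at_0(1)[OF H])
  moreover have "Q_family K q 0 = (\<chi> j. initial_form K (q $ j))"
    by (simp add: Q_family_def rescale_0)
  then have "D 0 *v (\<chi> j. initial_form K (q $ j)) = (\<chi> i. coord i ^ Suc N)" using D[of 0] by simp
  moreover have "residue ?w q = residue h g"
    using residue_transform[of A g h] prim q by (simp add: mult.commute)
  ultimately show ?thesis
    by (simp add: duality_trace_def Sp_log_def residue_symbol_def residue_eq)
qed

section \<open>Invariance under conjugation\<close>

text \<open>Both sides are ring homomorphisms modulo \<open>I\<^sup>2\<close> that agree on the coordinates, and \<open>I\<^sup>2\<close> contains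
  a power of the maximal ideal.\<close>

lemma taylor_mod_square:
  fixes f :: "'n::finite cps ^ 'n"
  assumes f0: "\<And>i. coeff (f $ i) 0 = 0" and prim: "primary (fixed_eqs f)"
  shows "\<exists>e. (\<forall>l. e l \<in> fixed_ideal f) \<and>
    u - subst f u = (\<Sum>l\<in>UNIV. (cps_partial l u - e l) * fixed_eqs f $ l)"
proof -
  let ?g = "fixed_eqs f" and ?I = "fixed_ideal f"
  have I: "is_ideal ?I" unfolding fixed_ideal_def by (rule is_ideal_ideal_gen)
  have gI: "?g $ l \<in> ?I" for l unfolding fixed_ideal_def by (rule ideal_gen_base) simp
  \<comment> \<open>The square of I, written as combinations of the equations with coefficients in
    I: the corrections \<open>e l\<close> are read off from this form.\<close>
  define J where "J = {\<Sum>l\<in>UNIV. e l * ?g $ l | e. \<forall>l. e l \<in> ?I}"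
  have J_I: "x \<in> J" if "x = (\<Sum>l\<in>UNIV. e l * ?g $ l)" "\<And>l. e l \<in> ?I" for x e
    using that unfolding J_def by blast
  have J: "is_ideal J"
    unfolding module.subspace_def[OF module_ring]
  proof (intro conjI ballI allI)
    show "0 \<in> J" by (rule J_I[of _ "\<lambda>_. 0"]) (simp_all add: ideal_0[OF I])
  next
    fix x y assume "x \<in> J" "y \<in> J"
    then obtain a b where a: "\<And>l. a l \<in> ?I" "x = (\<Sum>l\<in>UNIV. a l * ?g $ l)"
      and b: "\<And>l. b l \<in> ?I" "y = (\<Sum>l\<in>UNIV. b l * ?g $ l)" unfolding J_def by blast
    show "x + y \<in> J"
      by (rule J_I[of _ "\<lambda>l. a l + b l"])
        (simp_all add: a b distrib_right sum.distrib ideal_add[OF I])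
  next
    fix c x assume "x \<in> J"
    then obtain a where a: "\<And>l. a l \<in> ?I" "x = (\<Sum>l\<in>UNIV. a l * ?g $ l)" unfolding J_def by blast
    show "c * x \<in> J"
      by (rule J_I[of _ "\<lambda>l. c * a l"])
        (simp_all add: a sum_distrib_left mult.assoc ideal_mult[OF I])
  qed
  have IJ: "a * b \<in> J" if a: "a \<in> ?I" and b: "b \<in> ?I" for a b
  proof -
    obtain c where "b = (\<Sum>l\<in>UNIV. c l * ?g $ l)"
      using b unfolding fixed_ideal_def ideal_gen_range_iff by blast
    then show ?thesis
      by (intro J_I[of _ "\<lambda>l. a * c l"])
        (simp_all add: sum_distrib_left mult.assoc ideal_mult_right[OF I a])
  qed
  define d where "d v = (\<Sum>l\<in>UNIV. cps_partial l v * ?g $ l)" for v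
  have d_add: "d (v + w) = d v + d w" for v w by (simp add: d_def partial_add distrib_right sum.distrib)
  have d_mult: "d (v * w) = v * d w + d v * w" for v w
    by (simp add: d_def partial_mult algebra_simps sum.distrib sum_distrib_left)
  have d_1: "d 1 = 0" by (simp add: d_def partial_1)
  have dI: "d v \<in> ?I" for v
    unfolding d_def by (intro ideal_sum[OF I]) (rule ideal_mult[OF I gI])
  define Y where "Y = {v. subst f v - (v - d v) \<in> J}"
  note S = subst_hom[OF f0]
  have Y_add: "v + w \<in> Y" if "v \<in> Y" "w \<in> Y" for v w
  proof -
    have eq: "subst f (v + w) - (v + w - d (v + w)) = (subst f v - (v - d v)) + (subst f w - (w - d w))"
      by (simp add: hom_add[OF S] d_add)
    show ?thesis
      unfolding Y_def mem_Collect_eq eq by (rule ideal_add[OF J]) (use that in \<open>simp_all add: Y_def\<close>)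
  qed
  \<comment> \<open>The map sending v to v - d v fails to be multiplicative only by d v d w, which
    lies in the square of I.\<close>
  have Y_mult: "v * w \<in> Y" if "v \<in> Y" "w \<in> Y" for v w
  proof -
    have eq: "subst f (v * w) - (v * w - d (v * w)) = subst f w * (subst f v - (v - d v))
        + (v - d v) * (subst f w - (w - d w)) + d v * d w"
      by (simp add: hom_mult[OF S] d_mult algebra_simps)
    show ?thesis
      unfolding Y_def mem_Collect_eq eq
      using that by (intro ideal_add[OF J] ideal_mult[OF J] IJ dI) (auto simp: Y_def)
  qed
  have Y_cst: "cst a \<in> Y" for a
  proof -
    have "d (cst a) = 0"
      using partial_cst_mult[of _ a "1 :: 'n cps"] by (simp add: d_def partial_1)
    then show ?thesis by (simp add: Y_def subst_cst[OF f0] ideal_0[OF J])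
  qed
  have Y_coord: "coord i \<in> Y" for i
  proof -
    have "d (coord i) = (\<Sum>l\<in>UNIV. if l = i then ?g $ i else 0)"
      unfolding d_def partial_coord by (intro sum.cong) auto
    then show ?thesis
      by (simp add: Y_def subst_coord[OF f0] fixed_eqs_def ideal_0[OF J])
  qed
  have Y_power: "v ^ n \<in> Y" if "v \<in> Y" for v n
    by (induction n) (use that Y_cst[of 1] in \<open>auto simp: cst_1 intro: Y_mult\<close>)
  have Y_prod: "prod v B \<in> Y" if "\<And>i. i \<in> B \<Longrightarrow> v i \<in> Y" for v and B :: "'n set"
    using that by (induction B rule: infinite_finite_induct) (use Y_cst[of 1] in \<open>auto simp: cst_1 intro: Y_mult\<close>)
  have Y_sum: "sum v B \<in> Y" if "\<And>i. i \<in> B \<Longrightarrow> v i \<in> Y" for v and B :: "'b set"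
    using that by (induction B rule: infinite_finite_induct) (use Y_cst[of 0] in \<open>auto simp: cst_0 intro: Y_add\<close>)
  obtain N C where C: "C *v ?g = (\<chi> i. coord i ^ Suc N)" using prim primary_def by blast
  have xI: "coord i ^ Suc N \<in> ?I" for i
    using subsetD[OF ideal_gen_matrix[of C ?g] rangeI, of i] C by (simp add: fixed_ideal_def)
  \<comment> \<open>x_i^(N+1) lies in I, so x_i^M lies in its square. The exponent
    \<open>Suc M\<close> is used below because differentiation costs one power.\<close>
  define M where "M = Suc N + Suc N"
  have xJ: "coord i ^ M \<in> J" for i unfolding M_def power_add by (rule IJ[OF xI xI])
  have Y_high: "coord i ^ Suc M * w \<in> Y" for i w
  proof -
    have x: "coord i ^ Suc M \<in> J" unfolding power_Suc by (rule ideal_mult[OF J xJ])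
    have dx: "d (coord i ^ Suc M) \<in> J"
      unfolding d_def partial_power diff_Suc_1
      by (intro ideal_sum[OF J] ideal_mult_right[OF J] ideal_mult[OF J xJ])
    have "subst f (coord i ^ Suc M) - (coord i ^ Suc M - d (coord i ^ Suc M)) \<in> J"
      using Y_power[OF Y_coord, of i "Suc M"] unfolding Y_def by (rule CollectD)
    from ideal_add[OF J this ideal_diff[OF J x dx]] have sx: "subst f (coord i ^ Suc M) \<in> J" by simp
    have "subst f (coord i ^ Suc M) * subst f w
        - (coord i ^ Suc M * w - (coord i ^ Suc M * d w + d (coord i ^ Suc M) * w)) \<in> J"
      by (intro ideal_diff[OF J] ideal_add[OF J] ideal_mult_right[OF J] x dx sx)
    then show ?thesis by (simp only: Y_def mem_Collect_eq hom_mult[OF S] d_mult)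
  qed
  obtain w where w: "u = (\<Sum>\<beta> | \<forall>i. \<beta> $ i \<le> M. cst (coeff u \<beta>) * mon \<beta>) + (\<Sum>i\<in>UNIV. coord i ^ Suc M * w i)"
    using box_decomposition by blast
  have "u \<in> Y"
    by (subst w) (intro Y_add Y_sum Y_mult[OF Y_cst] Y_high, auto simp: mon_eq_prod intro: Y_prod Y_power Y_coord)
  then obtain e where e: "\<And>l. e l \<in> ?I" "subst f u - (u - d u) = (\<Sum>l\<in>UNIV. e l * ?g $ l)"
    unfolding Y_def J_def by blast
  have "u - subst f u = d u - (\<Sum>l\<in>UNIV. e l * ?g $ l)" unfolding e(2)[symmetric] by simp
  also have "\<dots> = (\<Sum>l\<in>UNIV. (cps_partial l u - e l) * ?g $ l)"
    by (simp add: d_def left_diff_distrib sum_subtractf)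
  finally show ?thesis using e(1) by blast
qed

lemma is_pullback_iff:
  assumes "\<And>i. coeff (\<phi> $ i) 0 = 0"
  shows "is_pullback \<phi> u v \<longleftrightarrow> v = subst \<phi> u"
  using subst_unique[OF assms, of v u] val_at_subst[OF assms, of u] by (auto simp: is_pullback_def)

lemma map_at_0_iff: "map_at \<phi> 0 = 0 \<longleftrightarrow> (\<forall>i. coeff (\<phi> $ i) 0 = 0)"
  by (simp add: map_at_def vec_eq_iff val_at_0_eq)

text \<open>The change of variables contributes \<open>det (jac \<phi>)\<close> and the passage
  between the two systems of equations contributes \<open>det M\<close>. Their quotient is 1 modulo
  I, which the residue ignores; hence no Jacobian factor relates \<open>h\<close> and
  \<open>h\<^sub>1\<close>.\<close>

lemma residue_fixed_eqs_conjugate: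
  fixes \<phi> f f\<^sub>1 :: "'n::finite cps ^ 'n"
  assumes \<phi>: "adapted_change K \<phi>" and f0: "map_at f 0 = 0" and conj: "is_conjugate \<phi> f f\<^sub>1"
    and h: "is_pullback \<phi> h\<^sub>1 h" and g: "primary (fixed_eqs f)" and g1: "primary (fixed_eqs f\<^sub>1)"
  shows "residue h\<^sub>1 (fixed_eqs f\<^sub>1) = residue h (fixed_eqs f)"
proof -
  let ?g = "fixed_eqs f" and ?I = "fixed_ideal f" and ?J = "det (jac \<phi>)"
  have \<phi>0: "coeff (\<phi> $ i) 0 = 0" for i using \<phi> by (simp add: adapted_change_def map_at_0_iff)
  have J0: "coeff ?J 0 \<noteq> 0" using \<phi> by (simp add: adapted_change_def val_at_0_eq)
  have f0: "coeff (f $ i) 0 = 0" for i using f0 by (simp add: map_at_0_iff)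
  have I: "is_ideal ?I" unfolding fixed_ideal_def by (rule is_ideal_ideal_gen)
  have "subst f (\<phi> $ i) = subst \<phi> (f\<^sub>1 $ i)" for i
  proof (rule subst_unique[OF \<phi>0])
    show "\<forall>\<^sub>F x in nhds 0. val_at (subst f (\<phi> $ i)) x = val_at (f\<^sub>1 $ i) (map_at \<phi> x)"
      using conj[unfolded is_conjugate_def] val_at_subst[OF f0, of "\<phi> $ i"]
    proof eventually_elim
      case (elim x)
      have "map_at \<psi> y $ i = val_at (\<psi> $ i) y" for \<psi> :: "'n cps ^ 'n" and y
        by (simp add: map_at_def)
      then show ?case using arg_cong[OF elim(1), of "\<lambda>v. v $ i"] elim(2) by simp
    qed
  qed
  then have Sg: "subst \<phi> (fixed_eqs f\<^sub>1 $ i) = \<phi> $ i - subst f (\<phi> $ i)" for i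
    by (simp add: fixed_eqs_def hom_diff[OF subst_hom[OF \<phi>0]] subst_coord[OF \<phi>0])
  have "\<forall>i. \<exists>e. (\<forall>l. e l \<in> ?I) \<and>
      \<phi> $ i - subst f (\<phi> $ i) = (\<Sum>l\<in>UNIV. (cps_partial l (\<phi> $ i) - e l) * ?g $ l)"
    using taylor_mod_square[OF f0 g] by blast
  from choice[OF this] obtain e where e: "\<And>i l. e i l \<in> ?I"
    "\<And>i. \<phi> $ i - subst f (\<phi> $ i) = (\<Sum>l\<in>UNIV. (cps_partial l (\<phi> $ i) - e i l) * ?g $ l)" by blast
  define M where "M = (\<chi> i l. jac \<phi> $ i $ l - e i l)"
  have M: "(\<chi> i. subst \<phi> (fixed_eqs f\<^sub>1 $ i)) = M *v ?g"
    by (simp add: Sg e(2) M_def jac_def matrix_vector_mult_def)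
  have JM: "?J - det M \<in> ?I"
    by (rule det_cong_ideal[OF I]) (simp add: M_def e(1))
  have "coeff v 0 = 0" if "v \<in> ?I" for v
  proof -
    have "coeff (coord i) 0 = 0" for i :: 'n by (simp add: coord.rep_eq vec_eq_iff axis_def)
    then have "coeff (?g $ l) 0 = 0" for l by (simp add: fixed_eqs_def f0)
    then show ?thesis
      using that unfolding fixed_ideal_def ideal_gen_range_iff
      by (auto simp: coeff_sum hom_mult[OF hom_const_term])
  qed
  from this[OF JM] J0 have "coeff (det M) 0 \<noteq> 0" by simp
  then obtain w where w: "det M * w = 1" by (rule cps_unit)
  have hS: "h = subst \<phi> h\<^sub>1" using h is_pullback_iff[OF \<phi>0] by blast
  have prim: "primary (M *v ?g)"
    using change_of_variables(1)[OF \<phi>0 J0 g1] M by simp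
  have "residue h\<^sub>1 (fixed_eqs f\<^sub>1) = residue (h * ?J) (M *v ?g)"
    using change_of_variables(2)[OF \<phi>0 J0 g1, of h\<^sub>1] M hS by simp
  also have "h * ?J = det M * (w * (h * ?J))" using w by (simp add: mult.assoc[symmetric])
  also have "residue \<dots> (M *v ?g) = residue (w * (h * ?J)) ?g" by (rule residue_transform[OF prim])
  also have "\<dots> = residue h ?g"
  proof (rule residue_cong_ideal[OF g])
    have "w * (h * ?J) - h = w * (h * ?J) - (det M * w) * h" by (simp add: w)
    also have "\<dots> = (w * h) * (?J - det M)" by (simp add: algebra_simps)
    finally show "w * (h * ?J) - h \<in> ideal_gen (range (($) ?g))"
      using ideal_mult[OF I JM] by (simp add: fixed_ideal_def)
  qed
  finally show ?thesis .
qed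

theorem proposition7p7:
  fixes K :: "('n::{finite,linorder}) set"
    and f q q' :: "('n cps, 'n) vec"
    and A A' :: "(('n cps, 'n) vec, 'n) vec"
    and h :: "'n cps"
  assumes "K \<noteq> {}"
    and "strict_log K f"
    and "isolated_fixed_point f"
    and "normally_admissible K (fixed_ideal f) q"
    and "invertible A" and "q = A *v fixed_eqs f"
    and "normally_admissible K (fixed_ideal f) q'"
    and "invertible A'" and "q' = A' *v fixed_eqs f"
  shows
    "SpTr K q A h = SpTr K q' A' h \<and> SpTr K q' A' h = lambda f h \<and>
     \<comment> \<open>independence of the representative of the class of \<open>h\<close>\<close>
     (\<forall>h\<^sub>1. h\<^sub>1 - h \<in> fixed_ideal f \<longrightarrow>
        SpTr K q A h\<^sub>1 = SpTr K q A h \<and> lambda f h\<^sub>1 = lambda f h) \<and>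
     \<comment> \<open>independence of the adapted coordinates: the function germ \<open>h\<close> is fixed and the
        reference equations are the fixed-point equations in the respective coordinates\<close>
     (\<forall>\<phi> f\<^sub>1 h\<^sub>1 q\<^sub>1 A\<^sub>1.
        adapted_change K \<phi> \<and> is_conjugate \<phi> f f\<^sub>1 \<and> is_pullback \<phi> h\<^sub>1 h \<and>
        normally_admissible K (fixed_ideal f\<^sub>1) q\<^sub>1 \<and>
        invertible A\<^sub>1 \<and> q\<^sub>1 = A\<^sub>1 *v fixed_eqs f\<^sub>1 \<longrightarrow>
        SpTr K q\<^sub>1 A\<^sub>1 h\<^sub>1 = SpTr K q A h) \<and>
     \<comment> \<open>the same, with the numerator form \<open>h dx = h\<^sub>1 dy\<close> and the reference equations
        (transported to the new coordinates) fixed\<close>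
     (\<forall>\<phi> g\<^sub>1 h\<^sub>1 u q\<^sub>1 A\<^sub>1.
        adapted_change K \<phi> \<and> (\<forall>i. is_pullback \<phi> (g\<^sub>1 $ i) (fixed_eqs f $ i)) \<and>
        is_pullback \<phi> h\<^sub>1 u \<and> u * det (jac \<phi>) = h \<and>
        normally_admissible K (ideal_gen (range (($) g\<^sub>1))) q\<^sub>1 \<and>
        invertible A\<^sub>1 \<and> q\<^sub>1 = A\<^sub>1 *v g\<^sub>1 \<longrightarrow>
        SpTr K q\<^sub>1 A\<^sub>1 h\<^sub>1 = SpTr K q A h) \<and>
     \<comment> \<open>the trace of the normal-cone class, whenever this class is defined\<close>
     (\<forall>H. divided_numerator K q A h H \<longrightarrow>
        duality_trace (Sp_log K q H) = lambda f h)"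
proof (intro conjI allI impI)
  have prim: "primary (fixed_eqs f)" and Sp: "\<And>h. SpTr K q A h = lambda f h"
    using SpTr_eq_residue[OF assms(4,6)] by (auto simp: lambda_def)
  show Sp': "SpTr K q' A' h = lambda f h"
    using SpTr_eq_residue[OF assms(7,9)] by (simp add: lambda_def)
  show "SpTr K q A h = SpTr K q' A' h" by (simp add: Sp Sp')
  fix h\<^sub>1 assume "h\<^sub>1 - h \<in> fixed_ideal f"
  then show "lambda f h\<^sub>1 = lambda f h"
    unfolding lambda_def fixed_ideal_def by (rule residue_cong_ideal[OF prim])
  then show "SpTr K q A h\<^sub>1 = SpTr K q A h" by (simp add: Sp)
next
  fix \<phi> f\<^sub>1 h\<^sub>1 q\<^sub>1 A\<^sub>1
  assume *: "adapted_change K \<phi> \<and> is_conjugate \<phi> f f\<^sub>1 \<and> is_pullback \<phi> h\<^sub>1 h \<and>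
    normally_admissible K (fixed_ideal f\<^sub>1) q\<^sub>1 \<and> invertible A\<^sub>1 \<and> q\<^sub>1 = A\<^sub>1 *v fixed_eqs f\<^sub>1"
  then have adm: "normally_admissible K (fixed_ideal f\<^sub>1) q\<^sub>1" and q1: "q\<^sub>1 = A\<^sub>1 *v fixed_eqs f\<^sub>1" by auto
  have "map_at f 0 = 0" using assms(3) by (simp add: isolated_fixed_point_def)
  then show "SpTr K q\<^sub>1 A\<^sub>1 h\<^sub>1 = SpTr K q A h"
    unfolding SpTr_eq_residue(1)[OF adm q1] SpTr_eq_residue(1)[OF assms(4,6)]
    using * residue_fixed_eqs_conjugate SpTr_eq_residue(2)[OF adm q1] SpTr_eq_residue(2)[OF assms(4,6)]
    by blast
next
  fix \<phi> g\<^sub>1 h\<^sub>1 u q\<^sub>1 A\<^sub>1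
  assume *: "adapted_change K \<phi> \<and> (\<forall>i. is_pullback \<phi> (g\<^sub>1 $ i) (fixed_eqs f $ i)) \<and>
    is_pullback \<phi> h\<^sub>1 u \<and> u * det (jac \<phi>) = h \<and>
    normally_admissible K (ideal_gen (range (($) g\<^sub>1))) q\<^sub>1 \<and> invertible A\<^sub>1 \<and> q\<^sub>1 = A\<^sub>1 *v g\<^sub>1"
  then have adm: "normally_admissible K (ideal_gen (range (($) g\<^sub>1))) q\<^sub>1" and q1: "q\<^sub>1 = A\<^sub>1 *v g\<^sub>1" by auto
  have \<phi>0: "coeff (\<phi> $ i) 0 = 0" for i using * by (simp add: adapted_change_def map_at_0_iff)
  have J0: "coeff (det (jac \<phi>)) 0 \<noteq> 0" using * by (simp add: adapted_change_def val_at_0_eq)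
  \<comment> \<open>Here the equations are only transported, so no second determinant cancels the
    Jacobian; it is the one contained in h = u det J.\<close>
  have "fixed_eqs f = (\<chi> i. subst \<phi> (g\<^sub>1 $ i))" "u = subst \<phi> h\<^sub>1"
    using * by (simp_all add: is_pullback_iff[OF \<phi>0] vec_eq_iff)
  then show "SpTr K q\<^sub>1 A\<^sub>1 h\<^sub>1 = SpTr K q A h"
    unfolding SpTr_eq_residue(1)[OF adm q1] SpTr_eq_residue(1)[OF assms(4,6)]
    using * change_of_variables(2)[OF \<phi>0 J0 SpTr_eq_residue(2)[OF adm q1], of h\<^sub>1] by simp
next
  fix H assume "divided_numerator K q A h H"
  then show "duality_trace (Sp_log K q H) = lambda f h"
    unfolding lambda_def by (rule trace_Sp_log[OF assms(4,6)])
qed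

end
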